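(* Let $B=K_{\aleph_0}$ be the countably infinite complete graph. There exist functions $\varepsilon_1,\varepsilon_2\colon\mathbb N_0\to\mathbb R$ with $\varepsilon_1(s)\to0$ and $\varepsilon_2(s)\to 0$ as $s\to\infty$ such that the following holds. Let $s,t\in\mathbb N_0$ and let $G_1,\dots,G_{s+t}\subseteq B$ be infinite graphs such that $G_1,\dots,G_s$ are of order $C_1,\dots,C_s$, respectively, and $G_{s+1},\dots,G_{s+t}$ are ascending. (1) If $$C_1,\dots,C_s\ \ge\ \max\left\{2^{\,t\cdot 2^{(1+\varepsilon_1(s))3s}},\ 2^{2^{(1+\varepsilon_2(s))s}}\right\},$$ then Maker has a winning strategy in $\mathrm{MB}_{\mathrm{col}}(G_1,\dots,G_{s+t})$. (2) If there exists a non-empty set $A\subseteq\{1,\dots,s\}$ such that $$\sum_{j\in A}C_j\ \le\ \frac{m(A)}{e}\cdot 2^{\frac{m(A)}{2}-1},$$ where $e$ is the Euler number, then Breaker has a winning strategy in $\mathrm{MB}_{\mathrm{col}}(G_1,\dots,G_{s+t})$. Moreover, this strategy of Breaker ensures that $G'=\left(\bigcup_{j\in A}G_j\right)\cap K'$ is a graph of order less than $m(A)$ for each infinite clique $K'\subseteq B$ for which Maker has claimed all edges $E(K')$.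
   Context: Two players, Maker and Breaker, alternately claim previously unclaimed edges of $B=K_{\aleph_0}$, one edge per move; Maker moves first and the game lasts $\omega$ moves. Given graphs $G_1,\dots,G_k\subseteq B$ (not necessarily disjoint, not necessarily covering $E(B)$), Maker wins the color preserving game $\mathrm{MB}_{\mathrm{col}}(G_1,\dots,G_k)$ if there is a copy $K\subseteq B$ of $K_{\aleph_0}$, all of whose edges have been claimed by Maker, with $|E(K)\cap E(G_i)|=\aleph_0$ for all $i\in\{1,\dots,k\}$; otherwise Breaker wins. An infinite graph here means one with infinitely many edges. A graph $G$ is called ascending if there is a sequence of distinct vertices $(v_j)_{j\in\mathbb N}$ of $G$ with $d_G(v_j)\ge j$ for all $j$. A graph $G$ is said to be of order $C$, for $C\in\mathbb N_0$, if there is a vertex set $S$ of size $C$ such that the maximum degree $\Delta(G-S)$ is finite and $d_G(v)=\aleph_0$ for all $v\in S$ (finite graphs are of order $0$ in this sense). Every infinite subgraph of $B$ is either ascending or of order $C$ for a unique $C\in\mathbb N_0$, and not both. For $A\subseteq\{1,\dots,s+t\}$, $m(A)$ is the minimum size of a finite vertex set $W\subseteq V(B)$ such that for each $j\in A$ there is $v\in W$ with $d_{G_j}(v)=\aleph_0$; if no such set exists, $m(A)=\infty$ (in which case the right-hand side of the inequality in (2) is $\infty$, and "order less than $m(A)$" means of some finite order). *)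

theory Defs
  imports Complex_Main "HOL-Library.Ramsey" "HOL-Library.Extended_Real"
begin

section \<open>Graphs\<close>

text \<open>Simple graphs with vertices in \<^typ>\<open>nat\<close>; edges are two-element sets of vertices.
  The board is the complete graph on all of \<^typ>\<open>nat\<close>.\<close>

record graph =
  verts :: "nat set"
  edges :: "nat set set"

definition complete_graph :: "nat set \<Rightarrow> graph" where
  "complete_graph V = \<lparr>verts = V, edges = nsets V 2\<rparr>"

definition board :: graph where
  "board = complete_graph UNIV"

definition wf_graph :: "graph \<Rightarrow> bool" where
  "wf_graph G \<longleftrightarrow> edges G \<subseteq> nsets (verts G) 2"

definition subgraph :: "graph \<Rightarrow> graph \<Rightarrow> bool" where
  "subgraph H G \<longleftrightarrow> wf_graph H \<and> wf_graph G \<and> verts H \<subseteq> verts G \<and> edges H \<subseteq> edges G"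

definition infinite_graph :: "graph \<Rightarrow> bool" where
  "infinite_graph G \<longleftrightarrow> infinite (edges G)"

definition graph_Inter :: "graph \<Rightarrow> graph \<Rightarrow> graph" where
  "graph_Inter G H = \<lparr>verts = verts G \<inter> verts H, edges = edges G \<inter> edges H\<rparr>"

definition graph_Union :: "(nat \<Rightarrow> graph) \<Rightarrow> nat set \<Rightarrow> graph" where
  "graph_Union G A = \<lparr>verts = (\<Union>j\<in>A. verts (G j)), edges = (\<Union>j\<in>A. edges (G j))\<rparr>"

definition delete_verts :: "graph \<Rightarrow> nat set \<Rightarrow> graph" where
  "delete_verts G S = \<lparr>verts = verts G - S, edges = {e \<in> edges G. e \<inter> S = {}}\<rparr>"

text \<open>All graphs here are countable, so \<^term>\<open>\<infinity> :: enat\<close> stands for the degree \<open>\<aleph>\<^sub>0\<close>.\<close>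

definition degree :: "graph \<Rightarrow> nat \<Rightarrow> enat" where
  "degree G v =
     (let I = {e \<in> edges G. v \<in> e} in if finite I then enat (card I) else \<infinity>)"

definition max_degree :: "graph \<Rightarrow> enat" where
  "max_degree G = (SUP v\<in>verts G. degree G v)"

definition ascending :: "graph \<Rightarrow> bool" where
  "ascending G \<longleftrightarrow>
     (\<exists>v :: nat \<Rightarrow> nat. inj v \<and> (\<forall>j. v j \<in> verts G \<and> enat j \<le> degree G (v j)))"

definition has_order :: "graph \<Rightarrow> nat \<Rightarrow> bool" where
  "has_order G C \<longleftrightarrow>
     (\<exists>S \<subseteq> verts G. finite S \<and> card S = C \<and>
        max_degree (delete_verts G S) < \<infinity> \<and> (\<forall>v\<in>S. degree G v = \<infinity>))"

text \<open>The number \<open>m(A)\<close> of the family \<open>G\<close>. The infimum of the empty set in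
  \<^typ>\<open>enat\<close> is \<open>\<infinity>\<close>, as required if no suitable set \<open>W\<close> exists.\<close>

definition cover_number :: "(nat \<Rightarrow> graph) \<Rightarrow> nat set \<Rightarrow> enat" where
  "cover_number G A =
     (INF W\<in>{W. finite W \<and> W \<subseteq> verts board \<and> (\<forall>j\<in>A. \<exists>v\<in>W. degree (G j) v = \<infinity>)}.
        enat (card W))"

text \<open>The function \<open>m \<mapsto> (m / e) * 2 powr (m / 2 - 1)\<close>, extended by \<open>\<infinity> \<mapsto> \<infinity>\<close>.\<close>

definition breaker_bound :: "enat \<Rightarrow> ereal" where
  "breaker_bound m =
     (case m of enat k \<Rightarrow> ereal (real k / exp 1 * 2 powr (real k / 2 - 1)) | \<infinity> \<Rightarrow> \<infinity>)"

section \<open>The game\<close>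

text \<open>A play lists the claimed edges in order: Maker claims \<open>p 0, p 2, \<dots>\<close> and
  Breaker \<open>p 1, p 3, \<dots>\<close>.\<close>

definition is_play :: "(nat \<Rightarrow> nat set) \<Rightarrow> bool" where
  "is_play p \<longleftrightarrow> inj p \<and> range p \<subseteq> edges board"

definition maker_edges :: "(nat \<Rightarrow> nat set) \<Rightarrow> nat set set" where
  "maker_edges p = {p (2 * n) | n. True}"

text \<open>A strategy maps the history, i.e. the list of all edges claimed so far by both players,
  to the next move. It has to name an unclaimed edge at every position; without this
  requirement an illegal strategy would be followed by no play and hence win vacuously.\<close>

definition is_position :: "nat set list \<Rightarrow> bool" where
  "is_position h \<longleftrightarrow> distinct h \<and> set h \<subseteq> edges board"

definition is_strategy :: "(nat set list \<Rightarrow> nat set) \<Rightarrow> bool" where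
  "is_strategy \<sigma> \<longleftrightarrow> (\<forall>h. is_position h \<longrightarrow> \<sigma> h \<in> edges board - set h)"

definition maker_ensures ::
  "(nat set list \<Rightarrow> nat set) \<Rightarrow> ((nat \<Rightarrow> nat set) \<Rightarrow> bool) \<Rightarrow> bool" where
  "maker_ensures \<sigma> Q \<longleftrightarrow>
     (\<forall>p. is_play p \<and> (\<forall>n. p (2 * n) = \<sigma> (map p [0..<2 * n])) \<longrightarrow> Q p)"

definition breaker_ensures ::
  "(nat set list \<Rightarrow> nat set) \<Rightarrow> ((nat \<Rightarrow> nat set) \<Rightarrow> bool) \<Rightarrow> bool" where
  "breaker_ensures \<sigma> Q \<longleftrightarrow>
     (\<forall>p. is_play p \<and> (\<forall>n. p (2 * n + 1) = \<sigma> (map p [0..<2 * n + 1])) \<longrightarrow> Q p)"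

text \<open>\<open>K\<close> is a copy of the countably infinite complete graph on the board all of whose
  edges have been claimed by Maker in the play \<open>p\<close>.\<close>

definition maker_clique :: "(nat \<Rightarrow> nat set) \<Rightarrow> graph \<Rightarrow> bool" where
  "maker_clique p K \<longleftrightarrow>
     subgraph K board \<and> infinite (verts K) \<and> K = complete_graph (verts K) \<and>
     edges K \<subseteq> maker_edges p"

text \<open>The color preserving game for the graphs \<open>G i\<close> with \<open>i \<in> I\<close>.\<close>

definition maker_wins_col :: "(nat \<Rightarrow> graph) \<Rightarrow> nat set \<Rightarrow> (nat \<Rightarrow> nat set) \<Rightarrow> bool" where
  "maker_wins_col G I p \<longleftrightarrow>
     (\<exists>K. maker_clique p K \<and> (\<forall>i\<in>I. infinite (edges K \<inter> edges (G i))))"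

definition maker_winning_strategy ::
  "(nat \<Rightarrow> graph) \<Rightarrow> nat set \<Rightarrow> (nat set list \<Rightarrow> nat set) \<Rightarrow> bool" where
  "maker_winning_strategy G I \<sigma> \<longleftrightarrow> is_strategy \<sigma> \<and> maker_ensures \<sigma> (maker_wins_col G I)"

definition breaker_winning_strategy ::
  "(nat \<Rightarrow> graph) \<Rightarrow> nat set \<Rightarrow> (nat set list \<Rightarrow> nat set) \<Rightarrow> bool" where
  "breaker_winning_strategy G I \<sigma> \<longleftrightarrow>
     is_strategy \<sigma> \<and> breaker_ensures \<sigma> (\<lambda>p. \<not> maker_wins_col G I p)"

end

theory Submission
  imports Defs "HOL-Library.Disjoint_Sets" "HOL-Real_Asymp.Real_Asymp"
begin

text \<open>
  Maker's part. Choose disjoint sets \<open>U j\<close> of \<open>c\<close> vertices of infinite degree in \<open>G j\<close>.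
  A weight argument in the style of Beck first gives Maker a \<open>2 ^ (- s\<^sup>2)\<close> fraction of all
  tuples in the product of the \<open>U j\<close> as cliques. She then builds blocks of fresh vertices, one after
  another, each joined to a set that meets all classes of all older blocks and to all tuples that are
  still alive. A fresh vertex is joined in a star game in which every class keeps half of its
  vertices and the weighted number of living tuples loses a factor \<open>2 ^ s\<close>, up to an error of
  lower order in \<open>c\<close>; by pigeonhole the outcome is the same for many fresh vertices. So it suffices
  that \<open>log c\<close> is of order \<open>s\<^sup>2 + s t\<close>. Along a diagonal subsequence of the blocks the
  tuple and all links stabilise, and one transversal per block together with the tuple is the clique.

  Breaker's part. Let \<open>S\<close> be the set of all vertices of infinite degree in some \<open>G j\<close> with
  \<open>j \<in> A\<close>. Inside \<open>S\<close> Breaker plays the Erdos--Selfridge strategy against cliques of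
  size \<open>m(A)\<close>, so a clique of Maker misses the vertices of infinite degree of some \<open>G j\<close>.
  The edges of the \<open>G j\<close> outside \<open>S\<close> form a graph of bounded degree, and a pairing strategy
  obtained from a colouring at distance two leaves only finitely many of them in a clique of Maker.
\<close>

section \<open>Forced positions and strategies\<close>

text \<open>Each block costs a constant factor of tuples and classes, and there are infinitely many
  blocks, so losses must not accumulate. Hence every stage starts again from all old vertices and
  all tuples completed at the beginning, whatever the links of earlier blocks are. The price is that
  a block cannot be one fixed clique: it offers classes, and the transversal that is used is known
  only in the limit. A stage has about \<open>s * c\<close> tasks, so a constant factor per task
  would be fatal as well. But a root concerns only the tuples through it, so a tuple is affected by
  at most \<open>s + t\<close> tasks, and a weight that grows with each of them keeps the total from
  dropping by more than the error terms. A root task has an error of relative order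
  \<open>1 / c ^ 2\<close>, all \<open>s * c\<close> of them together one of order
  \<open>1 / c\<close>. Vertices of an ascending graph may have finite degree. The centre of a star
  is therefore chosen with a degree above the number of all vertices touched until the star is
  finished, and the claims about fresh vertices carry explicit bounds on the number of
  moves.\<close>

abbreviation board_edges :: "nat set set" where
  "board_edges \<equiv> edges board"

lemma board_edges_eq: "board_edges = nsets UNIV 2"
  by (simp add: board_def complete_graph_def)

lemma doubleton_board [simp]: "{x, y} \<in> board_edges \<longleftrightarrow> x \<noteq> y"
  by (simp add: board_edges_eq)

lemma infinite_board_edges: "infinite board_edges"
proof -
  have "inj (\<lambda>n::nat. {0, Suc n})"
    by (auto simp: inj_def doubleton_eq_iff)
  moreover have "range (\<lambda>n::nat. {0, Suc n}) \<subseteq> board_edges" by auto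
  ultimately show ?thesis
    using range_inj_infinite finite_subset by blast
qed

text \<open>These are positions after full rounds, with Maker to move. Equal cardinalities make
  \<open>card M\<close> control the number of all touched vertices.\<close>

definition legal :: "nat set set \<Rightarrow> nat set set \<Rightarrow> bool" where
  "legal M B \<longleftrightarrow> finite M \<and> finite B \<and> M \<inter> B = {} \<and> M \<union> B \<subseteq> board_edges \<and> card M = card B"

lemma legal_finite: "legal M B \<Longrightarrow> finite (M \<union> B)"
  by (simp add: legal_def)

lemma legal_step:
  assumes "legal M B" "e \<in> board_edges - (M \<union> B)" "f \<in> board_edges - (insert e M \<union> B)"
  shows "legal (insert e M) (insert f B)"
  using assms by (auto simp: legal_def)

text \<open>Maker, being to move, can reach \<open>Q\<close> within finitely many rounds. The
  inductive form allows infinitely many replies \<open>f\<close> and needs no uniform bound on the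
  number of rounds.\<close>

inductive force :: "(nat set set \<Rightarrow> nat set set \<Rightarrow> bool) \<Rightarrow> nat set set \<Rightarrow> nat set set \<Rightarrow> bool" for Q where
  force_done: "Q M B \<Longrightarrow> force Q M B"
| force_move: "e \<in> board_edges - (M \<union> B) \<Longrightarrow>
    (\<And>f. f \<in> board_edges - (insert e M \<union> B) \<Longrightarrow> force Q (insert e M) (insert f B)) \<Longrightarrow> force Q M B"

lemma force_legal_trans:
  assumes "force Q M B" "legal M B"
    and "\<And>M' B'. Q M' B' \<Longrightarrow> legal M' B' \<Longrightarrow> force R M' B'"
  shows "force R M B"
  using assms(1,2)
proof (induction rule: force.induct)
  case (force_done M B)
  then show ?case using assms(3) by blast
next
  case (force_move e M B)
  show ?case
    by (rule force.force_move[OF force_move(1)]) (use force_move legal_step in blast)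
qed

lemma force_mono:
  assumes "force Q M B" "legal M B" "\<And>M' B'. Q M' B' \<Longrightarrow> legal M' B' \<Longrightarrow> R M' B'"
  shows "force R M B"
  using force_legal_trans[OF assms(1,2)] assms(3) force_done by blast

section \<open>Winning trees and the strategies that follow them\<close>

datatype strat = Done | Move "nat set" "nat set \<Rightarrow> strat"

primrec wins :: "strat \<Rightarrow> (nat set set \<Rightarrow> nat set set \<Rightarrow> bool) \<Rightarrow> nat set set \<Rightarrow> nat set set \<Rightarrow> bool" where
  "wins Done Q M B = Q M B"
| "wins (Move e k) Q M B = (e \<in> board_edges - (M \<union> B) \<and>
     (\<forall>f \<in> board_edges - (insert e M \<union> B). wins (k f) Q (insert e M) (insert f B)))"

text \<open>A derivation of \<open>force\<close> only asserts existence; choice over the infinitely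
  many Breaker moves turns it into a tree that a strategy can descend.\<close>

lemma force_imp_wins: "force Q M B \<Longrightarrow> \<exists>t. wins t Q M B"
proof (induction rule: force.induct)
  case (force_done M B)
  then show ?case by (intro exI[of _ Done]) simp
next
  case (force_move e M B)
  then have "\<forall>f \<in> board_edges - (insert e M \<union> B). \<exists>t. wins t Q (insert e M) (insert f B)"
    by blast
  then obtain k where "\<forall>f \<in> board_edges - (insert e M \<union> B). wins (k f) Q (insert e M) (insert f B)"
    by metis
  then have "wins (Move e k) Q M B" using force_move.hyps(1) by simp
  then show ?case by blast
qed

lemma ex_unclaimed: "finite X \<Longrightarrow> \<exists>e. e \<in> board_edges - X"
  using Diff_infinite_finite[OF _ infinite_board_edges] by (metis equals0I finite.emptyI)

lemma set_play_prefix: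
  "set (map p [0..<2 * n]) = {p (2 * i) |i. i < n} \<union> {p (2 * i + 1) |i. i < n}"
proof -
  have "{0..<2 * n} = (\<lambda>i. 2 * i) ` {..<n} \<union> (\<lambda>i. 2 * i + 1) ` {..<n}"
  proof (intro set_eqI iffI)
    fix j assume "j \<in> {0..<2 * n}"
    then show "j \<in> (\<lambda>i. 2 * i) ` {..<n} \<union> (\<lambda>i. 2 * i + 1) ` {..<n}"
      by (cases "even j") (auto elim!: evenE oddE)
  qed auto
  then have "p ` {0..<2 * n} = (\<lambda>i. p (2 * i)) ` {..<n} \<union> (\<lambda>i. p (2 * i + 1)) ` {..<n}"
    by (simp add: image_Un image_image)
  then show ?thesis by (auto simp: setcompr_eq_image)
qed

lemma some_unclaimed: "(SOME e. e \<in> board_edges - set h) \<in> board_edges - set h"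
  by (rule someI_ex, rule ex_unclaimed) simp

text \<open>\<open>Start\<close> describes positions at which a new goal is set and may depend on
  Breaker's edges; \<open>Inv\<close> depends on Maker's edges alone and, being monotone, survives
  the rest of the play. \<open>progress\<close> asks for at least one move towards each goal, so
  that Maker never faces the tree \<open>Done\<close>.\<close>

locale maker_framework =
  fixes Start :: "'a \<Rightarrow> nat set set \<Rightarrow> nat set set \<Rightarrow> bool"
    and Inv :: "'a \<Rightarrow> nat set set \<Rightarrow> bool" and stp :: "'a \<Rightarrow> 'a \<Rightarrow> bool" and a0 :: 'a
  assumes init: "Start a0 {} {}"
    and Start_Inv: "\<And>a M B. Start a M B \<Longrightarrow> Inv a M"
    and Inv_mono: "\<And>a M M'. Inv a M \<Longrightarrow> M \<subseteq> M' \<Longrightarrow> Inv a M'"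
    and progress: "\<And>a M B. legal M B \<Longrightarrow> Start a M B \<Longrightarrow>
      \<exists>e \<in> board_edges - (M \<union> B). \<forall>f \<in> board_edges - (insert e M \<union> B).
        force (\<lambda>M' B'. \<exists>a'. stp a a' \<and> Start a' M' B') (insert e M) (insert f B)"
begin

definition goal where "goal a = (\<lambda>M' B'. \<exists>a'. stp a a' \<and> Start a' M' B')"

definition tree where "tree a M B = (SOME t. t \<noteq> Done \<and> wins t (goal a) M B)"

lemma tree:
  assumes "legal M B" "Start a M B"
  shows "tree a M B \<noteq> Done \<and> wins (tree a M B) (goal a) M B"
proof -
  obtain e where e: "e \<in> board_edges - (M \<union> B)" and
    "\<forall>f \<in> board_edges - (insert e M \<union> B). force (goal a) (insert e M) (insert f B)"
    using progress[OF assms] by (auto simp: goal_def)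
  then have "\<forall>f \<in> board_edges - (insert e M \<union> B). \<exists>t. wins t (goal a) (insert e M) (insert f B)"
    using force_imp_wins by blast
  then obtain k where "\<forall>f \<in> board_edges - (insert e M \<union> B). wins (k f) (goal a) (insert e M) (insert f B)"
    by metis
  with e have "Move e k \<noteq> Done \<and> wins (Move e k) (goal a) M B" by simp
  then show ?thesis unfolding tree_def by (rule someI)
qed

text \<open>A tree that has run out is replaced at once by one for the next goal, so the current
  tree always has a move ready.\<close>

fun nxt :: "'a \<times> strat \<times> nat set set \<times> nat set set \<Rightarrow> nat set \<Rightarrow> 'a \<times> strat \<times> nat set set \<times> nat set set" where
  "nxt (a, Move e k, M, B) f =
     (if k f = Done
      then (let a' = (SOME a'. stp a a' \<and> Start a' (insert e M) (insert f B))
            in (a', tree a' (insert e M) (insert f B), insert e M, insert f B))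
      else (a, k f, insert e M, insert f B))"
| "nxt (a, Done, M, B) f = (a, Done, M, B)"

text \<open>Only Breaker's moves are read, since Maker's are prescribed by the tree. Hence the state
  after \<open>n\<close> rounds can be computed from a finite history.\<close>

primrec state where
  "state 0 p = (a0, tree a0 {} {}, {}, {})"
| "state (Suc n) p = nxt (state n p) (p (2 * n + 1))"

lemma state_cong: "(\<And>i. i < 2 * n \<Longrightarrow> p i = q i) \<Longrightarrow> state n p = state n q"
  by (induction n) auto

definition move where "move n p = (case state n p of (a, Move e k, M, B) \<Rightarrow> e | _ \<Rightarrow> {})"

text \<open>The fallback makes the function legal at histories that do not arise from following
  it.\<close>

definition strategy where
  "strategy h = (let e = move (length h div 2) ((!) h) in
     if e \<in> board_edges - set h then e else (SOME e. e \<in> board_edges - set h))"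

lemma is_strategy_strategy: "is_strategy strategy"
  unfolding is_strategy_def strategy_def Let_def using some_unclaimed by (auto simp del: Diff_iff)

definition good where
  "good s = (case s of (a, t, M, B) \<Rightarrow> legal M B \<and> Inv a M \<and> t \<noteq> Done \<and> wins t (goal a) M B)"

lemma good_nxt:
  assumes "good (a, Move e k, M, B)" "f \<in> board_edges - (insert e M \<union> B)"
  shows "good (nxt (a, Move e k, M, B) f)"
    and "k f = Done \<Longrightarrow> stp a (fst (nxt (a, Move e k, M, B) f))"
proof -
  have e: "e \<in> board_edges - (M \<union> B)" and w: "wins (k f) (goal a) (insert e M) (insert f B)"
    and l: "legal M B" and I: "Inv a M"
    using assms by (auto simp: good_def)
  have l': "legal (insert e M) (insert f B)" using l e assms(2) by (rule legal_step)
  define a' where "a' = (SOME a'. stp a a' \<and> Start a' (insert e M) (insert f B))"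
  have a': "stp a a' \<and> Start a' (insert e M) (insert f B)" if "k f = Done"
    using w that someI_ex[of "\<lambda>a'. stp a a' \<and> Start a' (insert e M) (insert f B)"]
    unfolding a'_def goal_def by auto
  show "good (nxt (a, Move e k, M, B) f)"
  proof (cases "k f = Done")
    case True
    then show ?thesis using a' l' tree[OF l'] Start_Inv[of a'] by (auto simp add: good_def a'_def[symmetric] Let_def)
  next
    case False
    then show ?thesis using w l' Inv_mono[OF I] by (auto simp add: good_def)
  qed
  show "k f = Done \<Longrightarrow> stp a (fst (nxt (a, Move e k, M, B) f))"
    using a' by (simp add: a'_def[symmetric] Let_def)
qed

context
  fixes p assumes play: "is_play p" and follows: "\<And>n. p (2 * n) = strategy (map p [0..<2 * n])"
begin

lemma state_inv:
  "good (state n p) \<and> (\<exists>a t. state n p = (a, t, {p (2 * i) |i. i < n}, {p (2 * i + 1) |i. i < n}))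
   \<and> p (2 * n) = move n p"
proof (induction n)
  case 0
  have g: "good (state 0 p)"
    using tree[OF _ init] Start_Inv[OF init] by (simp add: good_def legal_def)
  then obtain e k where "tree a0 {} {} = Move e k" "e \<in> board_edges"
    by (cases "tree a0 {} {}") (auto simp: good_def)
  then have "p 0 = move 0 p" using follows[of 0]
    by (simp add: strategy_def move_def)
  with g show ?case by auto
next
  case (Suc n)
  then obtain a t where st: "state n p = (a, t, {p (2 * i) |i. i < n}, {p (2 * i + 1) |i. i < n})" (is "_ = (_, _, ?M, ?B)")
    by blast
  with Suc obtain e k where t: "t = Move e k" by (cases t) (auto simp: good_def)
  have e: "p (2 * n) = e" using Suc st t by (simp add: move_def)
  have inj: "inj p" and E: "\<And>i. p i \<in> board_edges" using play by (auto simp: is_play_def)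
  have f: "p (2 * n + 1) \<in> board_edges - (insert e ?M \<union> ?B)"
  proof -
    have "p (2 * n + 1) \<notin> insert e ?M \<union> ?B" using e by (auto simp: inj_eq[OF inj] Suc_double_not_eq_double)
    then show ?thesis using E by blast
  qed
  have M': "insert e ?M = {p (2 * i) |i. i < Suc n}"
    using e by (auto simp only: less_Suc_eq)
  have B': "insert (p (2 * n + 1)) ?B = {p (2 * i + 1) |i. i < Suc n}"
    unfolding less_Suc_eq by blast
  have g: "good (state (Suc n) p)" using good_nxt(1)[of a e k ?M ?B, OF _ f] Suc st t by simp
  have st': "\<exists>a t. state (Suc n) p = (a, t, {p (2 * i) |i. i < Suc n}, {p (2 * i + 1) |i. i < Suc n})"
    by (simp add: st t M' B'[simplified] Let_def)
  then obtain a' t' where st'': "state (Suc n) p = (a', t', {p (2 * i) |i. i < Suc n}, {p (2 * i + 1) |i. i < Suc n})"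
    by blast
  with g obtain e' k' where t': "t' = Move e' k'" by (cases t') (auto simp: good_def)
  have e': "e' \<in> board_edges - ({p (2 * i) |i. i < Suc n} \<union> {p (2 * i + 1) |i. i < Suc n})"
    using g st'' t' by (auto simp: good_def)
  have "set (map p [0..<2 * Suc n]) = {p (2 * i) |i. i < Suc n} \<union> {p (2 * i + 1) |i. i < Suc n}"
    by (rule set_play_prefix)
  then have e'': "e' \<in> board_edges - set (map p [0..<2 * Suc n])" using e' by simp
  \<comment> \<open>The strategy evaluates \<open>move\<close> on the history, not on the play; both
    agree on the entries that the state reads.\<close>
  have "move (length (map p [0..<2 * Suc n]) div 2) ((!) (map p [0..<2 * Suc n])) = move (Suc n) p"
  proof -
    have "state (Suc n) ((!) (map p [0..<2 * Suc n])) = state (Suc n) p"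
      by (rule state_cong) (simp del: upt_Suc)
    then show ?thesis by (simp add: move_def del: upt_Suc state.simps)
  qed
  also have "move (Suc n) p = e'" using st'' t' by (simp add: move_def)
  finally have "p (2 * Suc n) = e'"
    using follows[of "Suc n"] e'' by (simp add: strategy_def del: upt_Suc)
  then show ?case using g st' st'' t' by (simp add: move_def)
qed

text \<open>Each round descends to a subtree, so induction on the tree shows that the next goal is
  reached.\<close>

lemma state_eventually_steps:
  "state n p = (a, t, M, B) \<Longrightarrow> \<exists>m>n. stp a (fst (state m p))"
proof (induction t arbitrary: n M B)
  case Done
  then show ?case using state_inv[of n] by (simp add: good_def)
next
  case (Move e k)
  have g: "good (a, Move e k, M, B)" using state_inv[of n] Move(2) by metis
  have MB: "M = {p (2 * i) |i. i < n}" "B = {p (2 * i + 1) |i. i < n}" and e: "p (2 * n) = e"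
    using state_inv[of n] Move(2) by (auto simp: move_def)
  have inj: "inj p" and E: "\<And>i. p i \<in> board_edges" using play by (auto simp: is_play_def)
  have "p (2 * n + 1) \<notin> insert e M \<union> B" using e MB by (auto simp: inj_eq[OF inj] Suc_double_not_eq_double)
  then have f: "p (2 * n + 1) \<in> board_edges - (insert e M \<union> B)" using E by blast
  show ?case
  proof (cases "k (p (2 * n + 1)) = Done")
    case True
    then have "stp a (fst (state (Suc n) p))" using good_nxt(2)[OF g f] Move(2) by simp
    then show ?thesis by blast
  next
    case False
    then have "state (Suc n) p = (a, k (p (2 * n + 1)), insert e M, insert (p (2 * n + 1)) B)"
      using Move(2) by simp
    with Move(1)[of "k (p (2 * n + 1))"] obtain m where "m > Suc n" "stp a (fst (state m p))" by blast
    then show ?thesis by (meson Suc_lessD)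
  qed
qed

text \<open>Each invariant holds at some finite time and passes to the set of all Maker edges by
  monotonicity.\<close>

lemma ghost_sequence:
  "\<exists>\<alpha>. \<alpha> 0 = a0 \<and> (\<forall>n. stp (\<alpha> n) (\<alpha> (Suc n)) \<and> Inv (\<alpha> n) (maker_edges p))"
proof -
  have "\<exists>m>n. stp (fst (state n p)) (fst (state m p))" for n
    using state_eventually_steps[of n] by (metis prod.collapse)
  then obtain g where g: "\<And>n. stp (fst (state n p)) (fst (state (g n) p))" by metis
  define \<alpha> where "\<alpha> n = fst (state ((g ^^ n) 0) p)" for n
  have "Inv (fst (state n p)) (maker_edges p)" for n
  proof -
    obtain a t where st: "state n p = (a, t, {p (2 * i) |i. i < n}, {p (2 * i + 1) |i. i < n})"
      using state_inv[of n] by blast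
    then have "Inv a {p (2 * i) |i. i < n}" using state_inv[of n] by (simp add: good_def)
    then have "Inv a (maker_edges p)" by (rule Inv_mono) (auto simp: maker_edges_def)
    then show ?thesis using st by simp
  qed
  moreover have "\<alpha> 0 = a0" by (simp add: \<alpha>_def)
  moreover have "stp (\<alpha> n) (\<alpha> (Suc n))" for n using g by (simp add: \<alpha>_def)
  ultimately show ?thesis by (intro exI[of _ \<alpha>]) (simp add: \<alpha>_def)
qed

end

theorem ghost_strategy:
  "is_strategy strategy \<and> maker_ensures strategy
     (\<lambda>p. \<exists>\<alpha>. \<alpha> 0 = a0 \<and> (\<forall>n. stp (\<alpha> n) (\<alpha> (Suc n)) \<and> Inv (\<alpha> n) (maker_edges p)))"
  using is_strategy_strategy ghost_sequence by (auto simp: maker_ensures_def)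

end

text \<open>The added state \<^term>\<open>None\<close> covers the moves until \<^term>\<open>a0\<close> is reached.\<close>

theorem maker_strategy_from_invariant:
  fixes Inv :: "'a \<Rightarrow> nat set set \<Rightarrow> bool"
  assumes init: "force (\<lambda>M B. Inv a0 M) {} {}"
    and mono: "\<And>a M M'. Inv a M \<Longrightarrow> M \<subseteq> M' \<Longrightarrow> Inv a M'"
    and progress: "\<And>a M B. legal M B \<Longrightarrow> Inv a M \<Longrightarrow> force (\<lambda>M' B'. \<exists>a'. stp a a' \<and> Inv a' M') M B"
  shows "\<exists>\<sigma>. is_strategy \<sigma> \<and> maker_ensures \<sigma>
     (\<lambda>p. \<exists>\<alpha>. \<alpha> 0 = a0 \<and> (\<forall>n. stp (\<alpha> n) (\<alpha> (Suc n)) \<and> Inv (\<alpha> n) (maker_edges p)))"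
  (is "\<exists>\<sigma>. _ \<and> maker_ensures \<sigma> ?R")
proof -
  define Inv' where "Inv' x M = (case x of None \<Rightarrow> True | Some a \<Rightarrow> Inv a M)" for x M
  define Start where "Start x M (B :: nat set set) =
    (case x of None \<Rightarrow> M = {} \<and> B = {} | Some a \<Rightarrow> Inv a M)" for x M B
  define stp' where "stp' x y = (case x of None \<Rightarrow> y = Some a0 |
    Some a \<Rightarrow> (\<exists>b. y = Some b \<and> stp a b))" for x y
  interpret maker_framework Start Inv' stp' None
  proof
    show "Start None {} {}" by (simp add: Start_def)
    show "Start a M B \<Longrightarrow> Inv' a M" for a M B
      by (auto simp: Start_def Inv'_def split: option.splits)
    show "Inv' a M \<Longrightarrow> M \<subseteq> M' \<Longrightarrow> Inv' a M'" for a M M'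
      using mono by (auto simp: Inv'_def split: option.splits)
  next
    fix x M B assume l: "legal M B" and S: "Start x M B"
    let ?Q = "\<lambda>M' B'. \<exists>a'. stp' x a' \<and> Start a' M' B'"
    \<comment> \<open>An arbitrary free edge. The framework insists on a move even if the goal
      already holds, and by monotonicity an additional Maker edge does no harm.\<close>
    obtain d where d: "d \<in> board_edges - (M \<union> B)" using ex_unclaimed[OF legal_finite[OF l]] by blast
    show "\<exists>e \<in> board_edges - (M \<union> B). \<forall>f \<in> board_edges - (insert e M \<union> B). force ?Q (insert e M) (insert f B)"
    proof (cases x)
      case None
      then have [simp]: "M = {}" "B = {}" using S by (auto simp: Start_def)
      have Q: "force ?Q M' B'" if "force (\<lambda>M B. Inv a0 M) M' B'" "legal M' B'" for M' B'
        using that by (rule force_mono) (auto simp: None stp'_def Start_def)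
      from init show ?thesis
      proof cases
        case force_done
        have "force ?Q (insert d M) (insert f B)" for f
          by (rule force.force_done) (auto simp: None stp'_def Start_def intro: mono[OF force_done])
        then show ?thesis using d by blast
      next
        case (force_move e)
        have "force ?Q (insert e M) (insert f B)" if "f \<in> board_edges - (insert e M \<union> B)" for f
          by (rule Q) (use force_move that legal_step[OF l] in auto)
        then show ?thesis using force_move by auto
      qed
    next
      case (Some a)
      have "force ?Q (insert d M) (insert f B)" if "f \<in> board_edges - (insert d M \<union> B)" for f
      proof (rule force_mono[OF progress[of _ _ a]])
        show "legal (insert d M) (insert f B)" "legal (insert d M) (insert f B)" using legal_step[OF l d that] by auto
        have "Inv a M" using S by (simp add: Some Start_def)
        then show "Inv a (insert d M)" by (rule mono) blast
      qed (auto simp: Some stp'_def Start_def)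
      then show ?thesis using d by blast
    qed
  qed
  show ?thesis
  proof (intro exI conjI)
    show "is_strategy strategy" using ghost_strategy by blast
    show "maker_ensures strategy ?R"
      unfolding maker_ensures_def
    proof (intro allI impI)
      fix p assume "is_play p \<and> (\<forall>n. p (2 * n) = strategy (map p [0..<2 * n]))"
      then obtain \<alpha> where \<alpha>: "\<alpha> 0 = None" "\<And>n. stp' (\<alpha> n) (\<alpha> (Suc n))" "\<And>n. Inv' (\<alpha> n) (maker_edges p)"
        using ghost_strategy unfolding maker_ensures_def by blast
      define \<beta> where "\<beta> n = the (\<alpha> (Suc n))" for n
      have some: "\<alpha> (Suc n) = Some (\<beta> n)" for n
        using \<alpha>(2)[of n] by (auto simp: stp'_def \<beta>_def split: option.splits)
      have "\<beta> 0 = a0" using \<alpha>(1) \<alpha>(2)[of 0] by (simp add: stp'_def \<beta>_def)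
      moreover have "stp (\<beta> n) (\<beta> (Suc n))" for n
        using \<alpha>(2)[of "Suc n"] some[of n] some[of "Suc n"] by (simp add: stp'_def)
      moreover have "Inv (\<beta> n) (maker_edges p)" for n
        using \<alpha>(3)[of "Suc n"] some[of n] by (simp add: Inv'_def)
      ultimately show "?R p" by blast
    qed
  qed
qed

section \<open>Finite games with Breaker moving first\<close>

text \<open>In \<open>sp Q F M\<close> Maker is the second player: Breaker moves first on the free elements \<^term>\<open>F\<close>,
  and Maker may pass.\<close>

inductive sp :: "('e set \<Rightarrow> bool) \<Rightarrow> 'e set \<Rightarrow> 'e set \<Rightarrow> bool" for Q where
  sp_done: "Q M \<Longrightarrow> sp Q {} M"
| sp_step: "F \<noteq> {} \<Longrightarrow>
    (\<And>f. f \<in> F \<Longrightarrow> (\<exists>e. e \<in> F \<and> e \<noteq> f \<and> sp Q (F - {f, e}) (insert e M)) \<or> sp Q (F - {f}) M) \<Longrightarrow>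
    sp Q F M"

lemma sp_mono:
  assumes "sp Q F M" "\<And>M. Q M \<Longrightarrow> R M"
  shows "sp R F M"
  using assms(1)
proof (induction rule: sp.induct)
  case (sp_done M)
  then show ?case using assms(2) by (blast intro: sp.sp_done)
next
  case (sp_step F M)
  show ?case by (rule sp.sp_step[OF sp_step(1)]) (use sp_step(2) in blast)
qed

lemma sp_empty: "sp Q {} M \<Longrightarrow> Q M"
  by (cases rule: sp.cases) auto

lemma sp_respond:
  assumes "sp Q F M" "f \<in> F"
  shows "(\<exists>e. e \<in> F \<and> e \<noteq> f \<and> sp Q (F - {f, e}) (insert e M)) \<or> sp Q (F - {f}) M"
  using assms by (cases rule: sp.cases) auto

lemma sp_True: "finite F \<Longrightarrow> sp (\<lambda>_. True) F M"
proof (induction F rule: finite_psubset_induct)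
  case (psubset F)
  show ?case
  proof (cases "F = {}")
    case False
    then show ?thesis by (rule sp_step) (use psubset in blast)
  qed (simp add: sp_done)
qed

text \<open>Maker answers in the component in which Breaker has just moved. That Breaker moves first
  and Maker may pass makes the components independent; monotonicity lets both goals be read off the
  union.\<close>

lemma sp_union:
  fixes F1 F2 :: "'e set"
  assumes "finite F1" "finite F2" "F1 \<inter> F2 = {}" "sp Q1 F1 M1" "sp Q2 F2 M2"
    and "\<And>M M'. M \<subseteq> M' \<Longrightarrow> Q1 M \<Longrightarrow> Q1 M'" "\<And>M M'. M \<subseteq> M' \<Longrightarrow> Q2 M \<Longrightarrow> Q2 M'"
  shows "sp (\<lambda>M. Q1 M \<and> Q2 M) (F1 \<union> F2) (M1 \<union> M2)"
  using assms
proof (induction "card F1 + card F2" arbitrary: F1 F2 M1 M2 Q1 Q2 rule: less_induct)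
  case less
  let ?Q = "\<lambda>M. Q1 M \<and> Q2 M"
  \<comment> \<open>Stated for arbitrary \<open>G1\<close> and \<open>G2\<close>, because the case
    \<open>f \<in> F2\<close> uses it with the two components exchanged.\<close>
  have respond: "(\<exists>e. e \<in> G1 \<union> G2 \<and> e \<noteq> f \<and> sp (\<lambda>M. R1 M \<and> R2 M) (G1 \<union> G2 - {f, e}) (insert e (N1 \<union> N2))) \<or>
      sp (\<lambda>M. R1 M \<and> R2 M) (G1 \<union> G2 - {f}) (N1 \<union> N2)"
    if f: "f \<in> G1" and c: "card G1 + card G2 = card F1 + card F2"
      and G: "finite G1" "finite G2" "G1 \<inter> G2 = {}" "sp R1 G1 N1" "sp R2 G2 N2"
        "\<And>M M'. M \<subseteq> M' \<Longrightarrow> R1 M \<Longrightarrow> R1 M'" "\<And>M M'. M \<subseteq> M' \<Longrightarrow> R2 M \<Longrightarrow> R2 M'"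
    for f and G1 G2 N1 N2 :: "'e set" and R1 R2
  proof -
    have IH: "sp (\<lambda>M. R1 M \<and> R2 M) (X \<union> G2) (N \<union> N2)" if X: "X \<subseteq> G1 - {f}" "sp R1 X N" for X N
    proof (rule less.hyps)
      have "X \<subset> G1" using X(1) f by blast
      then have "card X < card G1" by (rule psubset_card_mono[OF G(1)])
      then show "card X + card G2 < card F1 + card F2" using c by simp
      show "finite X" using X(1) G(1) finite_subset by blast
      show "X \<inter> G2 = {}" using X(1) G(3) by blast
    qed (use X G in auto)
    from sp_respond[OF G(4) f] show ?thesis
    proof
      assume "\<exists>e. e \<in> G1 \<and> e \<noteq> f \<and> sp R1 (G1 - {f, e}) (insert e N1)"
      then obtain e where e: "e \<in> G1" "e \<noteq> f" "sp R1 (G1 - {f, e}) (insert e N1)" by blast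
      have "G1 \<union> G2 - {f, e} = (G1 - {f, e}) \<union> G2" using G(3) f e by auto
      then show ?thesis using IH[of "G1 - {f, e}" "insert e N1"] e by (intro disjI1 exI[of _ e]) auto
    next
      assume s: "sp R1 (G1 - {f}) N1"
      have "G1 \<union> G2 - {f} = (G1 - {f}) \<union> G2" using G(3) f by auto
      then show ?thesis using IH[OF order_refl s] by simp
    qed
  qed
  show ?case
  proof (cases "F1 \<union> F2 = {}")
    case True
    then have "Q1 M1" "Q2 M2" using less.prems(4,5) sp_empty by auto
    then have "?Q (M1 \<union> M2)" using less.prems(6,7) by (meson sup_ge1 sup_ge2)
    then show ?thesis using True by (simp add: sp_done)
  next
    case False
    show ?thesis
    proof (rule sp_step[OF False])
      fix f assume "f \<in> F1 \<union> F2"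
      then consider "f \<in> F1" | "f \<in> F2" by blast
      then show "(\<exists>e. e \<in> F1 \<union> F2 \<and> e \<noteq> f \<and> sp ?Q (F1 \<union> F2 - {f, e}) (insert e (M1 \<union> M2))) \<or>
         sp ?Q (F1 \<union> F2 - {f}) (M1 \<union> M2)"
      proof cases
        case 1
        then show ?thesis by (rule respond[OF _ refl less.prems])
      next
        case 2
        have "F2 \<inter> F1 = {}" using less.prems(3) by blast
        from respond[OF 2 _ less.prems(2,1) this less.prems(5,4,7,6)] show ?thesis
          by (simp add: Un_commute conj_commute add.commute)
      qed
    qed
  qed
qed

lemma sp_UNION:
  assumes "finite I" "\<And>i. i \<in> I \<Longrightarrow> finite (F i)" "disjoint_family_on F I"
    and "\<And>i. i \<in> I \<Longrightarrow> sp (Q i) (F i) {}"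
    and mono: "\<And>i M M'. M \<subseteq> M' \<Longrightarrow> Q i M \<Longrightarrow> Q i M'"
  shows "sp (\<lambda>M. \<forall>i\<in>I. Q i M) (\<Union>i\<in>I. F i) {}"
  using assms(1-4)
proof (induction I rule: finite_induct)
  case empty
  then show ?case by (auto intro: sp_done)
next
  case (insert x I)
  have "sp (\<lambda>M. Q x M \<and> (\<forall>i\<in>I. Q i M)) (F x \<union> (\<Union>i\<in>I. F i)) ({} \<union> {})"
  proof (rule sp_union)
    show "F x \<inter> (\<Union>i\<in>I. F i) = {}" using insert by (auto simp: disjoint_family_on_def)
    show "sp (\<lambda>M. \<forall>i\<in>I. Q i M) (\<Union>i\<in>I. F i) {}"
      by (rule insert.IH) (use insert in \<open>auto simp: disjoint_family_on_def\<close>)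
    show "Q x M'" if "M \<subseteq> M'" "Q x M" for M M' using that by (rule mono)
    show "\<forall>i\<in>I. Q i M'" if "M \<subseteq> M'" "\<forall>i\<in>I. Q i M" for M M' using that mono by meson
  qed (use insert in auto)
  then show ?case by simp
qed

text \<open>Any free element is a good answer. Maker gets every second one, and rounding down pays
  for Breaker's first move.\<close>

lemma sp_half: 
  assumes "finite F"
  shows "sp (\<lambda>M. card F div 2 \<le> card (M \<inter> F)) F {}"
proof -
  have "sp (\<lambda>M'. card M + card X div 2 \<le> card (M' \<inter> F)) X M" if "X \<subseteq> F" "M \<subseteq> F" "M \<inter> X = {}" for X M
    using finite_subset[OF that(1) assms] that
  proof (induction X arbitrary: M rule: finite_psubset_induct)
    case (psubset X)
    let ?Q = "\<lambda>M'. card M + card X div 2 \<le> card (M' \<inter> F)"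
    show ?case
    proof (cases "X = {}")
      case True
      then show ?thesis using psubset by (auto intro!: sp_done simp: Int_absorb2)
    next
      case False
      show ?thesis
      proof (rule sp_step[OF False])
        fix f assume f: "f \<in> X"
        show "(\<exists>e. e \<in> X \<and> e \<noteq> f \<and> sp ?Q (X - {f, e}) (insert e M))
          \<or> sp ?Q (X - {f}) M"
        proof (cases "X = {f}")
          case True
          then have "sp ?Q (X - {f}) M"
            using psubset by (auto intro!: sp_done simp: Int_absorb2)
          then show ?thesis by blast
        next
          case False
          then obtain e where e: "e \<in> X" "e \<noteq> f" using f by blast
          have fin: "finite M" using psubset assms finite_subset by metis
          have "card (X - {f, e}) = card X - 2"
            using f e psubset by (subst card_Diff_subset) auto
          moreover have "card X \<ge> 2" 
            using card_mono[OF psubset.hyps, of "{f, e}"] f e by simp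
          ultimately have c: "card X div 2 = Suc (card (X - {f, e}) div 2)" by simp
          have c': "card (insert e M) = Suc (card M)" using fin e psubset by (subst card_insert_disjoint) auto
          have "sp (\<lambda>M'. card (insert e M) + card (X - {f, e}) div 2 \<le> card (M' \<inter> F)) (X - {f, e}) (insert e M)"
            by (rule psubset.IH) (use f e psubset in auto)
          then show ?thesis using e c c' by auto
        qed
      qed
    qed
  qed
  from this[of F "{}"] show ?thesis by simp
qed

section \<open>Potentials for weighted winning sets\<close>

locale weighted_sets =
  fixes I :: "'i set" and w :: "'i \<Rightarrow> real" and A :: "'i \<Rightarrow> 'e set" and D :: real
  assumes finI: "finite I" and w_nonneg: "\<And>i. i \<in> I \<Longrightarrow> w i \<ge> 0"
begin

text \<open>The expected final weight of the sets owned by Maker if fair coins distributed the free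
  elements \<open>F\<close>. \<open>deg\<close> is the share of the sets through one element.
  Breaker later uses the same potential with the opposite aim.\<close>

definition pot where
  "pot F M = (\<Sum>i\<in>I. if A i \<subseteq> M \<union> F then w i / 2 ^ card (A i \<inter> F) else 0)"

definition deg where
  "deg F M e = (\<Sum>i\<in>I. if A i \<subseteq> M \<union> F \<and> e \<in> A i then w i / 2 ^ card (A i \<inter> F) else 0)"

lemma pot_breaker:
  assumes "f \<in> F" "M \<inter> F = {}"
  shows "pot (F - {f}) M = pot F M - deg F M f"
  unfolding pot_def deg_def sum_subtractf[symmetric]
proof (rule sum.cong[OF refl])
  fix i
  have "A i \<subseteq> M \<union> (F - {f}) \<longleftrightarrow> A i \<subseteq> M \<union> F \<and> f \<notin> A i" using assms by blast
  moreover have "A i \<inter> (F - {f}) = A i \<inter> F" if "f \<notin> A i" using that by blast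
  ultimately show "(if A i \<subseteq> M \<union> (F - {f}) then w i / 2 ^ card (A i \<inter> (F - {f})) else 0) =
     (if A i \<subseteq> M \<union> F then w i / 2 ^ card (A i \<inter> F) else 0) -
     (if A i \<subseteq> M \<union> F \<and> f \<in> A i then w i / 2 ^ card (A i \<inter> F) else 0)" by auto
qed

lemma double_weight:
  assumes "e \<in> F" "finite F"
  shows "w i / 2 ^ card (A i \<inter> (F - {e})) = (if e \<in> A i then 2 else 1) * (w i / 2 ^ card (A i \<inter> F))"
proof (cases "e \<in> A i")
  case True
  then have "A i \<inter> F = insert e (A i \<inter> (F - {e}))" using assms by blast
  moreover have "finite (A i \<inter> (F - {e}))" "e \<notin> A i \<inter> (F - {e})" using assms by auto
  ultimately have "card (A i \<inter> F) = Suc (card (A i \<inter> (F - {e})))" by (metis card_insert_disjoint)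
  then show ?thesis using True by simp
next
  case False
  then have "A i \<inter> (F - {e}) = A i \<inter> F" by blast
  then show ?thesis using False by simp
qed

lemma pot_maker:
  assumes "e \<in> F" "finite F"
  shows "pot (F - {e}) (insert e M) = pot F M + deg F M e"
  unfolding pot_def deg_def sum.distrib[symmetric]
proof (rule sum.cong[OF refl])
  fix i
  have "insert e M \<union> (F - {e}) = M \<union> F" using assms by blast
  then show "(if A i \<subseteq> insert e M \<union> (F - {e}) then w i / 2 ^ card (A i \<inter> (F - {e})) else 0) =
     (if A i \<subseteq> M \<union> F then w i / 2 ^ card (A i \<inter> F) else 0) +
     (if A i \<subseteq> M \<union> F \<and> e \<in> A i then w i / 2 ^ card (A i \<inter> F) else 0)"
    by (simp add: double_weight[OF assms])
qed

lemma weight_le: "i \<in> I \<Longrightarrow> w i / 2 ^ n \<le> w i"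
proof -
  assume "i \<in> I"
  then have "w i * 1 \<le> w i * 2 ^ n" by (intro mult_left_mono w_nonneg) auto
  then show ?thesis by (simp add: field_simps)
qed

text \<open>Only sets that contain both \<open>e\<close> and \<open>g\<close> change their
  contribution to the degree of \<open>g\<close>, and doubling it adds at most their weight.\<close>

lemma deg_maker:
  assumes "e \<in> F" "finite F" "(\<Sum>i\<in>{i \<in> I. e \<in> A i \<and> g \<in> A i}. w i) \<le> D"
  shows "deg (F - {e}) (insert e M) g \<le> deg F M g + D"
proof -
  have "deg (F - {e}) (insert e M) g \<le> deg F M g + (\<Sum>i\<in>I. if e \<in> A i \<and> g \<in> A i then w i else 0)"
    unfolding deg_def sum.distrib[symmetric]
  proof (rule sum_mono)
    fix i assume i: "i \<in> I"
    have "insert e M \<union> (F - {e}) = M \<union> F" using assms by blast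
    then show "(if A i \<subseteq> insert e M \<union> (F - {e}) \<and> g \<in> A i then w i / 2 ^ card (A i \<inter> (F - {e})) else 0)
      \<le> (if A i \<subseteq> M \<union> F \<and> g \<in> A i then w i / 2 ^ card (A i \<inter> F) else 0) +
        (if e \<in> A i \<and> g \<in> A i then w i else 0)"
      using weight_le[OF i, of "card (A i \<inter> F)"] w_nonneg[OF i]
      by (simp add: double_weight[OF assms(1,2)])
  qed
  also have "(\<Sum>i\<in>I. if e \<in> A i \<and> g \<in> A i then w i else 0) \<le> D"
    using assms(3) by (simp add: sum.inter_filter[OF finI])
  finally show ?thesis by simp
qed

lemma deg_nonneg: "deg F M e \<ge> 0"
  unfolding deg_def by (intro sum_nonneg) (auto intro!: divide_nonneg_nonneg w_nonneg)

text \<open>Maker answers with an element of largest degree. The condition on \<^term>\<open>deg\<close>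
  pays in advance for the next Breaker move, and each round costs at most \<^term>\<open>D\<close>.\<close>

lemma sp_potential:
  assumes "finite F" "M \<inter> F = {}" "D \<ge> 0"
    and pair: "\<And>e g. e \<noteq> g \<Longrightarrow> (\<Sum>i\<in>{i \<in> I. e \<in> A i \<and> g \<in> A i}. w i) \<le> D"
    and "pot F M \<ge> L + D * card F" "\<And>e. e \<in> F \<Longrightarrow> pot F M - deg F M e \<ge> L + D * card F"
  shows "sp (\<lambda>M'. L \<le> (\<Sum>i\<in>{i \<in> I. A i \<subseteq> M'}. w i)) F M" (is "sp ?Q F M")
  using assms(1,2,5,6)
proof (induction F arbitrary: M rule: finite_psubset_induct)
  case (psubset F)
  have final: "sp ?Q {} M" if "pot {} M \<ge> L" for M
    using that by (auto intro!: sp_done simp: pot_def sum.inter_filter[OF finI] cong: if_cong)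
  show ?case
  proof (cases "F = {}")
    case True
    then show ?thesis using psubset final by simp
  next
    case False
    show ?thesis
    proof (rule sp_step[OF False])
      fix f assume f: "f \<in> F"
      define F1 where "F1 = F - {f}"
      have fin1: "finite F1" using psubset by (simp add: F1_def)
      have c1: "card F = Suc (card F1)"
        unfolding F1_def by (metis psubset.hyps f card_Suc_Diff1)
      have p1: "pot F1 M \<ge> L + D * card F"
        using psubset.prems(3)[OF f] pot_breaker[OF f] psubset by (simp add: F1_def)
      show "(\<exists>e. e \<in> F \<and> e \<noteq> f \<and> sp ?Q (F - {f, e}) (insert e M))
          \<or> sp ?Q (F - {f}) M"
      proof (cases "F1 = {}")
        case True
        have "L \<le> L + D * card F" using assms(3) by simp
        then have "sp ?Q (F - {f}) M"
          using final[of M] p1 True unfolding F1_def[symmetric] by auto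
        then show ?thesis by blast
      next
        case False
        have ae: "Max (deg F1 M ` F1) \<in> deg F1 M ` F1" using fin1 False by (intro Max_in) auto
        then obtain e where e: "e \<in> F1" and emax: "deg F1 M e = Max (deg F1 M ` F1)" by auto
        have max: "deg F1 M g \<le> deg F1 M e" if "g \<in> F1" for g
          using that fin1 by (simp add: emax)
        define F2 where "F2 = F1 - {e}"
        have c2: "card F1 = Suc (card F2)"
          unfolding F2_def by (metis fin1 e card_Suc_Diff1)
        have p2: "pot F2 (insert e M) = pot F1 M + deg F1 M e"
          unfolding F2_def by (rule pot_maker[OF e fin1])
        \<comment> \<open>A round removes two elements of \<open>F\<close> and so releases
          \<open>2 * D\<close>, of which one \<open>D\<close> pays for the growth of the
          degrees.\<close>
        have "L + D * card F2 \<le> L + D * card F - D" by (simp add: c1 c2 algebra_simps assms(3))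
        then have L2: "L + D * card F2 \<le> pot F1 M - D" using p1 by linarith
        have "sp ?Q F2 (insert e M)"
        proof (rule psubset.IH)
          show "F2 \<subset> F" using f e by (auto simp: F2_def F1_def)
          show "insert e M \<inter> F2 = {}" using psubset by (auto simp: F2_def F1_def)
          show "L + D * card F2 \<le> pot F2 (insert e M)"
            using L2 p2 deg_nonneg[of F1 M e] assms(3) by linarith
          fix g assume g: "g \<in> F2"
          have "deg F2 (insert e M) g \<le> deg F1 M g + D"
            unfolding F2_def by (rule deg_maker[OF e fin1 pair]) (use g F2_def in auto)
          then show "L + D * card F2 \<le> pot F2 (insert e M) - deg F2 (insert e M) g"
            using L2 p2 max[of g] g by (auto simp: F2_def)
        qed
        moreover have "F2 = F - {f, e}" by (auto simp: F1_def F2_def)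
        moreover have "e \<in> F" "e \<noteq> f" using e by (auto simp: F1_def)
        ultimately show ?thesis by blast
      qed
    qed
  qed
qed

end

text \<open>The main term is the expected weight if every element is won with probability 1/2;
  \<open>W\<close> pays for Breaker's first move and \<open>D * card F\<close> for the
  rounds.\<close>

lemma sp_beck:
  fixes w :: "'i \<Rightarrow> real" and A :: "'i \<Rightarrow> 'e set"
  assumes "finite I" "\<And>i. i \<in> I \<Longrightarrow> w i \<ge> 0" "finite F" "\<And>i. i \<in> I \<Longrightarrow> A i \<subseteq> F" "D \<ge> 0" "W \<ge> 0"
    and pair: "\<And>e g. e \<noteq> g \<Longrightarrow> (\<Sum>i\<in>{i \<in> I. e \<in> A i \<and> g \<in> A i}. w i) \<le> D"
    and single: "\<And>e. (\<Sum>i\<in>{i \<in> I. e \<in> A i}. w i) \<le> W"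
  shows "sp (\<lambda>M. (\<Sum>i\<in>I. w i / 2 ^ card (A i)) - D * card F - W \<le> (\<Sum>i\<in>{i \<in> I. A i \<subseteq> M}. w i)) F {}"
proof -
  interpret weighted_sets I w A D by unfold_locales (use assms in auto)
  have pot: "pot F {} = (\<Sum>i\<in>I. w i / 2 ^ card (A i))"
    unfolding pot_def by (rule sum.cong) (use assms(4) in \<open>auto simp: Int_absorb2\<close>)
  have deg: "deg F {} e \<le> W" for e
  proof -
    have "deg F {} e \<le> (\<Sum>i\<in>I. if e \<in> A i then w i else 0)"
      unfolding deg_def by (rule sum_mono) (use weight_le w_nonneg in auto)
    also have "\<dots> \<le> W" using single by (simp add: sum.inter_filter[OF finI])
    finally show ?thesis .
  qed
  show ?thesis
    by (rule sp_potential) (use assms pot deg in \<open>auto simp: algebra_simps\<close>)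
qed

text \<open>Transfers a game in which Maker is second to the real game, in which she is to move.
  \<open>g\<close> is the only edge of \<open>F\<close> that Breaker may hold unanswered. If he has
  played elsewhere, Maker pretends that he took some element of \<open>F\<close>. The simulated set
  \<open>N\<close> stays below the real \<open>M\<close>, and monotonicity does the rest.\<close>

lemma sp_force:
  assumes "sp Q F N" "legal M B" "finite F" "F \<subseteq> board_edges" "F \<inter> M = {}" "N \<subseteq> M" "F \<inter> B \<subseteq> {g}"
    and mono: "\<And>M M'. M \<subseteq> M' \<Longrightarrow> Q M \<Longrightarrow> Q M'"
  shows "force (\<lambda>M' B'. M \<subseteq> M' \<and> M' \<subseteq> M \<union> F \<and> Q M') M B"
  using assms(3,1,2,4-7)
proof (induction F arbitrary: N M B g rule: finite_psubset_induct)
  case (psubset F)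
  show ?case
  proof (cases "F = {}")
    case True
    then have "Q N" using psubset.prems(1) sp_empty by simp
    then have "Q M" by (rule mono[OF psubset.prems(5)])
    then show ?thesis by (intro force_done) auto
  next
    case False
    obtain f where f: "f \<in> F" "F \<inter> B \<subseteq> {f}" using False psubset.prems by blast
    from sp_respond[OF psubset.prems(1) f(1)] show ?thesis
    proof
      assume "\<exists>e. e \<in> F \<and> e \<noteq> f \<and> sp Q (F - {f, e}) (insert e N)"
      then obtain e where e: "e \<in> F" "e \<noteq> f" "sp Q (F - {f, e}) (insert e N)" by blast
      have e': "e \<in> board_edges - (M \<union> B)" using e f psubset.prems by blast
      show ?thesis
      proof (rule force_move[OF e'])
        fix h assume h: "h \<in> board_edges - (insert e M \<union> B)"
        have l: "legal (insert e M) (insert h B)" by (rule legal_step[OF psubset.prems(2) e' h])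
        have "force (\<lambda>M' B'. insert e M \<subseteq> M' \<and> M' \<subseteq> insert e M \<union> (F - {f, e}) \<and> Q M') (insert e M) (insert h B)"
          by (rule psubset.IH[where g = h, OF _ e(3) l]) (use e f psubset.prems in auto)
        then show "force (\<lambda>M' B'. M \<subseteq> M' \<and> M' \<subseteq> M \<union> F \<and> Q M') (insert e M) (insert h B)"
          by (rule force_mono[OF _ l]) (use e in auto)
      qed
    next
      assume s: "sp Q (F - {f}) N"
      have "force (\<lambda>M' B'. M \<subseteq> M' \<and> M' \<subseteq> M \<union> (F - {f}) \<and> Q M') M B"
        by (rule psubset.IH[where g = f, OF _ s psubset.prems(2)]) (use f psubset.prems in auto)
      then show ?thesis by (rule force_mono[OF _ psubset.prems(2)]) auto
    qed
  qed
qed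

section \<open>Joining fresh vertices\<close>

definition star :: "nat \<Rightarrow> nat set \<Rightarrow> nat set set" where
  "star x Z = (\<lambda>z. {x, z}) ` Z"

lemma star_inj: "inj_on (\<lambda>z. {x, z}) Z"
  by (auto simp: inj_on_def doubleton_eq_iff)

lemma doubleton_eq_same: "{x, z} = {x, z'} \<longleftrightarrow> z = z'"
  by (auto simp: doubleton_eq_iff)

lemma mem_star [simp]: "{x, z} \<in> star x Z \<longleftrightarrow> z \<in> Z"
  by (auto simp: star_def doubleton_eq_same)

lemma star_subset [simp]: "star x Y \<subseteq> star x Z \<longleftrightarrow> Y \<subseteq> Z"
  by (auto simp: star_def doubleton_eq_same image_subset_iff)

lemma finite_star [simp]: "finite Z \<Longrightarrow> finite (star x Z)"
  by (simp add: star_def)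

lemma card_star [simp]: "card (star x Z) = card Z"
  unfolding star_def by (rule card_image[OF star_inj])

lemma star_Un: "star x (Y \<union> Z) = star x Y \<union> star x Z"
  by (auto simp: star_def)

lemma star_disjoint: "Y \<inter> Z = {} \<Longrightarrow> star x Y \<inter> star x Z = {}"
  by (auto simp: star_def doubleton_eq_same)

lemma star_board: "x \<notin> Z \<Longrightarrow> star x Z \<subseteq> board_edges"
  by (auto simp: star_def)

lemma star_contains: "e \<in> star x Z \<Longrightarrow> x \<in> e"
  by (auto simp: star_def)

definition joined :: "nat set set \<Rightarrow> nat \<Rightarrow> nat set \<Rightarrow> bool" where
  "joined M x Z \<longleftrightarrow> (\<forall>z\<in>Z. {x, z} \<in> M)"

lemma joined_mono: "joined M x Z \<Longrightarrow> M \<subseteq> M' \<Longrightarrow> Z' \<subseteq> Z \<Longrightarrow> joined M' x Z'"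
  by (auto simp: joined_def)

lemma joined_star: "joined M x Z \<longleftrightarrow> star x Z \<subseteq> M"
  by (auto simp: joined_def star_def)

lemma sp_star_half:
  assumes "finite Z"
  shows "sp (\<lambda>M. card Z div 2 \<le> card {z \<in> Z. {x, z} \<in> M}) (star x Z) {}"
proof -
  have "card (M \<inter> star x Z) = card {z \<in> Z. {x, z} \<in> M}" for M
  proof -
    have "M \<inter> star x Z = (\<lambda>z. {x, z}) ` {z \<in> Z. {x, z} \<in> M}" by (auto simp: star_def)
    then show ?thesis by (simp add: card_image[OF star_inj])
  qed
  with sp_half[OF finite_star[OF assms], of x] show ?thesis by simp
qed

lemma sp_star_classes:
  assumes "finite \<F>" "disjoint \<F>" "finite T"
  shows "sp (\<lambda>M. \<forall>F\<in>\<F>. card (F \<inter> T) div 2 \<le> card {z \<in> F \<inter> T. {x, z} \<in> M}) (star x T) {}"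
proof -
  let ?R = "\<lambda>F M. card (F \<inter> T) div 2 \<le> card {z \<in> F \<inter> T. {x, z} \<in> M}"
  have mono: "?R F M'" if "M \<subseteq> M'" "?R F M" for F M M'
  proof -
    have "card {z \<in> F \<inter> T. {x, z} \<in> M} \<le> card {z \<in> F \<inter> T. {x, z} \<in> M'}"
      by (rule card_mono) (use that assms(3) in auto)
    then show ?thesis using that by linarith
  qed
  have half: "sp (?R F) (star x (F \<inter> T)) {}" for F
    by (rule sp_star_half) (use assms(3) in blast)
  have dis: "disjoint_family_on (\<lambda>F. star x (F \<inter> T)) \<F>"
    unfolding disjoint_family_on_def
    by (intro ballI impI star_disjoint) (use assms(2) in \<open>auto simp: disjoint_def\<close>)
  have "sp (\<lambda>M. \<forall>F\<in>\<F>. ?R F M) (\<Union>F\<in>\<F>. star x (F \<inter> T)) {}"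
    by (rule sp_UNION[OF assms(1) _ dis half mono]) (use assms(3) in auto)
  moreover have "(\<Union>F\<in>\<F>. star x (F \<inter> T)) = star x (T \<inter> \<Union>\<F>)" by (auto simp: star_def)
  \<comment> \<open>The vertices of \<open>T\<close> outside all classes still belong to the board
    of the star; the goal there is trivial.\<close>
  ultimately have "sp (\<lambda>M. (\<forall>F\<in>\<F>. ?R F M) \<and> True) (star x (T \<inter> \<Union>\<F>) \<union> star x (T - \<Union>\<F>)) ({} \<union> {})"
    using assms(3) mono by (intro sp_union sp_True star_disjoint) (simp, simp, blast, simp, simp, meson, simp)
  moreover have "star x (T \<inter> \<Union>\<F>) \<union> star x (T - \<Union>\<F>) = star x T" by (auto simp: star_def)
  ultimately show ?thesis by simp
qed

text \<open>The sets \<open>A i\<close> will be ranges of root tuples; a set survives a fresh vertex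
  if the vertex is joined to all of it. \<open>D\<close> and \<open>W\<close> bound the weight
  through two points and through one, the quantities in the error of the potential argument.\<close>

locale star_weights =
  fixes I :: "'i set" and w :: "'i \<Rightarrow> real" and A :: "'i \<Rightarrow> nat set" and U :: "nat set"
    and s :: nat and D W :: real
  assumes finI: "finite I" and w_nonneg: "\<And>i. i \<in> I \<Longrightarrow> w i \<ge> 0"
    and finU: "finite U" and AU: "\<And>i. i \<in> I \<Longrightarrow> A i \<subseteq> U" and card_A: "\<And>i. i \<in> I \<Longrightarrow> card (A i) \<le> s"
    and D_nonneg: "D \<ge> 0" and W_nonneg: "W \<ge> 0"
    and pair: "\<And>u v. u \<noteq> v \<Longrightarrow> (\<Sum>i\<in>{i \<in> I. u \<in> A i \<and> v \<in> A i}. w i) \<le> D"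
    and single: "\<And>u. (\<Sum>i\<in>{i \<in> I. u \<in> A i}. w i) \<le> W"
begin

definition err where "err = D * card U + W"

lemma err_nonneg: "err \<ge> 0"
  by (simp add: err_def D_nonneg W_nonneg)

lemma sum_sub_mono: "X \<subseteq> Y \<Longrightarrow> Y \<subseteq> I \<Longrightarrow> sum w X \<le> sum w Y"
  by (intro sum_mono2) (auto intro: finite_subset[OF _ finI] w_nonneg)

lemma sp_star_weights:
  assumes "J \<subseteq> I"
  shows "sp (\<lambda>M. sum w J / 2 ^ s - err \<le> sum w {i \<in> J. joined M x (A i)}) (star x U) {}"
proof -
  have "sp (\<lambda>M. (\<Sum>i\<in>J. w i / 2 ^ card (star x (A i))) - D * card (star x U) - W
      \<le> (\<Sum>i\<in>{i \<in> J. star x (A i) \<subseteq> M}. w i)) (star x U) {}"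
  proof (rule sp_beck)
    show "finite J" using assms finI finite_subset by blast
    show "w i \<ge> 0" if "i \<in> J" for i using that assms w_nonneg by blast
    show "star x (A i) \<subseteq> star x U" if "i \<in> J" for i using that assms AU by auto
    fix e
    show "(\<Sum>i\<in>{i \<in> J. e \<in> star x (A i)}. w i) \<le> W"
    proof (cases "e \<in> range (\<lambda>z. {x, z})")
      case True
      then obtain u where "e = {x, u}" by blast
      then have "(\<Sum>i\<in>{i \<in> J. e \<in> star x (A i)}. w i) \<le> (\<Sum>i\<in>{i \<in> I. u \<in> A i}. w i)"
        using assms by (intro sum_sub_mono) auto
      then show ?thesis using single[of u] by linarith
    next
      case False
      then have "{i \<in> J. e \<in> star x (A i)} = {}" by (auto simp: star_def)
      then show ?thesis using W_nonneg by (simp only: sum.empty)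
    qed
    fix g assume eg: "e \<noteq> g"
    show "(\<Sum>i\<in>{i \<in> J. e \<in> star x (A i) \<and> g \<in> star x (A i)}. w i) \<le> D"
    proof (cases "e \<in> range (\<lambda>z. {x, z}) \<and> g \<in> range (\<lambda>z. {x, z})")
      case True
      then obtain u v where uv: "e = {x, u}" "g = {x, v}" by blast
      then have "(\<Sum>i\<in>{i \<in> J. e \<in> star x (A i) \<and> g \<in> star x (A i)}. w i)
          \<le> (\<Sum>i\<in>{i \<in> I. u \<in> A i \<and> v \<in> A i}. w i)"
        using assms by (intro sum_sub_mono) auto
      then show ?thesis using pair[of u v] uv eg by force
    next
      case False
      then have "{i \<in> J. e \<in> star x (A i) \<and> g \<in> star x (A i)} = {}" by (auto simp: star_def)
      then show ?thesis using D_nonneg by (simp only: sum.empty)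
    qed
  qed (use finU D_nonneg W_nonneg in auto)
  then show ?thesis
  proof (rule sp_mono)
    fix M
    have "(\<Sum>i\<in>J. w i / 2 ^ s) \<le> (\<Sum>i\<in>J. w i / 2 ^ card (star x (A i)))"
      using assms w_nonneg card_A by (intro sum_mono divide_left_mono power_increasing) auto
    then show "sum w J / 2 ^ s - err \<le> sum w {i \<in> J. joined M x (A i)}" if
      "(\<Sum>i\<in>J. w i / 2 ^ card (star x (A i))) - D * card (star x U) - W \<le> sum w {i \<in> J. star x (A i) \<subseteq> M}"
      using that by (simp add: err_def joined_star sum_divide_distrib)
  qed
qed

text \<open>\<open>T'\<close> and \<open>J'\<close> are what one or more fresh vertices leave of the
  links and of the living sets; this pair is the key by which fresh vertices are sorted.\<close>

definition outcome where
  "outcome \<F> T J T' J' \<longleftrightarrow> T' \<subseteq> T \<and> J' \<subseteq> J \<and> (\<forall>F\<in>\<F>. card (F \<inter> T) div 2 \<le> card (F \<inter> T')) \<and>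
     sum w J / 2 ^ s - err \<le> sum w J'"

definition attach where
  "attach M x An T' J' \<longleftrightarrow> joined M x (An \<union> T' \<union> (\<Union>i\<in>J'. A i))"

lemma attach_mono: "attach M x An T' J' \<Longrightarrow> M \<subseteq> M' \<Longrightarrow> attach M' x An T' J'"
  by (auto simp: attach_def joined_def)

text \<open>Since \<open>x\<close> is untouched, Maker's first move secures the anchor edge, the one
  edge that must not be lost because it will lie in the prescribed graph. Breaker's answer is the
  single pending edge that \<open>sp_force\<close> permits, so the star game can follow with Maker
  as second player. The class game and the weight game run side by side because \<open>T\<close> and
  \<open>U\<close> are disjoint.\<close>

lemma force_star:
  assumes leg: "legal M B" and x: "x \<notin> \<Union>(M \<union> B)" "x \<notin> An \<union> T \<union> U"
    and fin: "finite \<F>" "disjoint \<F>" "finite T" and J: "J \<subseteq> I"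
    and disj: "T \<inter> U = {}" "An \<inter> (T \<union> U) = {}" and An: "An = {} \<or> (\<exists>v. An = {v})"
  shows "force (\<lambda>M' B'. M \<subseteq> M' \<and> card M' \<le> card M + (card T + card U + 1) \<and>
    (\<exists>T' J'. outcome \<F> T J T' J' \<and> attach M' x An T' J')) M B" (is "force ?R M B")
proof -
  define Q where "Q M = ((\<forall>F\<in>\<F>. card (F \<inter> T) div 2 \<le> card {z \<in> F \<inter> T. {x, z} \<in> M}) \<and>
      sum w J / 2 ^ s - err \<le> sum w {i \<in> J. joined M x (A i)})" for M
  have mono1: "card (F \<inter> T) div 2 \<le> card {z \<in> F \<inter> T. {x, z} \<in> M'}"
    if "M \<subseteq> M'" "card (F \<inter> T) div 2 \<le> card {z \<in> F \<inter> T. {x, z} \<in> M}" for F M M'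
  proof -
    have "card {z \<in> F \<inter> T. {x, z} \<in> M} \<le> card {z \<in> F \<inter> T. {x, z} \<in> M'}"
      by (rule card_mono) (use that fin(3) in auto)
    then show ?thesis using that by simp
  qed
  have mono2: "sum w J / 2 ^ s - err \<le> sum w {i \<in> J. joined M' x (A i)}"
    if "M \<subseteq> M'" "sum w J / 2 ^ s - err \<le> sum w {i \<in> J. joined M x (A i)}" for M M'
  proof -
    have "sum w {i \<in> J. joined M x (A i)} \<le> sum w {i \<in> J. joined M' x (A i)}"
      by (rule sum_sub_mono) (use that(1) J in \<open>auto simp: joined_def\<close>)
    then show ?thesis using that by simp
  qed
  have Q_mono: "Q M'" if "M \<subseteq> M'" "Q M" for M M'
    using that mono1 mono2 unfolding Q_def by blast
  have spQ: "sp Q (star x (T \<union> U)) {}"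
    unfolding Q_def star_Un
    using sp_union[OF _ _ _ sp_star_classes[OF fin] sp_star_weights[OF J], of x x] fin(3) finU
      star_disjoint[OF disj(1)] mono1 mono2 by simp
  have untouched: "star x Z \<inter> (M \<union> B) = {}" for Z using x(1) star_contains by blast
  have fin_TU: "finite (star x (T \<union> U))" using fin finU by simp
  have TU: "star x (T \<union> U) \<subseteq> board_edges" using x(2) by (intro star_board) auto
  have cTU: "card (T \<union> U) \<le> card T + card U" by (rule card_Un_le)
  have play: "force (\<lambda>M' B'. M1 \<subseteq> M' \<and> M' \<subseteq> M1 \<union> star x (T \<union> U) \<and> Q M') M1 B1"
    if "legal M1 B1" "star x (T \<union> U) \<inter> M1 = {}" "star x (T \<union> U) \<inter> B1 \<subseteq> {g}" for M1 B1 g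
    using sp_force[OF spQ that(1) fin_TU TU that(2) _ that(3) Q_mono] by simp
  have result: "?R M' B'"
    if M': "M1 \<subseteq> M'" "M' \<subseteq> M1 \<union> star x (T \<union> U)" "Q M'" and
      M1: "M \<subseteq> M1" "card M1 \<le> card M + 1" "joined M1 x An" "finite M1" for M1 M' B' :: "nat set set"
  proof (intro conjI exI)
    show "M \<subseteq> M'" using M' M1 by blast
    have "card M' \<le> card (M1 \<union> star x (T \<union> U))"
      by (rule card_mono) (use M1 M' fin_TU in auto)
    also have "\<dots> \<le> card M1 + card (star x (T \<union> U))" by (rule card_Un_le)
    finally show "card M' \<le> card M + (card T + card U + 1)" using M1(2) cTU by simp
    have eq: "F \<inter> {z \<in> T. {x, z} \<in> M'} = {z \<in> F \<inter> T. {x, z} \<in> M'}" for F by blast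
    show "outcome \<F> T J {z \<in> T. {x, z} \<in> M'} {i \<in> J. joined M' x (A i)}"
      using M'(3) unfolding outcome_def Q_def eq by auto
    show "attach M' x An {z \<in> T. {x, z} \<in> M'} {i \<in> J. joined M' x (A i)}"
      using M1(3) M'(1) by (auto simp: attach_def joined_def)
  qed
  have finM: "finite M" using leg by (simp add: legal_def)
  from An show ?thesis
  proof
    assume "An = {}"
    then have j: "joined M x An" by (simp add: joined_def)
    show ?thesis
      by (rule force_mono[OF play[OF leg, of "{}"] leg])
        (use untouched result[of M] finM j in auto)
  next
    assume "\<exists>v. An = {v}"
    then obtain v where v: "An = {v}" by blast
    have e: "{x, v} \<in> board_edges - (M \<union> B)" using x v by auto
    show ?thesis
    proof (rule force_move[OF e])
      fix h assume h: "h \<in> board_edges - (insert {x, v} M \<union> B)"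
      have leg1: "legal (insert {x, v} M) (insert h B)" by (rule legal_step[OF leg e h])
      have "{x, v} \<notin> star x (T \<union> U)" using v disj by auto
      then have 1: "star x (T \<union> U) \<inter> insert {x, v} M = {}" using untouched by blast
      have 2: "star x (T \<union> U) \<inter> insert h B \<subseteq> {h}" using untouched by blast
      have j: "joined (insert {x, v} M) x An" by (simp add: v joined_def)
      have c: "card (insert {x, v} M) \<le> card M + 1" using finM by (simp add: card_insert_if)
      show "force ?R (insert {x, v} M) (insert h B)"
        by (rule force_mono[OF play[OF leg1 1 2] leg1]) (rule result[of "insert {x, v} M"], use j c finM in auto)
    qed
  qed
qed

end

section \<open>Many interchangeable fresh vertices\<close>

lemma pigeonhole_fiber:
  assumes "finite us" "finite Ks" "Ks \<noteq> {}" "f ` us \<subseteq> Ks" "N * card Ks \<le> card us" 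
  shows "\<exists>k\<in>Ks. N \<le> card {u \<in> us. f u = k}"
proof (rule ccontr)
  assume "\<not> ?thesis"
  then have less: "\<And>k. k \<in> Ks \<Longrightarrow> card {u \<in> us. f u = k} < N" by force
  have "card us = (\<Sum>k\<in>Ks. card {u \<in> us. f u = k})"
    using sum.group[OF assms(1,2,4), of "\<lambda>_. 1::nat"] by simp
  also have "\<dots> < (\<Sum>k\<in>Ks. N)" using less assms by (intro sum_strict_mono) auto
  finally show False using assms(5) by (simp add: mult.commute)
qed

text \<open>The unit is repeated on disjoint vertex sets often enough for \<open>N\<close> of them
  to share a key. The bounds on \<open>card M'\<close> and \<open>card Av'\<close> are handed to
  \<open>unit\<close> so that a finite supply of vertices chosen in advance can be known to
  last.\<close>

lemma force_many:
  fixes V :: "'b \<Rightarrow> nat set" and Rl :: "'k \<Rightarrow> 'b \<Rightarrow> nat set set \<Rightarrow> bool"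
  assumes Ks: "finite Ks" "Ks \<noteq> {}"
    and n: "n = N * card Ks"
    and mono: "\<And>k u M M'. Rl k u M \<Longrightarrow> M \<subseteq> M' \<Longrightarrow> Rl k u M'"
    and V: "\<And>k u M. Rl k u M \<Longrightarrow> finite (V u) \<and> V u \<noteq> {} \<and> card (V u) \<le> d"
    and leg: "legal M B" and Av: "finite Av"
    and unit: "\<And>M' B' Av'. legal M' B' \<Longrightarrow> M \<subseteq> M' \<Longrightarrow> card M' \<le> card M + n * c \<Longrightarrow> finite Av' \<Longrightarrow> Av \<subseteq> Av' \<Longrightarrow>
      card Av' \<le> card Av + n * d \<Longrightarrow>
      force (\<lambda>M'' B''. M' \<subseteq> M'' \<and> card M'' \<le> card M' + c \<and> (\<exists>k\<in>Ks. \<exists>u. V u \<inter> Av' = {} \<and> Rl k u M'')) M' B'"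
  shows "force (\<lambda>M' B'. M \<subseteq> M' \<and> card M' \<le> card M + n * c \<and>
    (\<exists>k\<in>Ks. \<exists>us. finite us \<and> card us = N \<and> disjoint_family_on V us \<and> (\<forall>u\<in>us. V u \<inter> Av = {} \<and> Rl k u M'))) M B"
  (is "force (\<lambda>M' B'. M \<subseteq> M' \<and> card M' \<le> card M + n * c \<and> ?many M') M B")
proof -
  let ?P = "\<lambda>j M' us. M \<subseteq> M' \<and> card M' \<le> card M + j * c \<and> finite us \<and> card us = j \<and>
    disjoint_family_on V us \<and> (\<forall>u\<in>us. V u \<inter> Av = {} \<and> (\<exists>k\<in>Ks. Rl k u M'))"
  have "force (\<lambda>M' B'. \<exists>us. ?P j M' us) M B" if "j \<le> n" for j
    using that
  proof (induction j)
    case 0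
    have "?P 0 M {}" by (simp add: disjoint_family_on_def)
    then show ?case by (intro force_done) blast
  next
    case (Suc j)
    show ?case
    proof (rule force_legal_trans[OF Suc.IH leg])
      show "j \<le> n" using Suc by simp
      fix M' B' assume "\<exists>us. ?P j M' us" and leg': "legal M' B'"
      then obtain us where us: "?P j M' us" by blast
      define Av' where "Av' = Av \<union> (\<Union>u\<in>us. V u)"
      have finAv: "finite Av'" unfolding Av'_def using us V Av by blast
      have "card (\<Union>u\<in>us. V u) \<le> (\<Sum>u\<in>us. card (V u))" using us by (intro card_UN_le) auto
      also have "\<dots> \<le> (\<Sum>u\<in>us. d)" by (rule sum_mono) (use us V in blast)
      finally have "card (\<Union>u\<in>us. V u) \<le> n * d" using us Suc.prems
        by (simp add: order_trans[OF _ mult_le_mono1[of j n d]])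
      then have cAv: "card Av' \<le> card Av + n * d"
        unfolding Av'_def using card_Un_le[of Av "\<Union>u\<in>us. V u"] by linarith
      have "j * c \<le> n * c" using Suc.prems by simp
      then have cM: "card M' \<le> card M + n * c" using us by linarith
      have MM: "M \<subseteq> M'" using us by blast
      show "force (\<lambda>M' B'. \<exists>us. ?P (Suc j) M' us) M' B'"
      proof (rule force_mono[OF unit[OF leg' MM cM finAv _ cAv] leg'])
        show "Av \<subseteq> Av'" by (simp add: Av'_def)
        fix M'' B'' assume r: "M' \<subseteq> M'' \<and> card M'' \<le> card M' + c \<and> (\<exists>k\<in>Ks. \<exists>u. V u \<inter> Av' = {} \<and> Rl k u M'')"
        then obtain k u where u: "k \<in> Ks" "V u \<inter> Av' = {}" "Rl k u M''" by blast
        \<comment> \<open>Here \<open>V u \<noteq> {}\<close> matters: the set of a repeated unit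
          would meet \<open>Av'\<close>.\<close>
        have "u \<notin> us" using u V[OF u(3)] by (auto simp: Av'_def)
        then have "card (insert u us) = Suc j" using us by simp
        moreover have "disjoint_family_on V (insert u us)"
          using us u(2) unfolding disjoint_family_on_def Av'_def by blast
        moreover have "\<forall>u'\<in>insert u us. V u' \<inter> Av = {} \<and> (\<exists>k\<in>Ks. Rl k u' M'')"
        proof
          fix u' assume "u' \<in> insert u us"
          then show "V u' \<inter> Av = {} \<and> (\<exists>k\<in>Ks. Rl k u' M'')"
          proof
            assume "u' = u"
            then show ?thesis using u unfolding Av'_def by blast
          next
            assume "u' \<in> us"
            then obtain k' where "V u' \<inter> Av = {}" "k' \<in> Ks" "Rl k' u' M'" using us by blast
            moreover have "Rl k' u' M''" using \<open>Rl k' u' M'\<close> r mono[of k' u' M' M''] by blast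
            ultimately show ?thesis by blast
          qed
        qed
        moreover have "M \<subseteq> M''" using r MM by blast
        moreover have "card M'' \<le> card M + Suc j * c" using r us by simp
        ultimately show "\<exists>us. ?P (Suc j) M'' us" using us by blast
      qed
    qed
  qed
  then have *: "force (\<lambda>M' B'. \<exists>us. ?P n M' us) M B" by blast
  show ?thesis
  proof (rule force_mono[OF * leg])
    fix M' B' assume "\<exists>us. ?P n M' us"
    then obtain us where us: "?P n M' us" by blast
    then have "\<forall>u\<in>us. \<exists>k. k \<in> Ks \<and> Rl k u M'" by blast
    then obtain f where f: "\<forall>u\<in>us. f u \<in> Ks \<and> Rl (f u) u M'" by metis
    then have "\<exists>k\<in>Ks. N \<le> card {u \<in> us. f u = k}"
      using us n by (intro pigeonhole_fiber Ks) auto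
    then obtain k where k: "k \<in> Ks" "N \<le> card {u \<in> us. f u = k}" by blast
    obtain us' where us': "us' \<subseteq> {u \<in> us. f u = k}" "card us' = N" "finite us'"
      using obtain_subset_with_card_n[OF k(2)] by blast
    moreover have "disjoint_family_on V us'"
      using us us'(1) unfolding disjoint_family_on_def by blast
    moreover have "\<forall>u\<in>us'. V u \<inter> Av = {} \<and> Rl k u M'"
    proof
      fix u assume "u \<in> us'"
      then have "u \<in> us" "f u = k" using us'(1) by auto
      then show "V u \<inter> Av = {} \<and> Rl k u M'" using us f by auto
    qed
    ultimately have "?many M'"
      using k(1) by (intro bexI[of _ k] exI[of _ us'] conjI)
    then show "M \<subseteq> M' \<and> card M' \<le> card M + n * c \<and>
      ?many M'"
      using us by simp
  qed
qed

lemma card_touched: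
  assumes "legal M B"
  shows "finite (\<Union>(M \<union> B))" "card (\<Union>(M \<union> B)) \<le> 4 * card M"
proof -
  have fin: "finite (M \<union> B)" and E: "\<And>e. e \<in> M \<union> B \<Longrightarrow> finite e \<and> card e = 2" and c: "card (M \<union> B) = 2 * card M"
    using assms by (auto simp: legal_def board_edges_eq nsets_def card_Un_disjoint)
  show "finite (\<Union>(M \<union> B))" using fin E by blast
  have "card (\<Union>(M \<union> B)) \<le> (\<Sum>e\<in>M \<union> B. card e)" by (rule card_Union_le_sum_card)
  also have "\<dots> = (\<Sum>e\<in>M \<union> B. 2)" by (rule sum.cong) (use E in auto)
  finally show "card (\<Union>(M \<union> B)) \<le> 4 * card M" using c by simp
qed

context star_weights
begin

definition keys where "keys T = card (Pow T \<times> Pow I)"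

text \<open>There are at most \<open>keys T\<close> outcomes, so \<open>N * keys T\<close> attempts
  yield \<open>N\<close> vertices with the same one. \<open>Cand\<close> outnumbers the touched and
  the forbidden vertices throughout; the factor 4 counts two ends for the edges of both
  players.\<close>

lemma force_pool:
  assumes leg: "legal M B" and fin: "finite \<F>" "disjoint \<F>" "finite T" and J: "J \<subseteq> I"
    and disj: "T \<inter> U = {}" "An \<inter> (T \<union> U) = {}" and An: "An = {} \<or> (\<exists>v. An = {v})"
    and Av: "finite Av" "An \<union> T \<union> U \<subseteq> Av"
    and n: "n = N * keys T" and N: "N \<ge> 1" and c: "c = card T + card U + 1"
    and Cand: "finite Cand" "card Cand > 4 * (card M + n * c) + (card Av + n)"
  shows "force (\<lambda>M' B'. M \<subseteq> M' \<and> card M' \<le> card M + n * c \<and>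
    (\<exists>T' J' X. outcome \<F> T J T' J' \<and> X \<subseteq> Cand - Av \<and> card X = N \<and> (\<forall>x\<in>X. attach M' x An T' J'))) M B"
  (is "force (\<lambda>M' B'. _ \<and> _ \<and> ?pool M') M B")
proof -
  let ?Ks = "Pow T \<times> Pow I"
  let ?Rl = "\<lambda>k x M. outcome \<F> T J (fst k) (snd k) \<and> x \<in> Cand \<and> attach M x An (fst k) (snd k)"
  have "force (\<lambda>M' B'. M \<subseteq> M' \<and> card M' \<le> card M + n * c \<and>
    (\<exists>k\<in>?Ks. \<exists>us. finite us \<and> card us = N \<and> disjoint_family_on (\<lambda>x. {x}) us \<and> (\<forall>u\<in>us. {u} \<inter> Av = {} \<and> ?Rl k u M'))) M B"
  proof (rule force_many[where d = 1])
    show "finite ?Ks" "?Ks \<noteq> {}" using fin(3) finI by auto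
    show "n = N * card ?Ks" using n by (simp add: keys_def)
    fix M' B' Av' assume leg': "legal M' B'" and MM: "M \<subseteq> M'" and cM: "card M' \<le> card M + n * c"
      and Av': "finite Av'" "Av \<subseteq> Av'" "card Av' \<le> card Av + n * 1"
    have "card (Av' \<union> \<Union>(M' \<union> B')) \<le> card Av' + card (\<Union>(M' \<union> B'))" by (rule card_Un_le)
    also have "\<dots> \<le> (card Av + n) + 4 * (card M + n * c)"
      using Av'(3) cM by (intro add_mono order_trans[OF card_touched(2)[OF leg']]) auto
    also have "\<dots> < card Cand" using Cand(2) by simp
    finally have "\<not> Cand \<subseteq> Av' \<union> \<Union>(M' \<union> B')"
      using card_mono[of "Av' \<union> \<Union>(M' \<union> B')" Cand] card_touched(1)[OF leg'] Av'(1) by auto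
    then obtain x where x: "x \<in> Cand" "x \<notin> Av'" "x \<notin> \<Union>(M' \<union> B')" by blast
    have x2: "x \<notin> An \<union> T \<union> U" using x Av' Av by blast
    show "force (\<lambda>M'' B''. M' \<subseteq> M'' \<and> card M'' \<le> card M' + c \<and>
        (\<exists>k\<in>?Ks. \<exists>u. {u} \<inter> Av' = {} \<and> ?Rl k u M'')) M' B'"
    proof (rule force_mono[OF force_star[OF leg' x(3) x2 fin J disj An] leg'])
      fix M'' B'' assume "M' \<subseteq> M'' \<and> card M'' \<le> card M' + (card T + card U + 1) \<and>
        (\<exists>T' J'. outcome \<F> T J T' J' \<and> attach M'' x An T' J')"
      then obtain T' J' where r: "M' \<subseteq> M''" "card M'' \<le> card M' + c" "outcome \<F> T J T' J'" "attach M'' x An T' J'"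
        using c by blast
      then have k: "(T', J') \<in> ?Ks" using J by (auto simp: outcome_def)
      have "\<exists>k\<in>?Ks. \<exists>u. {u} \<inter> Av' = {} \<and> ?Rl k u M''"
        by (rule bexI[OF _ k], rule exI[of _ x]) (use r x in simp)
      then show "M' \<subseteq> M'' \<and> card M'' \<le> card M' + c \<and> (\<exists>k\<in>?Ks. \<exists>u. {u} \<inter> Av' = {} \<and> ?Rl k u M'')"
        using r by blast
    qed
  qed (use leg Av attach_mono in auto)
  then show ?thesis
  proof (rule force_mono[OF _ leg])
    fix M' B' assume "M \<subseteq> M' \<and> card M' \<le> card M + n * c \<and>
      (\<exists>k\<in>?Ks. \<exists>us. finite us \<and> card us = N \<and> disjoint_family_on (\<lambda>x. {x}) us \<and> (\<forall>u\<in>us. {u} \<inter> Av = {} \<and> ?Rl k u M'))"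
    then obtain k us where r: "M \<subseteq> M'" "card M' \<le> card M + n * c" "card us = N" "\<forall>u\<in>us. {u} \<inter> Av = {} \<and> ?Rl k u M'"
      by blast
    from r(3) N have "us \<noteq> {}" by auto
    then have "outcome \<F> T J (fst k) (snd k)" using r(4) by blast
    moreover have "us \<subseteq> Cand - Av" "\<forall>x\<in>us. attach M' x An (fst k) (snd k)" using r(4) by auto
    ultimately show "M \<subseteq> M' \<and> card M' \<le> card M + n * c \<and>
      ?pool M'"
      using r by blast
  qed
qed

end

section \<open>One stage of Maker's strategy\<close>

definition complete_on :: "nat set set \<Rightarrow> nat set \<Rightarrow> bool" where
  "complete_on M K \<longleftrightarrow> (\<forall>x\<in>K. \<forall>y\<in>K. x \<noteq> y \<longrightarrow> {x, y} \<in> M)"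

lemma complete_on_mono: "complete_on M K \<Longrightarrow> M \<subseteq> M' \<Longrightarrow> K' \<subseteq> K \<Longrightarrow> complete_on M' K'"
  by (auto simp: complete_on_def)

lemma complete_on_insert:
  assumes "complete_on M K" "joined M x K"
  shows "complete_on M (insert x K)"
  using assms unfolding complete_on_def joined_def by (metis insert_commute insert_iff)

text \<open>Both kinds of graphs enter only through neighbourhoods. For an ascending graph nothing
  but finite stars is assumed, of any size and with centres outside any finite set.\<close>

locale roots =
  fixes s t c :: nat and U :: "nat \<Rightarrow> nat set" and Nb :: "nat \<Rightarrow> nat \<Rightarrow> nat set"
  assumes cardU: "\<And>j. j \<in> {1..s} \<Longrightarrow> card (U j) = c" and c_pos: "c > 0"
    and disjU: "disjoint_family_on U {1..s}"
    and inf_Nb: "\<And>j v. j \<in> {1..s} \<Longrightarrow> v \<in> U j \<Longrightarrow> infinite (Nb j v)"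
    and asc_Nb: "\<And>i Av n. i \<in> {s + 1..s + t} \<Longrightarrow> finite Av \<Longrightarrow>
      \<exists>y. y \<notin> Av \<and> (\<exists>X. finite X \<and> X \<subseteq> Nb i y \<and> card X > n)"
    and irrefl_Nb: "\<And>i y. y \<notin> Nb i y"
begin

lemma finite_U: "j \<in> {1..s} \<Longrightarrow> finite (U j)"
  using cardU c_pos card_ge_0_finite by metis

definition R where "R = (\<Union>j\<in>{1..s}. U j)"

lemma finite_R: "finite R"
  using finite_U by (auto simp: R_def)

lemma card_R: "card R = s * c"
  unfolding R_def using disjU cardU finite_U by (subst card_UN_disjoint) (auto simp: disjoint_family_on_def)

section \<open>Tuples of roots, tasks and weights\<close>

definition tuples where "tuples = PiE {1..s} U"

definition rng :: "(nat \<Rightarrow> nat) \<Rightarrow> nat set" where "rng \<tau> = \<tau> ` {1..s}"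

lemma finite_tuples: "finite tuples"
  unfolding tuples_def using finite_U by (intro finite_PiE) auto

lemma card_tuples: "card tuples = c ^ s"
  unfolding tuples_def using cardU by (subst card_PiE) auto

lemma tuple_in: "\<tau> \<in> tuples \<Longrightarrow> j \<in> {1..s} \<Longrightarrow> \<tau> j \<in> U j"
  by (auto simp: tuples_def)

lemma rng_R: "\<tau> \<in> tuples \<Longrightarrow> rng \<tau> \<subseteq> R"
  by (auto simp: rng_def R_def tuples_def)

lemma card_rng: "card (rng \<tau>) \<le> s"
  unfolding rng_def using card_image_le[of "{1..s}" \<tau>] by simp

lemma finite_rng: "finite (rng \<tau>)" by (simp add: rng_def)

lemma U_unique: "i \<in> {1..s} \<Longrightarrow> j \<in> {1..s} \<Longrightarrow> x \<in> U i \<Longrightarrow> x \<in> U j \<Longrightarrow> i = j"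
  using disjU unfolding disjoint_family_on_def by blast

text \<open>The sets \<open>U j\<close> are disjoint, so a vertex determines its coordinate and
  \<open>X\<close> fixes \<open>card X\<close> coordinates. The product form avoids a truncated
  exponent when \<open>card X\<close> exceeds \<open>s\<close>.\<close>

lemma tuples_through:
  assumes "finite X"
  shows "card {\<tau> \<in> tuples. X \<subseteq> rng \<tau>} * c ^ card X \<le> c ^ s"
proof (cases "{\<tau> \<in> tuples. X \<subseteq> rng \<tau>} = {}")
  case True
  then show ?thesis by (simp only: card.empty)
next
  case False
  then obtain \<tau>0 where \<tau>0: "\<tau>0 \<in> tuples" "X \<subseteq> rng \<tau>0" by blast
  define K where "K = {j \<in> {1..s}. \<tau>0 j \<in> X}"
  have "inj_on \<tau>0 {1..s}" using U_unique tuple_in[OF \<tau>0(1)] by (intro inj_onI) metis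
  then have "inj_on \<tau>0 K" by (rule inj_on_subset) (auto simp: K_def)
  moreover have "X = \<tau>0 ` K" using \<tau>0(2) by (auto simp: K_def rng_def)
  ultimately have cX: "card X = card K" by (simp add: card_image)
  let ?P = "PiE {1..s} (\<lambda>j. if j \<in> K then {\<tau>0 j} else U j)"
  have fin: "finite ?P" by (rule finite_PiE) (use finite_U in auto)
  have "{\<tau> \<in> tuples. X \<subseteq> rng \<tau>} \<subseteq> ?P"
  proof
    fix \<tau> assume \<tau>: "\<tau> \<in> {\<tau> \<in> tuples. X \<subseteq> rng \<tau>}"
    have "\<tau> j = \<tau>0 j" if j: "j \<in> K" for j
    proof -
      have "\<tau>0 j \<in> rng \<tau>" using \<tau> j by (auto simp: K_def)
      then obtain i where i: "i \<in> {1..s}" "\<tau>0 j = \<tau> i" by (auto simp: rng_def)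
      have "\<tau> i \<in> U i" "\<tau>0 j \<in> U j" using \<tau> \<tau>0 i(1) j tuple_in by (auto simp: K_def)
      then have "i = j" using U_unique[of i j] i j by (auto simp: K_def)
      then show ?thesis using i by simp
    qed
    then show "\<tau> \<in> ?P" using \<tau> by (auto simp: tuples_def PiE_iff)
  qed
  then have "card {\<tau> \<in> tuples. X \<subseteq> rng \<tau>} \<le> card ?P" by (rule card_mono[OF fin])
  also have "card ?P = (\<Prod>j\<in>{1..s}. if j \<in> K then 1 else c)"
    by (subst card_PiE) (auto intro!: prod.cong simp: cardU)
  also have "\<dots> = c ^ card ({1..s} - K)" by (simp add: prod.If_cases set_diff_eq[symmetric] Diff_eq)
  finally have "card {\<tau> \<in> tuples. X \<subseteq> rng \<tau>} * c ^ card X \<le> c ^ card ({1..s} - K) * c ^ card K"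
    using cX by simp
  also have "\<dots> = c ^ s"
  proof -
    have "card ({1..s} - K) + card K = s"
    proof -
      have "K \<subseteq> {1..s}" by (auto simp: K_def)
      then show ?thesis using card_Diff_subset[of K "{1..s}"] card_mono[of "{1..s}" K] finite_subset by fastforce
    qed
    then show ?thesis by (simp add: power_add[symmetric])
  qed
  finally show ?thesis .
qed

abbreviation "NN \<equiv> real c ^ s"

lemma sum_through:
  assumes "finite X" "P \<subseteq> tuples" "\<And>\<tau>. \<tau> \<in> P \<Longrightarrow> X \<subseteq> rng \<tau> \<and> w \<tau> \<le> B" "B \<ge> 0"
  shows "sum w P \<le> B * NN / real c ^ card X"
proof -
  have P: "P \<subseteq> {\<tau> \<in> tuples. X \<subseteq> rng \<tau>}" using assms by auto
  have "card P * c ^ card X \<le> card {\<tau> \<in> tuples. X \<subseteq> rng \<tau>} * c ^ card X"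
    using card_mono[OF _ P] finite_tuples by simp
  also have "\<dots> \<le> c ^ s" by (rule tuples_through[OF assms(1)])
  finally have "real (card P * c ^ card X) \<le> real (c ^ s)" by (simp only: of_nat_le_iff)
  then have "real (card P) \<le> NN / real c ^ card X" using c_pos by (simp add: field_simps)
  have "sum w P \<le> (\<Sum>\<tau>\<in>P. B)" by (rule sum_mono) (use assms in auto)
  also have "\<dots> = B * real (card P)" by simp
  also have "\<dots> \<le> B * (NN / real c ^ card X)" by (rule mult_left_mono) fact+
  finally show ?thesis by simp
qed

text \<open>The task \<open>(j, v)\<close> with \<open>j \<le> s\<close> asks for a class of neighbours of the root \<open>v\<close> in the
  \<open>j\<close>-th graph, and \<open>(i, 0)\<close> with \<open>i > s\<close> for stars in the \<open>i\<close>-th, ascending graph.\<close>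

definition tasks :: "(nat \<times> nat) set" where
  "tasks = (SIGMA j:{1..s}. U j) \<union> {s + 1..s + t} \<times> {0}"

definition aff :: "nat \<times> nat \<Rightarrow> (nat \<Rightarrow> nat) \<Rightarrow> bool" where
  "aff \<delta> \<tau> \<longleftrightarrow> (fst \<delta> \<le> s \<longrightarrow> \<tau> (fst \<delta>) = snd \<delta>)"

text \<open>A task costs the tuples it affects at most a factor \<open>4 ^ s\<close>, which the weight gives back.\<close>

definition wt :: "(nat \<times> nat) set \<Rightarrow> (nat \<Rightarrow> nat) \<Rightarrow> real" where
  "wt D \<tau> = (4 ^ s) ^ card {\<delta> \<in> D. aff \<delta> \<tau>}"

text \<open>A tuple is affected by at most one root task per coordinate and one task per ascending
  graph. This bounds all weights independently of \<open>c\<close>.\<close>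

definition Wm :: real where "Wm = (4 ^ s) ^ (s + t)"

lemma finite_tasks: "finite tasks"
  unfolding tasks_def using finite_U by (intro finite_UnI finite_SigmaI) auto

lemma wt_pos: "wt D \<tau> > 0" by (simp add: wt_def)

lemma wt_le: 
  assumes "D \<subseteq> tasks"
  shows "wt D \<tau> \<le> Wm"
proof -
  have "{\<delta> \<in> D. aff \<delta> \<tau>} \<subseteq> (\<lambda>j. if j \<le> s then (j, \<tau> j) else (j, 0)) ` {1..s + t}"
  proof
    fix \<delta> assume \<delta>: "\<delta> \<in> {\<delta> \<in> D. aff \<delta> \<tau>}"
    then have "\<delta> \<in> tasks" using assms by blast
    then have "fst \<delta> \<in> {1..s + t}" "\<delta> = (if fst \<delta> \<le> s then (fst \<delta>, \<tau> (fst \<delta>)) else (fst \<delta>, 0))"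
      using \<delta> by (auto simp: tasks_def aff_def)
    then show "\<delta> \<in> (\<lambda>j. if j \<le> s then (j, \<tau> j) else (j, 0)) ` {1..s + t}" by (rule rev_image_eqI)
  qed
  then have "card {\<delta> \<in> D. aff \<delta> \<tau>} \<le> card {1..s + t}"
    by (rule surj_card_le[OF finite_atLeastAtMost])
  then have "card {\<delta> \<in> D. aff \<delta> \<tau>} \<le> s + t" by simp
  then show ?thesis unfolding wt_def Wm_def by (intro power_increasing) auto
qed

lemma wt_insert:
  assumes "finite D" "\<delta> \<notin> D"
  shows "wt (insert \<delta> D) \<tau> = (if aff \<delta> \<tau> then 4 ^ s else 1) * wt D \<tau>"
proof (cases "aff \<delta> \<tau>")
  case True
  then have "{x \<in> insert \<delta> D. aff x \<tau>} = insert \<delta> {x \<in> D. aff x \<tau>}" by auto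
  then show ?thesis using True assms by (simp add: wt_def)
next
  case False
  then have "{x \<in> insert \<delta> D. aff x \<tau>} = {x \<in> D. aff x \<tau>}" by auto
  then show ?thesis using False by (simp add: wt_def)
qed

text \<open>Each clause yields one edge of the graph of the task, either between the root and
  \<open>H\<close> or inside \<open>H\<close>.\<close>

definition served :: "(nat \<times> nat) set \<Rightarrow> nat set \<Rightarrow> (nat \<Rightarrow> nat) \<Rightarrow> bool" where
  "served D H \<tau> \<longleftrightarrow> (\<forall>\<delta>\<in>D. aff \<delta> \<tau> \<longrightarrow>
     (if fst \<delta> \<le> s then \<exists>h\<in>H. h \<in> Nb (fst \<delta>) (snd \<delta>) else \<exists>h\<in>H. \<exists>h'\<in>H. h' \<in> Nb (fst \<delta>) h))"

lemma served_mono: "served D H \<tau> \<Longrightarrow> H \<subseteq> H' \<Longrightarrow> served D H' \<tau>"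
  unfolding served_def by (metis subset_iff)

lemma served_insert: "served D H \<tau> \<Longrightarrow> served {\<delta>} Z \<tau> \<Longrightarrow> served (insert \<delta> D) (Z \<union> H) \<tau>"
  using served_mono[of D H \<tau> "Z \<union> H"] served_mono[of "{\<delta>}" Z \<tau> "Z \<union> H"] by (simp add: served_def)

text \<open>The weight that a task may lose: \<open>4 ^ s\<close> times the error of the star game,
  or twice that for an ascending graph, where two star games are played. A root task plays only for
  the tuples through its root, which gains a factor \<open>c\<close> and makes up for the number
  \<open>s * c\<close> of such tasks.\<close>

definition cost :: "nat \<times> nat \<Rightarrow> real" where
  "cost \<delta> = (if fst \<delta> \<le> s then 4 ^ s * Wm * (s + 1) * NN / c ^ 2 else 2 * 4 ^ s * Wm * (s + 1) * NN / c)"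

abbreviation "n_tasks \<equiv> card tasks"

end

section \<open>The invariant within one stage\<close>

locale stage = roots +
  fixes Old :: "nat set" and Fo :: "nat set set" and A0 :: "(nat \<Rightarrow> nat) set"
  assumes Old: "finite Old" "\<Union>Fo \<subseteq> Old" "finite Fo" "disjoint Fo" "Old \<inter> R = {}"
    and A0: "A0 \<subseteq> tuples"
begin

text \<open>\<open>T'\<close> stands for the part of the block to which later blocks will be linked.
  It is not known yet, so a clique must be available inside every set that meets all new classes;
  the links to old vertices do not depend on this choice.\<close>

definition sel where
  "sel D M Y Fn T \<A> \<longleftrightarrow> (\<forall>\<tau>\<in>\<A>. \<forall>T'\<subseteq>T. (\<forall>F\<in>Fn. T' \<inter> F \<noteq> {}) \<longrightarrow>
     (\<exists>H\<subseteq>T' \<inter> Y. complete_on M (H \<union> rng \<tau>) \<and> (\<forall>h\<in>H. joined M h (T \<inter> Old)) \<and> served D H \<tau>))"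

lemma sel_apply:
  assumes "sel D M Y Fn T \<A>" "\<tau> \<in> \<A>" "T' \<subseteq> T" "\<forall>F\<in>Fn. T' \<inter> F \<noteq> {}"
  shows "\<exists>H. H \<subseteq> T' \<inter> Y \<and> complete_on M (H \<union> rng \<tau>) \<and> (\<forall>h\<in>H. joined M h (T \<inter> Old)) \<and> served D H \<tau>"
  using assms unfolding sel_def by blast

text \<open>Every task at most quarters a class. New classes start with \<open>4 ^ (2 * n_tasks)\<close> vertices, so that
  \<open>4 ^ n_tasks\<close> of them survive the stage and suffice for every later one.\<close>

definition inv where
  "inv D M Y Fn T \<A> \<longleftrightarrow> finite Y \<and> T \<subseteq> Old \<union> Y \<and> finite Fn \<and> \<Union>Fn \<subseteq> Y \<and> disjoint (Fo \<union> Fn) \<and>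
     Y \<inter> (Old \<union> R) = {} \<and> \<A> \<subseteq> A0 \<and>
     (\<forall>F\<in>Fo. 4 ^ (n_tasks - card D) \<le> card (F \<inter> T)) \<and>
     (\<forall>F\<in>Fn. 4 ^ (2 * n_tasks - card D) \<le> card (F \<inter> T)) \<and>
     sum (wt D) \<A> \<ge> card A0 - sum cost D \<and> sel D M Y Fn T \<A>"

lemma quarter_power:
  assumes "4 ^ (n - k) \<le> (a::nat)" "k < n" "a div 2 div 2 \<le> b"
  shows "4 ^ (n - Suc k) \<le> b"
proof -
  have "n - k = Suc (n - Suc k)" using assms by simp
  then have "4 * 4 ^ (n - Suc k) \<le> a" using assms by simp
  then show ?thesis using assms(3) by linarith
qed

text \<open>Bookkeeping common to both kinds of task. The vertices used from \<open>X\<close> are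
  joined to all of \<open>T'\<close>, so a clique found earlier inside \<open>T'\<close> can be
  extended by them. \<open>div 2 div 2\<close> leaves room for the two star games of an ascending
  task.\<close>

lemma inv_insert:
  assumes inv: "inv D M Y Fn T \<A>" and D: "D \<subseteq> tasks" "\<delta> \<in> tasks - D" and MM: "M \<subseteq> M'"
    and X: "finite X" "X \<inter> (Old \<union> Y \<union> R) = {}" and sub: "T' \<subseteq> T" "\<A>' \<subseteq> \<A>"
    and N: "finite N" "disjoint N" "\<And>F. F \<in> N \<Longrightarrow> F \<subseteq> X \<and> card F = 4 ^ (2 * n_tasks)"
    and cF: "\<And>F. F \<in> Fo \<union> Fn \<Longrightarrow> card (F \<inter> T) div 2 div 2 \<le> card (F \<inter> T')"
    and weight: "sum (wt D) \<A> - cost \<delta> \<le> sum (wt (insert \<delta> D)) \<A>'"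
    and ext: "\<And>\<tau> T1 H. \<tau> \<in> \<A>' \<Longrightarrow> \<forall>F\<in>N. T1 \<inter> F \<noteq> {} \<Longrightarrow> H \<subseteq> T' \<Longrightarrow> complete_on M' (H \<union> rng \<tau>) \<Longrightarrow>
      \<exists>Z\<subseteq>T1 \<inter> X. complete_on M' (Z \<union> (H \<union> rng \<tau>)) \<and> (\<forall>z\<in>Z. joined M' z T') \<and> served {\<delta>} Z \<tau>"
  shows "inv (insert \<delta> D) M' (Y \<union> X) (Fn \<union> N) (T' \<union> X) \<A>'"
proof -
  note I = inv[unfolded inv_def]
  have finD: "finite D" using D finite_tasks finite_subset by blast
  have cD: "card D < n_tasks" using D by (intro psubset_card_mono[OF finite_tasks]) auto
  have card_insert: "card (insert \<delta> D) = Suc (card D)" using finD D by simp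
  have finT: "finite (T' \<union> X)" using I Old(1) X(1) sub(1) by (meson finite_UnI finite_subset)
  have XYO: "X \<inter> Y = {}" "X \<inter> Old = {}" using X(2) by auto
  have quarter: "4 ^ (m - card (insert \<delta> D)) \<le> card (F \<inter> (T' \<union> X))"
    if F: "F \<in> Fo \<union> Fn" and m: "4 ^ (m - card D) \<le> card (F \<inter> T)" "card D < m" for F m
  proof -
    have "4 ^ (m - card (insert \<delta> D)) \<le> card (F \<inter> T')"
      unfolding card_insert by (rule quarter_power[OF m cF[OF F]])
    also have "\<dots> \<le> card (F \<inter> (T' \<union> X))" by (rule card_mono) (use finT in auto)
    finally show ?thesis .
  qed
  show ?thesis
    unfolding inv_def
  proof (intro conjI ballI)
    show "finite (Y \<union> X)" "T' \<union> X \<subseteq> Old \<union> (Y \<union> X)" "finite (Fn \<union> N)" "\<A>' \<subseteq> A0"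
      "(Y \<union> X) \<inter> (Old \<union> R) = {}"
      using I X sub N(1) by auto
    show "\<Union>(Fn \<union> N) \<subseteq> Y \<union> X" using I N(3) by blast
    have "G \<inter> F = {}" if "F \<in> Fo \<union> Fn" "G \<in> N" for F G
    proof -
      have "F \<subseteq> Old \<union> Y" "G \<subseteq> X" using that I Old(2) N(3) by blast+
      then show ?thesis using XYO by blast
    qed
    then show "disjoint (Fo \<union> (Fn \<union> N))"
      using I N(2) unfolding disjoint_def by (metis Int_commute Un_iff)
    show "4 ^ (n_tasks - card (insert \<delta> D)) \<le> card (F \<inter> (T' \<union> X))" if "F \<in> Fo" for F
      by (rule quarter) (use that I cD in auto)
    show "4 ^ (2 * n_tasks - card (insert \<delta> D)) \<le> card (F \<inter> (T' \<union> X))" if F: "F \<in> Fn \<union> N" for F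
    proof (cases "F \<in> Fn")
      case True
      then show ?thesis by (intro quarter) (use I cD in auto)
    next
      case False
      then have "F \<subseteq> X" "card F = 4 ^ (2 * n_tasks)" using F N(3) by auto
      moreover from this have "F \<inter> (T' \<union> X) = F" by blast
      ultimately show ?thesis by (simp add: power_increasing)
    qed
    show "sum (wt (insert \<delta> D)) \<A>' \<ge> card A0 - sum cost (insert \<delta> D)"
      using I weight finD D by simp
    show "sel (insert \<delta> D) M' (Y \<union> X) (Fn \<union> N) (T' \<union> X) \<A>'"
      unfolding sel_def
    proof (intro ballI allI impI)
      fix \<tau> T1 assume \<tau>: "\<tau> \<in> \<A>'" and T1: "T1 \<subseteq> T' \<union> X" and hit: "\<forall>F\<in>Fn \<union> N. T1 \<inter> F \<noteq> {}"
      have "\<forall>F\<in>Fn. (T1 \<inter> T') \<inter> F \<noteq> {}"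
      proof
        fix F assume "F \<in> Fn"
        then have "T1 \<inter> F \<noteq> {}" "F \<inter> X = {}" using hit I XYO by auto
        then show "(T1 \<inter> T') \<inter> F \<noteq> {}" using T1 by blast
      qed
      moreover have "sel D M Y Fn T \<A>" "\<tau> \<in> \<A>" "T1 \<inter> T' \<subseteq> T" using I \<tau> sub by auto
      ultimately obtain H where H: "H \<subseteq> (T1 \<inter> T') \<inter> Y" "complete_on M (H \<union> rng \<tau>)"
        "\<forall>h\<in>H. joined M h (T \<inter> Old)" "served D H \<tau>"
        by (metis sel_apply)
      have TO: "(T' \<union> X) \<inter> Old \<subseteq> T \<inter> Old" "(T' \<union> X) \<inter> Old \<subseteq> T'" using sub XYO by auto
      have HT: "H \<subseteq> T'" using H(1) by blast
      have hits: "\<forall>F\<in>N. T1 \<inter> F \<noteq> {}" using hit by blast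
      from ext[OF \<tau> hits HT complete_on_mono[OF H(2) MM order_refl]]
      obtain Z where Z: "Z \<subseteq> T1 \<inter> X" "complete_on M' (Z \<union> (H \<union> rng \<tau>))" "\<forall>z\<in>Z. joined M' z T'" "served {\<delta>} Z \<tau>"
        by blast
      show "\<exists>H\<subseteq>T1 \<inter> (Y \<union> X). complete_on M' (H \<union> rng \<tau>) \<and> (\<forall>h\<in>H. joined M' h ((T' \<union> X) \<inter> Old)) \<and>
        served (insert \<delta> D) H \<tau>"
      proof (intro exI[of _ "Z \<union> H"] conjI ballI)
        show "Z \<union> H \<subseteq> T1 \<inter> (Y \<union> X)" using Z(1) H(1) by blast
        show "complete_on M' (Z \<union> H \<union> rng \<tau>)" using Z(2) by (simp add: Un_assoc)
        show "served (insert \<delta> D) (Z \<union> H) \<tau>" by (rule served_insert[OF H(4) Z(4)])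
        show "joined M' h ((T' \<union> X) \<inter> Old)" if "h \<in> Z \<union> H" for h
          using that Z(3) H(3) joined_mono[OF _ MM TO(1)] joined_mono[OF _ order_refl TO(2)] by blast
      qed
    qed
  qed
qed

text \<open>\<open>Z\<close> is left out of the star game: it is the root of a root task, which the
  anchor edge takes care of, or empty. Each prescribed vertex divides the number of tuples by
  \<open>c\<close>, which explains the exponents.\<close>

lemma star_weights_tuples:
  assumes D: "D \<subseteq> tasks" and J: "J \<subseteq> tuples" and Z: "finite Z" "\<And>\<tau>. \<tau> \<in> J \<Longrightarrow> Z \<subseteq> rng \<tau>"
  shows "star_weights J (wt D) (\<lambda>\<tau>. rng \<tau> - Z) (R - Z) s (Wm * NN / real c ^ (card Z + 2)) (Wm * NN / real c ^ (card Z + 1))"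
proof
  have Wm: "Wm \<ge> 0" by (simp add: Wm_def)
  have through: "sum (wt D) {\<tau> \<in> J. X \<subseteq> rng \<tau> - Z} \<le> Wm * NN / real c ^ (card Z + card X)" if X: "finite X" for X
  proof (cases "X \<inter> Z = {}")
    case True
    have "sum (wt D) {\<tau> \<in> J. X \<subseteq> rng \<tau> - Z} \<le> Wm * NN / real c ^ card (Z \<union> X)"
      by (rule sum_through) (use X J Z wt_le[OF D] Wm in auto)
    then show ?thesis using True X Z(1) by (simp add: card_Un_disjoint Int_commute)
  next
    case False
    then have "{\<tau> \<in> J. X \<subseteq> rng \<tau> - Z} = {}" by blast
    then have "sum (wt D) {\<tau> \<in> J. X \<subseteq> rng \<tau> - Z} = 0" by (simp only: sum.empty)
    then show ?thesis using Wm by simp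
  qed
  show "finite J" using J finite_tuples finite_subset by blast
  show "wt D \<tau> \<ge> 0" for \<tau> using wt_pos[of D \<tau>] by simp
  show "finite (R - Z)" using finite_R by simp
  show "\<tau> \<in> J \<Longrightarrow> rng \<tau> - Z \<subseteq> R - Z" for \<tau> using J rng_R by blast
  show "card (rng \<tau> - Z) \<le> s" for \<tau>
    using card_mono[OF finite_rng, of "rng \<tau> - Z" \<tau>] card_rng[of \<tau>] by force
  show "Wm * NN / real c ^ (card Z + 2) \<ge> 0" "Wm * NN / real c ^ (card Z + 1) \<ge> 0" using Wm by auto
  show "sum (wt D) {\<tau> \<in> J. x \<in> rng \<tau> - Z \<and> y \<in> rng \<tau> - Z} \<le> Wm * NN / real c ^ (card Z + 2)" if "x \<noteq> y" for x y
    using through[of "{x, y}"] that by simp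
  show "sum (wt D) {\<tau> \<in> J. x \<in> rng \<tau> - Z} \<le> Wm * NN / real c ^ (card Z + 1)" for x
    using through[of "{x}"] by simp
qed

section \<open>Serving a single task\<close>

lemma infinite_obtains_card:
  assumes "infinite X"
  obtains Z where "finite Z" "Z \<subseteq> X" "card Z > n"
  using infinite_arbitrarily_large[OF assms, of "Suc n"] by (metis lessI)

lemma four_power: "(4::real) ^ n = 2 ^ n * 2 ^ n"
  by (simp add: power_mult_distrib[symmetric])

text \<open>The new class consists of neighbours of \<open>v\<close> with a common outcome, so any
  one of them can serve the task. Tuples that avoid \<open>v\<close> keep their weight; for those in
  \<open>J'\<close> it is multiplied by \<open>4 ^ s\<close>, which outweighs the factor
  \<open>2 ^ s\<close> lost in the star game.\<close>

lemma task_root: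
  assumes inv: "inv D M Y Fn T \<A>" and leg: "legal M B" and D: "D \<subseteq> tasks" "(j, v) \<in> tasks - D" and j: "j \<le> s"
  shows "force (\<lambda>M' B'. M \<subseteq> M' \<and> (\<exists>Y Fn T \<A>. inv (insert (j, v) D) M' Y Fn T \<A>)) M B"
proof -
  let ?\<delta> = "(j, v)"
  have jv: "j \<in> {1..s}" "v \<in> U j" using D(2) j by (auto simp: tasks_def)
  have vR: "v \<in> R" using jv by (auto simp: R_def)
  have finD: "finite D" using D finite_tasks finite_subset by blast
  note I = inv[unfolded inv_def]
  have finT: "finite T" using I Old(1) by (meson finite_UnI finite_subset)
  define I where "I = {\<tau> \<in> \<A>. \<tau> j = v}"
  have \<A>: "\<A> \<subseteq> tuples" using I A0 by blast
  have It: "I \<subseteq> tuples" using \<A> by (auto simp: I_def)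
  have "v \<in> rng \<tau>" if "\<tau> \<in> I" for \<tau> using that jv(1) by (auto simp: I_def rng_def)
  then interpret star_weights I "wt D" "\<lambda>\<tau>. rng \<tau> - {v}" "R - {v}" s "Wm * NN / real c ^ 3" "Wm * NN / real c ^ 2"
    using star_weights_tuples[OF D(1) It, of "{v}"] by (simp add: numeral_3_eq_3 numeral_2_eq_2)
  have err: "4 ^ s * err \<le> cost ?\<delta>"
  proof -
    have "card (R - {v}) \<le> s * c" using card_R finite_R by (metis card_Diff1_le)
    then have "real (card (R - {v})) \<le> real (s * c)" by (simp only: of_nat_le_iff)
    then have "Wm * NN / real c ^ 3 * card (R - {v}) \<le> Wm * NN / real c ^ 3 * real (s * c)" using D_nonneg by (intro mult_left_mono)
    also have "\<dots> = Wm * NN * s / real c ^ 2" using c_pos by (simp add: power3_eq_cube power2_eq_square)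
    finally have "err \<le> Wm * NN * s / real c ^ 2 + Wm * NN / real c ^ 2" by (simp add: err_def)
    also have "\<dots> = Wm * (s + 1) * NN / real c ^ 2" by (simp add: add_divide_distrib algebra_simps)
    finally have "4 ^ s * err \<le> 4 ^ s * (Wm * (s + 1) * NN / real c ^ 2)" by (intro mult_left_mono) auto
    also have "\<dots> = cost ?\<delta>" using j by (simp add: cost_def)
    finally show ?thesis .
  qed
  define Av where "Av = Old \<union> Y \<union> R"
  define N where "N = (4::nat) ^ (2 * n_tasks)"
  define n where "n = N * keys T"
  define cc where "cc = card T + card (R - {v}) + 1"
  obtain Cand where Cand: "finite Cand" "Cand \<subseteq> Nb j v" "card Cand > 4 * (card M + n * cc) + (card Av + n)"
    using infinite_obtains_card[OF inf_Nb[OF jv]] by blast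
  have finF: "finite (Fo \<union> Fn)" "disjoint (Fo \<union> Fn)" using I Old by auto
  have TR: "T \<inter> R = {}" using I Old(5) by blast
  have Av: "finite Av" "{v} \<union> T \<union> (R - {v}) \<subseteq> Av" using I Old(1) finite_R vR by (auto simp: Av_def)
  have "force (\<lambda>M' B'. M \<subseteq> M' \<and> card M' \<le> card M + n * cc \<and>
    (\<exists>T' J' X. outcome (Fo \<union> Fn) T I T' J' \<and> X \<subseteq> Cand - Av \<and> card X = N \<and> (\<forall>x\<in>X. attach M' x {v} T' J'))) M B" (is "force ?P M B")
    by (rule force_pool[OF leg finF finT order_refl _ _ _ Av n_def _ cc_def Cand(1,3)])
      (use TR vR in \<open>auto simp: N_def\<close>)
  then show ?thesis
  proof (rule force_mono[OF _ leg])
    fix M' B' assume "?P M' B'"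
    then obtain T' J' X where MM: "M \<subseteq> M'" and out: "outcome (Fo \<union> Fn) T I T' J'" and X: "X \<subseteq> Cand - Av" "card X = N"
      and att: "\<And>x. x \<in> X \<Longrightarrow> attach M' x {v} T' J'" by blast
    have finX: "finite X" using X Cand(1) finite_subset by blast
    have T': "T' \<subseteq> T" and J': "J' \<subseteq> I" using out by (auto simp: outcome_def)
    define \<A>' where "\<A>' = {\<tau> \<in> \<A>. \<tau> j \<noteq> v} \<union> J'"
    have "inv (insert ?\<delta> D) M' (Y \<union> X) (Fn \<union> {X}) (T' \<union> X) \<A>'"
    proof (rule inv_insert[OF inv D MM finX _ T'])
      show "X \<inter> (Old \<union> Y \<union> R) = {}" using X(1) by (auto simp: Av_def)
      show "\<A>' \<subseteq> \<A>" using J' by (auto simp: \<A>'_def I_def)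
      show "disjoint {X}" by (simp add: disjoint_def)
      show "card (F \<inter> T) div 2 div 2 \<le> card (F \<inter> T')" if "F \<in> Fo \<union> Fn" for F
      proof -
        have "card (F \<inter> T) div 2 \<le> card (F \<inter> T')" using out that by (simp add: outcome_def)
        then show ?thesis by linarith
      qed
      show "sum (wt D) \<A> - cost ?\<delta> \<le> sum (wt (insert ?\<delta> D)) \<A>'"
      proof -
        let ?B = "{\<tau> \<in> \<A>. \<tau> j \<noteq> v}"
        have fin\<A>: "finite \<A>" using \<A> finite_tuples finite_subset by blast
        have finJ': "finite J'" using J' finI finite_subset by blast
        have w1: "sum (wt (insert ?\<delta> D)) ?B = sum (wt D) ?B"
          by (rule sum.cong) (use D j in \<open>auto simp: wt_insert[OF finD] aff_def\<close>)
        have w2: "sum (wt (insert ?\<delta> D)) J' = 4 ^ s * sum (wt D) J'"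
          unfolding sum_distrib_left
          by (rule sum.cong) (use D J' in \<open>auto simp: wt_insert[OF finD] aff_def I_def\<close>)
        have "sum (wt D) I / 2 ^ s - err \<le> sum (wt D) J'" using out by (simp add: outcome_def)
        then have "4 ^ s * (sum (wt D) I / 2 ^ s - err) \<le> 4 ^ s * sum (wt D) J'" by (intro mult_left_mono) auto
        moreover have "4 ^ s * (sum (wt D) I / 2 ^ s) = 2 ^ s * sum (wt D) I"
          by (simp add: four_power)
        moreover have "sum (wt D) I \<le> 2 ^ s * sum (wt D) I"
          using sum_nonneg[of I "wt D"] wt_pos by (simp add: mult_le_cancel_right1 less_imp_le not_less)
        ultimately have w3: "sum (wt D) I - cost ?\<delta> \<le> 4 ^ s * sum (wt D) J'"
          using err by (simp add: right_diff_distrib)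
        have "sum (wt (insert ?\<delta> D)) \<A>' = sum (wt (insert ?\<delta> D)) ?B + sum (wt (insert ?\<delta> D)) J'"
          unfolding \<A>'_def by (rule sum.union_disjoint) (use fin\<A> J' finJ' in \<open>auto simp: I_def\<close>)
        moreover have "sum (wt D) \<A> = sum (wt D) ?B + sum (wt D) I"
        proof -
          have "\<A> = ?B \<union> I" by (auto simp: I_def)
          then show ?thesis using sum.union_disjoint[of ?B I "wt D"] fin\<A> finI by (auto simp: I_def)
        qed
        ultimately show ?thesis using w1 w2 w3 by linarith
      qed
      fix \<tau> T1 H assume \<tau>: "\<tau> \<in> \<A>'" and hit: "\<forall>F\<in>{X}. T1 \<inter> F \<noteq> {}" and H: "H \<subseteq> T'"
        and cl: "complete_on M' (H \<union> rng \<tau>)"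
      show "\<exists>Z\<subseteq>T1 \<inter> X. complete_on M' (Z \<union> (H \<union> rng \<tau>)) \<and> (\<forall>z\<in>Z. joined M' z T') \<and> served {?\<delta>} Z \<tau>"
      proof (cases "\<tau> j = v")
        case False
        then show ?thesis using cl j by (intro exI[of _ "{}"]) (simp add: served_def aff_def)
      next
        case True
        then have \<tau>J: "\<tau> \<in> J'" using \<tau> by (auto simp: \<A>'_def)
        obtain x where x: "x \<in> X" "x \<in> T1" using hit by blast
        have ax: "joined M' x ({v} \<union> T' \<union> (\<Union>\<tau>\<in>J'. rng \<tau> - {v}))" using att[OF x(1)] by (simp add: attach_def)
        have "joined M' x (H \<union> rng \<tau>)"
          by (rule joined_mono[OF ax order_refl]) (use H \<tau>J in blast)
        then have "complete_on M' ({x} \<union> (H \<union> rng \<tau>))" using complete_on_insert[OF cl] by simp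
        moreover have "joined M' x T'" by (rule joined_mono[OF ax order_refl]) blast
        moreover have "x \<in> Nb j v" using x(1) X(1) Cand(2) by blast
        ultimately show ?thesis using x j by (intro exI[of _ "{x}"]) (simp add: served_def)
      qed
    qed (use X(2) in \<open>auto simp: N_def\<close>)
    then show "M \<subseteq> M' \<and> (\<exists>Y Fn T \<A>. inv (insert (j, v) D) M' Y Fn T \<A>)" using MM by blast
  qed
qed

text \<open>A unit is a centre \<open>y\<close> with \<open>N\<close> leaves from its neighbourhood;
  \<open>N\<close> units with a common outcome are built. The centres form one class and the leaves
  of each centre another. A set that meets all these classes contains a centre and then also a leaf
  of this very centre, hence an edge of the graph.\<close>

lemma task_ascending:
  assumes inv: "inv D M Y Fn T \<A>" and leg: "legal M B" and D: "D \<subseteq> tasks" "(i, v) \<in> tasks - D" and i: "\<not> i \<le> s"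
  shows "force (\<lambda>M' B'. M \<subseteq> M' \<and> (\<exists>Y Fn T \<A>. inv (insert (i, v) D) M' Y Fn T \<A>)) M B"
proof -
  let ?\<delta> = "(i, v)"
  have ii: "i \<in> {s + 1..s + t}" using D(2) i by (auto simp: tasks_def)
  have finD: "finite D" using D finite_tasks finite_subset by blast
  note I = inv[unfolded inv_def]
  have finT: "finite T" using I Old(1) by (meson finite_UnI finite_subset)
  have \<A>: "\<A> \<subseteq> tuples" using I A0 by blast
  interpret star_weights \<A> "wt D" rng R s "Wm * NN / real c ^ 2" "Wm * NN / real c"
    using star_weights_tuples[OF D(1) \<A>, of "{}"] by (simp add: power2_eq_square)
  have err: "2 * 4 ^ s * err = cost ?\<delta>"
  proof -
    have "Wm * NN / real c ^ 2 * (s * c) = Wm * NN * s / real c" using c_pos by (simp add: power2_eq_square)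
    then have "err = Wm * (s + 1) * NN / real c" by (simp add: err_def card_R add_divide_distrib algebra_simps)
    then show ?thesis using i by (simp add: cost_def)
  qed
  define Av where "Av = Old \<union> Y \<union> R"
  define N where "N = (4::nat) ^ (2 * n_tasks)"
  define n where "n = N * keys T"
  define c1 where "c1 = card T + card R + 1"
  define V :: "nat \<times> nat set \<Rightarrow> nat set" where "V u = insert (fst u) (snd u)" for u
  define FF where "FF = Fo \<union> Fn"
  define unit_ok where "unit_ok k u M \<longleftrightarrow> fst k \<subseteq> T \<and> snd k \<subseteq> \<A> \<and>
    (\<forall>F\<in>FF. card (F \<inter> T) div 2 div 2 \<le> card (F \<inter> fst k)) \<and>
    (sum (wt D) \<A> / 2 ^ s - err) / 2 ^ s - err \<le> sum (wt D) (snd k) \<and>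
    snd u \<subseteq> Nb i (fst u) \<and> fst u \<notin> snd u \<and> finite (snd u) \<and> card (snd u) = N \<and>
    attach M (fst u) {} (fst k) (snd k) \<and> (\<forall>w\<in>snd u. attach M w {fst u} (fst k) (snd k))" for k u M
  have unit_mono: "unit_ok k u M'" if "unit_ok k u M" "M \<subseteq> M'" for k u M M'
    using that attach_mono unfolding unit_ok_def by blast
  have N1: "N \<ge> 1" by (simp add: N_def)
  have finF: "finite FF" "disjoint FF" using I Old by (auto simp: FF_def)
  have TR: "T \<inter> R = {}" using I Old(5) by blast
  have finAv: "finite Av" using I Old(1) finite_R by (simp add: Av_def)
  have AvT: "T \<union> R \<subseteq> Av" using I by (auto simp: Av_def)
  have "force (\<lambda>M' B'. M \<subseteq> M' \<and> card M' \<le> card M + n * (c1 + n * c1) \<and>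
    (\<exists>k\<in>Pow T \<times> Pow \<A>. \<exists>us. finite us \<and> card us = N \<and> disjoint_family_on V us \<and> (\<forall>u\<in>us. V u \<inter> Av = {} \<and> unit_ok k u M'))) M B" (is "force ?many M B")
  proof (rule force_many[where d = "Suc N"])
    show "finite (Pow T \<times> Pow \<A>)" "Pow T \<times> Pow \<A> \<noteq> {}" using finT finI by auto
    show "n = N * card (Pow T \<times> Pow \<A>)" by (simp add: n_def keys_def)
    show "finite (V u) \<and> V u \<noteq> {} \<and> card (V u) \<le> Suc N" if "unit_ok k u M" for k u M
      using that by (auto simp: unit_ok_def V_def)
    fix M' B' Av' assume leg': "legal M' B'" and Av': "finite Av'" "Av \<subseteq> Av'"
    \<comment> \<open>Bounds the vertices touched or excluded until the unit is complete:
      \<open>c1\<close> moves for the centre and \<open>n * c1\<close> for its leaves. It has to be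
      fixed before \<open>y\<close> is chosen, since \<open>y\<close> may have finite
      degree.\<close>
    define b where "b = 4 * (card M' + c1 + n * c1) + (card Av' + 1 + n)"
    have "finite (Av' \<union> \<Union>(M' \<union> B'))" using Av'(1) card_touched(1)[OF leg'] by simp
    from asc_Nb[OF ii this, of b] obtain y Cand where y: "y \<notin> Av'" "y \<notin> \<Union>(M' \<union> B')"
      and Cand: "finite Cand" "Cand \<subseteq> Nb i y" "card Cand > b" by blast
    have yTR: "y \<notin> {} \<union> T \<union> R" using y AvT Av' by blast
    have star: "force (\<lambda>M'' B''. M' \<subseteq> M'' \<and> card M'' \<le> card M' + c1 \<and>
      (\<exists>T' J'. outcome FF T \<A> T' J' \<and> attach M'' y {} T' J')) M' B'" (is "force ?star M' B'")
      unfolding c1_def by (rule force_star[OF leg' y(2) yTR finF finT order_refl TR]) auto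
    show "force (\<lambda>M'' B''. M' \<subseteq> M'' \<and> card M'' \<le> card M' + (c1 + n * c1) \<and>
        (\<exists>k\<in>Pow T \<times> Pow \<A>. \<exists>u. V u \<inter> Av' = {} \<and> unit_ok k u M'')) M' B'"
      (is "force ?unit M' B'")
    proof (rule force_legal_trans[OF star leg'])
      fix M1 B1 assume "?star M1 B1" and leg1: "legal M1 B1"
      then obtain T1 J1 where M1: "M' \<subseteq> M1" "card M1 \<le> card M' + c1" and out1: "outcome FF T \<A> T1 J1"
        and att1: "attach M1 y {} T1 J1" by blast
      have T1: "T1 \<subseteq> T" "J1 \<subseteq> \<A>" using out1 by (auto simp: outcome_def)
      have finT1: "finite T1" using T1 finT finite_subset by blast
      have "card (Pow T1 \<times> Pow \<A>) \<le> card (Pow T \<times> Pow \<A>)"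
        by (rule card_mono) (use T1 finT finI in auto)
      then have k1: "N * keys T1 \<le> n" by (simp add: n_def keys_def)
      have c1': "card T1 + card R + 1 \<le> c1" using card_mono[OF finT T1(1)] by (simp add: c1_def)
      have nc: "N * keys T1 * (card T1 + card R + 1) \<le> n * c1" by (rule mult_le_mono[OF k1 c1'])
      have Candb: "card Cand > 4 * (card M1 + N * keys T1 * (card T1 + card R + 1)) + (card (insert y Av') + N * keys T1)"
      proof -
        have a1: "card M1 + N * keys T1 * (card T1 + card R + 1) \<le> card M' + c1 + n * c1"
          by (rule add_le_mono[OF M1(2) nc])
        have a2: "card (insert y Av') + N * keys T1 \<le> card Av' + 1 + n"
          using Av'(1) y k1 by simp
        have "4 * (card M1 + N * keys T1 * (card T1 + card R + 1)) + (card (insert y Av') + N * keys T1) \<le> b"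
          unfolding b_def by (rule add_le_mono[OF mult_le_mono2[OF a1] a2])
        then show ?thesis using Cand(3) by simp
      qed
      have pool: "force (\<lambda>M2 B2. M1 \<subseteq> M2 \<and> card M2 \<le> card M1 + N * keys T1 * (card T1 + card R + 1) \<and>
        (\<exists>T' J' X. outcome FF T1 J1 T' J' \<and> X \<subseteq> Cand - insert y Av' \<and> card X = N \<and> (\<forall>x\<in>X. attach M2 x {y} T' J'))) M1 B1"
        (is "force ?pool M1 B1")
        by (rule force_pool[OF leg1 finF finT1 T1(2) _ _ _ _ _ refl N1 refl Cand(1) Candb])
          (use TR T1 y AvT Av' yTR in auto)
      show "force ?unit M1 B1"
      proof (rule force_mono[OF pool leg1])
        fix M2 B2 assume "?pool M2 B2"
        then obtain T2 J2 X where M2: "M1 \<subseteq> M2" "card M2 \<le> card M1 + N * keys T1 * (card T1 + card R + 1)"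
          and out2: "outcome FF T1 J1 T2 J2" and X: "X \<subseteq> Cand - insert y Av'" "card X = N"
          and att2: "\<forall>x\<in>X. attach M2 x {y} T2 J2" by blast
        have T2: "T2 \<subseteq> T1" "J2 \<subseteq> J1" using out2 by (auto simp: outcome_def)
        have "unit_ok (T2, J2) (y, X) M2" unfolding unit_ok_def fst_conv snd_conv
        proof (intro conjI ballI)
          show "T2 \<subseteq> T" "J2 \<subseteq> \<A>" using T2 T1 by auto
          show "card (F \<inter> T) div 2 div 2 \<le> card (F \<inter> T2)" if "F \<in> FF" for F
          proof -
            have "card (F \<inter> T) div 2 \<le> card (F \<inter> T1)" "card (F \<inter> T1) div 2 \<le> card (F \<inter> T2)"
              using out1 out2 that by (auto simp: outcome_def)
            then show ?thesis by linarith
          qed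
          have o1: "sum (wt D) \<A> / 2 ^ s - err \<le> sum (wt D) J1" and o2: "sum (wt D) J1 / 2 ^ s - err \<le> sum (wt D) J2"
            using out1 out2 by (auto simp: outcome_def)
          have "(sum (wt D) \<A> / 2 ^ s - err) / 2 ^ s \<le> sum (wt D) J1 / 2 ^ s"
            by (rule divide_right_mono[OF o1]) simp
          then show "(sum (wt D) \<A> / 2 ^ s - err) / 2 ^ s - err \<le> sum (wt D) J2" using o2 by linarith
          show "X \<subseteq> Nb i y" using X Cand by blast
          then show "y \<notin> X" using irrefl_Nb by blast
          show "finite X" using X(1) Cand(1) finite_subset by blast
          show "card X = N" by (rule X(2))
          have "joined M1 y ({} \<union> T1 \<union> \<Union>(rng ` J1))" using att1 by (simp add: attach_def)
          then show "attach M2 y {} T2 J2" unfolding attach_def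
            by (rule joined_mono) (use M2(1) T2 in blast)+
          show "attach M2 w {y} T2 J2" if "w \<in> X" for w using att2 that by blast
        qed
        moreover have "V (y, X) \<inter> Av' = {}" using y X by (auto simp: V_def)
        moreover have "(T2, J2) \<in> Pow T \<times> Pow \<A>" using T1 T2 by auto
        ultimately have ex: "\<exists>k\<in>Pow T \<times> Pow \<A>. \<exists>u. V u \<inter> Av' = {} \<and> unit_ok k u M2" by blast
        have "card M2 \<le> card M' + (c1 + n * c1)" using M2(2) M1(2) nc by linarith
        then show "?unit M2 B2" using M1 M2 ex by blast
      qed
    qed
  qed (use leg finAv unit_mono in auto)
  then show ?thesis
  proof (rule force_mono[OF _ leg])
    fix M' B' assume "?many M' B'"
    then obtain k us where MM: "M \<subseteq> M'" and us: "finite us" "card us = N" "disjoint_family_on V us"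
      and u: "\<And>u. u \<in> us \<Longrightarrow> V u \<inter> Av = {}" "\<And>u. u \<in> us \<Longrightarrow> unit_ok k u M'" by blast
    define T' where "T' = fst k"
    define J' where "J' = snd k"
    have usne: "us \<noteq> {}" using us(2) N1 by auto
    then obtain u0 where u0: "u0 \<in> us" by blast
    have T': "T' \<subseteq> T" and J': "J' \<subseteq> \<A>" and cF: "\<And>F. F \<in> FF \<Longrightarrow> card (F \<inter> T) div 2 div 2 \<le> card (F \<inter> T')"
      and wJ: "(sum (wt D) \<A> / 2 ^ s - err) / 2 ^ s - err \<le> sum (wt D) J'"
      using u(2)[OF u0] by (auto simp: unit_ok_def T'_def J'_def)
    define X where "X = (\<Union>u\<in>us. V u)"
    define Ys where "Ys = fst ` us"
    have finV: "finite (V u)" if "u \<in> us" for u using u(2)[OF that] by (simp add: unit_ok_def V_def)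
    have finX: "finite X" using us(1) finV by (simp add: X_def)
    have XA: "X \<inter> (Old \<union> Y \<union> R) = {}" using u(1) by (auto simp: Av_def X_def)
    have dis: "u = u'" if "u \<in> us" "u' \<in> us" "x \<in> V u" "x \<in> V u'" for u u' x
      using us(3) that unfolding disjoint_family_on_def by blast
    have YsX: "Ys \<subseteq> X" by (auto simp: Ys_def X_def V_def)
    have WX: "snd u \<subseteq> X" if "u \<in> us" for u using that by (auto simp: X_def V_def)
    have cYs: "card Ys = N"
    proof -
      have "inj_on fst us" by (rule inj_onI) (rule dis, auto simp: V_def)
      then show ?thesis using us(2) by (simp add: Ys_def card_image)
    qed
    have new: "F \<subseteq> X \<and> card F = N" if "F \<in> insert Ys (snd ` us)" for F
      using that YsX cYs WX u(2) by (auto simp: unit_ok_def)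
    have "inv (insert ?\<delta> D) M' (Y \<union> X) (Fn \<union> insert Ys (snd ` us)) (T' \<union> X) J'"
    proof (rule inv_insert[OF inv D MM finX XA T' J'])
      show "finite (insert Ys (snd ` us))" using us(1) by simp
      have Yw: "Ys \<inter> snd u = {}" if "u \<in> us" for u
      proof (rule ccontr)
        assume "Ys \<inter> snd u \<noteq> {}"
        then obtain u' where u': "u' \<in> us" "fst u' \<in> snd u" by (auto simp: Ys_def)
        then have "u' = u" using dis[OF u'(1) that, of "fst u'"] by (simp add: V_def)
        then show False using u(2)[OF that] u' by (simp add: unit_ok_def)
      qed
      have ww: "snd u \<inter> snd u' = {}" if "u \<in> us" "u' \<in> us" "snd u \<noteq> snd u'" for u u'
        using dis[OF that(1,2)] that(3) by (auto simp: V_def)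
      show "disjoint (insert Ys (snd ` us))" using Yw ww by (auto simp: disjoint_def)
      show "card (F \<inter> T) div 2 div 2 \<le> card (F \<inter> T')" if "F \<in> Fo \<union> Fn" for F
        using cF that by (simp add: FF_def)
      show "sum (wt D) \<A> - cost ?\<delta> \<le> sum (wt (insert ?\<delta> D)) J'"
      proof -
        have w2: "sum (wt (insert ?\<delta> D)) J' = 4 ^ s * sum (wt D) J'"
          unfolding sum_distrib_left
          by (rule sum.cong) (use D i in \<open>auto simp: wt_insert[OF finD] aff_def\<close>)
        have "4 ^ s * ((sum (wt D) \<A> / 2 ^ s - err) / 2 ^ s - err) \<le> 4 ^ s * sum (wt D) J'"
          by (rule mult_left_mono[OF wJ]) simp
        \<comment> \<open>The errors of the first and the second star game enter with the factors
          \<open>2 ^ s\<close> and \<open>4 ^ s\<close>; hence the 2 in \<open>cost\<close>.\<close>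
        moreover have "4 ^ s * ((sum (wt D) \<A> / 2 ^ s - err) / 2 ^ s - err) = sum (wt D) \<A> - 2 ^ s * err - 4 ^ s * err"
          by (simp add: four_power field_simps)
        moreover have "2 ^ s * err \<le> 4 ^ s * err" by (intro mult_right_mono power_mono err_nonneg) auto
        ultimately show ?thesis using w2 err by linarith
      qed
      fix \<tau> T1 H assume \<tau>: "\<tau> \<in> J'" and hit: "\<forall>F\<in>insert Ys (snd ` us). T1 \<inter> F \<noteq> {}" and H: "H \<subseteq> T'"
        and cl: "complete_on M' (H \<union> rng \<tau>)"
      obtain w where w: "w \<in> us" "fst w \<in> T1" using hit by (auto simp: Ys_def)
      then obtain z where z: "z \<in> snd w" "z \<in> T1" using hit by blast
      have jy: "joined M' (fst w) ({} \<union> T' \<union> \<Union>(rng ` J'))" and jz: "joined M' z ({fst w} \<union> T' \<union> \<Union>(rng ` J'))"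
        and zn: "z \<in> Nb i (fst w)"
        using u(2)[OF w(1)] z(1) by (auto simp: unit_ok_def attach_def T'_def J'_def)
      have "joined M' (fst w) (H \<union> rng \<tau>)"
        by (rule joined_mono[OF jy order_refl]) (use H \<tau> in blast)
      then have c0: "complete_on M' (insert (fst w) (H \<union> rng \<tau>))" by (rule complete_on_insert[OF cl])
      have "joined M' z (insert (fst w) (H \<union> rng \<tau>))"
        by (rule joined_mono[OF jz order_refl]) (use H \<tau> in blast)
      then have "complete_on M' ({z, fst w} \<union> (H \<union> rng \<tau>))" using complete_on_insert[OF c0] by simp
      moreover have "joined M' (fst w) T'" by (rule joined_mono[OF jy order_refl]) blast
      moreover have "joined M' z T'" by (rule joined_mono[OF jz order_refl]) blast
      moreover have "{z, fst w} \<subseteq> T1 \<inter> X" using w z by (auto simp: X_def V_def)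
      moreover have "served {?\<delta>} {z, fst w} \<tau>" using i zn by (simp add: served_def)
      ultimately show "\<exists>Z\<subseteq>T1 \<inter> X. complete_on M' (Z \<union> (H \<union> rng \<tau>)) \<and> (\<forall>z\<in>Z. joined M' z T') \<and> served {?\<delta>} Z \<tau>"
        by (intro exI[of _ "{z, fst w}"]) simp
    qed (use new in \<open>auto simp: N_def\<close>)
    then show "M \<subseteq> M' \<and> (\<exists>Y Fn T \<A>. inv (insert (i, v) D) M' Y Fn T \<A>)" using MM by blast
  qed
qed

end

section \<open>The sequence of blocks\<close>

context stage
begin

lemma all_tasks:
  assumes "inv {} M Y Fn T \<A>" "legal M B"
  shows "force (\<lambda>M' B'. M \<subseteq> M' \<and> (\<exists>Y Fn T \<A>. inv tasks M' Y Fn T \<A>)) M B"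
proof -
  have "force (\<lambda>M' B'. M \<subseteq> M' \<and> (\<exists>Y Fn T \<A>. inv D M' Y Fn T \<A>)) M B" if "D \<subseteq> tasks" for D
    using finite_subset[OF that finite_tasks] that
  proof (induction D rule: finite_induct)
    case empty
    then show ?case using assms by (intro force_done) blast
  next
    case (insert \<delta> D)
    show ?case
    proof (rule force_legal_trans[OF insert.IH assms(2)])
      show "D \<subseteq> tasks" using insert by simp
      fix M1 B1 assume "M \<subseteq> M1 \<and> (\<exists>Y Fn T \<A>. inv D M1 Y Fn T \<A>)" and leg1: "legal M1 B1"
      then obtain Y Fn T \<A> where MM: "M \<subseteq> M1" and inv: "inv D M1 Y Fn T \<A>" by blast
      obtain j v where \<delta>: "\<delta> = (j, v)" by fastforce
      have "force (\<lambda>M' B'. M1 \<subseteq> M' \<and> (\<exists>Y Fn T \<A>. inv (insert \<delta> D) M' Y Fn T \<A>)) M1 B1"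
        using task_root[OF inv leg1] task_ascending[OF inv leg1] insert \<delta> by (cases "j \<le> s") auto
      then show "force (\<lambda>M' B'. M \<subseteq> M' \<and> (\<exists>Y Fn T \<A>. inv (insert \<delta> D) M' Y Fn T \<A>)) M1 B1"
        by (rule force_mono[OF _ leg1]) (use MM in blast)
    qed
  qed
  then show ?thesis by blast
qed

text \<open>A stage begins with \<open>T = Old\<close> and all of \<open>A0\<close>; nothing that
  earlier stages lost is carried over.\<close>

lemma inv_start:
  assumes "\<And>F. F \<in> Fo \<Longrightarrow> 4 ^ n_tasks \<le> card F" "\<And>\<tau>. \<tau> \<in> A0 \<Longrightarrow> complete_on M (rng \<tau>)"
  shows "inv {} M {} {} Old A0"
proof -
  have "F \<inter> Old = F" if "F \<in> Fo" for F using that Old(2) by blast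
  then show ?thesis
    using assms Old A0 by (auto simp: inv_def sel_def wt_def served_def)
qed

end

section \<open>Blocks and the invariant of the infinite construction\<close>

type_synonym block = "nat set \<times> nat set set \<times> nat set \<times> (nat \<Rightarrow> nat)"

definition bverts :: "block \<Rightarrow> nat set" where "bverts = fst"
definition bclasses :: "block \<Rightarrow> nat set set" where "bclasses b = fst (snd b)"
definition blinks :: "block \<Rightarrow> nat set" where "blinks b = fst (snd (snd b))"
definition btuple :: "block \<Rightarrow> nat \<Rightarrow> nat" where "btuple b = snd (snd (snd b))"

text \<open>\<open>c_big\<close> makes the tuples left by the base phase,
  \<open>NN / 2 ^ (s ^ 2)\<close> up to an error of \<open>(s ^ 2 + 1) * NN / c\<close>, exceed the
  total cost of a stage. \<open>t_pos\<close> provides a graph whose infinitely many edges force the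
  limit clique to be infinite.\<close>

locale big_roots = roots +
  assumes c_big: "real c > 2 ^ (s ^ 2) * ((s ^ 2 + 1) + 4 ^ s * Wm * (s + 1) * (s + 2 * t))"
    and t_pos: "t \<ge> 1"
begin

lemma sum_cost: "sum cost tasks = 4 ^ s * Wm * (s + 1) * (s + 2 * t) * NN / c"
proof -
  let ?A = "SIGMA j:{1..s}. U j" and ?B = "{s + 1..s + t} \<times> {0::nat}"
  have "sum cost tasks = sum cost ?A + sum cost ?B"
    unfolding tasks_def by (rule sum.union_disjoint) (use finite_U in auto)
  also have "sum cost ?A = (\<Sum>\<delta>\<in>?A. 4 ^ s * Wm * (s + 1) * NN / c ^ 2)"
    by (rule sum.cong) (auto simp: cost_def)
  also have "\<dots> = real (card ?A) * (4 ^ s * Wm * (s + 1) * NN / c ^ 2)" by simp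
  also have "card ?A = s * c" using finite_U cardU by (subst card_SigmaI) auto
  also have "sum cost ?B = (\<Sum>\<delta>\<in>?B. 2 * 4 ^ s * Wm * (s + 1) * NN / c)"
    by (rule sum.cong) (auto simp: cost_def)
  also have "\<dots> = real t * (2 * 4 ^ s * Wm * (s + 1) * NN / c)"
    by (simp add: card_cartesian_product)
  finally have 1: "sum cost tasks = real (s * c) * (4 ^ s * Wm * (s + 1) * NN / c ^ 2) + real t * (2 * 4 ^ s * Wm * (s + 1) * NN / c)" .
  define Z where "Z = 4 ^ s * Wm * (s + 1) * NN / c"
  have 2: "real (s * c) * (4 ^ s * Wm * (s + 1) * NN / c ^ 2) = s * Z"
    using c_pos by (simp add: Z_def power2_eq_square)
  have 3: "2 * 4 ^ s * Wm * (s + 1) * NN / c = 2 * Z" by (simp add: Z_def)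
  have 4: "4 ^ s * Wm * (s + 1) * (s + 2 * t) * NN / c = (s + 2 * t) * Z" by (simp add: Z_def)
  show ?thesis unfolding 1 2 3 4 by (simp add: distrib_right)
qed

definition big where "big A0 M \<longleftrightarrow> A0 \<subseteq> tuples \<and> real (card A0) > sum cost tasks \<and> (\<forall>\<tau>\<in>A0. complete_on M (rng \<tau>))"

text \<open>The potential argument on pairs of roots, with one winning set per tuple. Two different
  pairs span at least three vertices and so lie in at most \<open>NN / c ^ 3\<close> common tuples;
  over the at most \<open>(s * c) ^ 2\<close> pairs the error is of order
  \<open>NN / c\<close>.\<close>

lemma base_phase: "force (\<lambda>M B. \<exists>A0. big A0 M) {} {}"
proof -
  let ?F = "nsets R 2"
  have sub: "nsets (rng \<tau>) 2 \<subseteq> ?F" if "\<tau> \<in> tuples" for \<tau>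
    using rng_R[OF that] by (rule nsets_mono)
  define D where "D = NN / real c ^ 3"
  define W where "W = NN / real c ^ 2"
  have finF: "finite ?F" by (simp add: finite_R finite_imp_finite_nsets)
  let ?Q = "\<lambda>M. (\<Sum>\<tau>\<in>tuples. 1 / 2 ^ card (nsets (rng \<tau>) 2)) - D * card ?F - W
      \<le> (\<Sum>\<tau>\<in>{\<tau> \<in> tuples. nsets (rng \<tau>) 2 \<subseteq> M}. 1)"
  have "sp ?Q ?F {}"
  proof (rule sp_beck)
    show "D \<ge> 0" "W \<ge> 0" by (auto simp: D_def W_def)
    fix e g :: "nat set" assume eg: "e \<noteq> g"
    show "(\<Sum>\<tau>\<in>{\<tau> \<in> tuples. e \<in> nsets (rng \<tau>) 2 \<and> g \<in> nsets (rng \<tau>) 2}. 1) \<le> D"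
    proof (cases "finite e \<and> card e = 2 \<and> finite g \<and> card g = 2")
      case True
      have "card (e \<union> g) \<ge> 3"
      proof (rule ccontr)
        assume "\<not> 3 \<le> card (e \<union> g)"
        then have "card (e \<union> g) \<le> card e" "card (e \<union> g) \<le> card g" using True by auto
        then have "e = e \<union> g" "g = e \<union> g" using True by (metis card_seteq finite_UnI sup_ge1, metis card_seteq finite_UnI sup_ge2)
        then show False using eg by simp
      qed
      then have p: "real c ^ card (e \<union> g) \<ge> real c ^ 3" using c_pos by (intro power_increasing) auto
      have "(\<Sum>\<tau>\<in>{\<tau> \<in> tuples. e \<in> nsets (rng \<tau>) 2 \<and> g \<in> nsets (rng \<tau>) 2}. 1::real) \<le> 1 * NN / real c ^ card (e \<union> g)"
        by (rule sum_through) (use True in \<open>auto simp: nsets_def\<close>)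
      also have "\<dots> \<le> D" unfolding D_def mult_1 using p c_pos by (intro divide_left_mono mult_pos_pos) auto
      finally show ?thesis by simp
    next
      case False
      then have "{\<tau> \<in> tuples. e \<in> nsets (rng \<tau>) 2 \<and> g \<in> nsets (rng \<tau>) 2} = {}" by (auto simp: nsets_def)
      then show ?thesis using \<open>D \<ge> 0\<close> by (simp only: sum.empty)
    qed
  next
    fix e :: "nat set"
    show "(\<Sum>\<tau>\<in>{\<tau> \<in> tuples. e \<in> nsets (rng \<tau>) 2}. 1) \<le> W"
    proof (cases "finite e \<and> card e = 2")
      case True
      have "(\<Sum>\<tau>\<in>{\<tau> \<in> tuples. e \<in> nsets (rng \<tau>) 2}. 1::real) \<le> 1 * NN / real c ^ card e"
        by (rule sum_through) (use True in \<open>auto simp: nsets_def\<close>)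
      then show ?thesis using True by (simp add: W_def)
    next
      case False
      then have "{\<tau> \<in> tuples. e \<in> nsets (rng \<tau>) 2} = {}" by (auto simp: nsets_def)
      then show ?thesis by (simp only: sum.empty W_def) simp
    qed
  qed (use finF finite_tuples sub in auto)
  then have "force (\<lambda>M' B'. {} \<subseteq> M' \<and> M' \<subseteq> {} \<union> ?F \<and>
      ?Q M') {} {}"
  proof (rule sp_force[where g = "{}"])
    show "legal {} {}" by (simp add: legal_def)
    show "?F \<subseteq> board_edges" unfolding board_edges_eq by (rule nsets_mono) simp
    fix M M' :: "nat set set" assume M: "M \<subseteq> M'"
    have "(\<Sum>\<tau>\<in>{\<tau> \<in> tuples. nsets (rng \<tau>) 2 \<subseteq> M}. 1::real) \<le> (\<Sum>\<tau>\<in>{\<tau> \<in> tuples. nsets (rng \<tau>) 2 \<subseteq> M'}. 1)"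
      by (rule sum_mono2) (use M finite_tuples in auto)
    then show "?Q M'"
      if "?Q M" using that by linarith
  qed (use finF in auto)
  then show ?thesis
  proof (rule force_mono)
    show "legal {} {}" by (simp add: legal_def)
    fix M' B' assume M': "{} \<subseteq> M' \<and> M' \<subseteq> {} \<union> ?F \<and>
      ?Q M'"
    define A0 where "A0 = {\<tau> \<in> tuples. nsets (rng \<tau>) 2 \<subseteq> M'}"
    have "complete_on M' (rng \<tau>)" if "\<tau> \<in> A0" for \<tau>
      using that by (auto simp: A0_def complete_on_def)
    moreover have "real (card A0) > sum cost tasks"
    proof -
      have 1: "NN / 2 ^ (s ^ 2) \<le> (\<Sum>\<tau>\<in>tuples. 1 / 2 ^ card (nsets (rng \<tau>) 2))"
      proof -
        have "card (nsets (rng \<tau>) 2) \<le> s ^ 2" for \<tau>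
        proof -
          have "card (nsets (rng \<tau>) 2) = card (rng \<tau>) choose 2" by (rule card_nsets)
          also have "\<dots> \<le> card (rng \<tau>) ^ 2"
            using binomial_le_pow[of 2 "card (rng \<tau>)"] by (cases "2 \<le> card (rng \<tau>)") (auto simp: binomial_eq_0)
          also have "\<dots> \<le> s ^ 2" using card_rng by (simp add: power_mono)
          finally show ?thesis .
        qed
        then have "(\<Sum>\<tau>\<in>tuples. 1 / 2 ^ (s ^ 2) :: real) \<le> (\<Sum>\<tau>\<in>tuples. 1 / 2 ^ card (nsets (rng \<tau>) 2))"
          by (intro sum_mono divide_left_mono power_increasing) auto
        then show ?thesis by (simp add: card_tuples)
      qed
      have 2: "D * card ?F + W \<le> (s ^ 2 + 1) * NN / c"
      proof -
        have "card ?F = (s * c) choose 2" by (simp add: card_nsets card_R)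
        also have "\<dots> \<le> (s * c) ^ 2"
          using binomial_le_pow[of 2 "s * c"] by (cases "2 \<le> s * c") (auto simp: binomial_eq_0)
        finally have "real (card ?F) \<le> real ((s * c) ^ 2)" by (simp only: of_nat_le_iff)
        then have "D * card ?F \<le> D * real ((s * c) ^ 2)" by (intro mult_left_mono) (simp_all add: D_def)
        also have "\<dots> = s ^ 2 * NN / c"
          using c_pos by (simp add: D_def power2_eq_square power3_eq_cube)
        finally have a: "D * card ?F \<le> s ^ 2 * NN / c" .
        have "W \<le> NN / c" unfolding W_def
          using c_pos by (intro divide_left_mono) (auto simp: power2_eq_square mult_le_cancel_left1)
        then show ?thesis using a by (simp add: algebra_simps add_divide_distrib)
      qed
      have N: "NN > 0" using c_pos by simp
      have "((s ^ 2 + 1) + 4 ^ s * Wm * (s + 1) * (s + 2 * t)) / c < 1 / 2 ^ (s ^ 2)"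
        using c_big c_pos by (simp add: field_simps)
      then have "NN * (((s ^ 2 + 1) + 4 ^ s * Wm * (s + 1) * (s + 2 * t)) / c) < NN * (1 / 2 ^ (s ^ 2))"
        using N by (rule mult_strict_left_mono)
      then have "(s ^ 2 + 1) * NN / c + sum cost tasks < NN / 2 ^ (s ^ 2)"
        unfolding sum_cost by (simp add: algebra_simps add_divide_distrib)
      moreover have "(\<Sum>\<tau>\<in>tuples. 1 / 2 ^ card (nsets (rng \<tau>) 2)) - D * card ?F - W \<le> real (card A0)"
        using M' by (simp add: A0_def)
      ultimately show ?thesis using 1 2 by linarith
    qed
    ultimately have "big A0 M'" by (auto simp: big_def A0_def)
    then show "\<exists>A0. big A0 M'" by blast
  qed
qed

definition old where "old bs = (\<Union>b\<in>set bs. bverts b)"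

definition block_shape :: "block list \<Rightarrow> block \<Rightarrow> bool" where
  "block_shape bs b \<longleftrightarrow> finite (bverts b) \<and> finite (bclasses b) \<and> \<Union>(bclasses b) \<subseteq> bverts b \<and>
     bverts b \<inter> (old bs \<union> R) = {} \<and> (\<forall>F\<in>bclasses b. 4 ^ n_tasks \<le> card F) \<and> btuple b \<in> tuples \<and>
     (\<forall>a\<in>set bs. \<forall>F\<in>bclasses a. blinks b \<inter> F \<noteq> {})"

text \<open>In contrast to \<open>sel\<close>, \<open>T'\<close> is arbitrary. The classes stored in
  a block are already cut down to the surviving vertices, so \<open>T'\<close> may be intersected
  with these.\<close>

definition block_sel :: "nat set set \<Rightarrow> block list \<Rightarrow> block \<Rightarrow> bool" where
  "block_sel M bs b \<longleftrightarrow> (\<forall>T'. (\<forall>F\<in>bclasses b. T' \<inter> F \<noteq> {}) \<longrightarrow>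
       (\<exists>H\<subseteq>T' \<inter> bverts b. complete_on M (H \<union> rng (btuple b)) \<and> (\<forall>h\<in>H. joined M h (blinks b \<inter> old bs)) \<and>
          served tasks H (btuple b)))"

definition block_ok :: "nat set set \<Rightarrow> block list \<Rightarrow> block \<Rightarrow> bool" where
  "block_ok M bs b \<longleftrightarrow> block_shape bs b \<and> block_sel M bs b"

text \<open>A block is judged only against the blocks before it, with its own tuple and its own
  links; different blocks need not agree.\<close>

definition Inv :: "block list \<Rightarrow> nat set set \<Rightarrow> bool" where
  "Inv bs M \<longleftrightarrow> (\<exists>A0. big A0 M) \<and> disjoint (\<Union>b\<in>set bs. bclasses b) \<and>
     (\<forall>k<length bs. block_ok M (take k bs) (bs ! k))"

lemma block_selD:
  "block_sel M bs b \<Longrightarrow> \<forall>F\<in>bclasses b. T' \<inter> F \<noteq> {} \<Longrightarrow>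
   \<exists>H. H \<subseteq> T' \<inter> bverts b \<and> complete_on M (H \<union> rng (btuple b)) \<and> (\<forall>h\<in>H. joined M h (blinks b \<inter> old bs)) \<and>
     served tasks H (btuple b)"
  unfolding block_sel_def by blast

lemma block_ok_mono:
  assumes ok: "block_ok M bs b" and MM: "M \<subseteq> M'"
  shows "block_ok M' bs b"
proof -
  have "block_sel M' bs b"
    unfolding block_sel_def
  proof (intro allI impI)
    fix T' assume hit: "\<forall>F\<in>bclasses b. T' \<inter> F \<noteq> {}"
    have "block_sel M bs b" using ok by (simp add: block_ok_def)
    from block_selD[OF this hit] obtain H where H: "H \<subseteq> T' \<inter> bverts b" "complete_on M (H \<union> rng (btuple b))"
      "\<forall>h\<in>H. joined M h (blinks b \<inter> old bs)" "served tasks H (btuple b)" by blast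
    show "\<exists>H\<subseteq>T' \<inter> bverts b. complete_on M' (H \<union> rng (btuple b)) \<and> (\<forall>h\<in>H. joined M' h (blinks b \<inter> old bs)) \<and>
          served tasks H (btuple b)"
      using H(1,4) complete_on_mono[OF H(2) MM order_refl] joined_mono[OF _ MM order_refl] H(3)
      by (intro exI[of _ H] conjI) auto
  qed
  then show ?thesis using ok by (simp add: block_ok_def)
qed

lemma Inv_mono:
  assumes "Inv bs M" "M \<subseteq> M'"
  shows "Inv bs M'"
proof -
  have "big A0 M'" if "big A0 M" for A0
    using that complete_on_mono[OF _ assms(2) order_refl] by (auto simp: big_def)
  then show ?thesis using assms(1) block_ok_mono[OF _ assms(2)] unfolding Inv_def by blast
qed

lemma Inv_progress:
  assumes leg: "legal M B" and I: "Inv bs M"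
  shows "force (\<lambda>M' B'. \<exists>bs'. (\<exists>b. bs' = bs @ [b]) \<and> Inv bs' M') M B"
proof -
  obtain A0 where big: "A0 \<subseteq> tuples" "real (card A0) > sum cost tasks" "\<forall>\<tau>\<in>A0. complete_on M (rng \<tau>)"
    using I by (auto simp: Inv_def big_def)
  have ok: "\<exists>bs'. block_ok M bs' b" if b: "b \<in> set bs" for b
  proof -
    obtain k where "k < length bs" "b = bs ! k" using b by (metis in_set_conv_nth)
    then show ?thesis using I by (auto simp: Inv_def)
  qed
  have okD: "finite (bverts b)" "finite (bclasses b)" "\<Union>(bclasses b) \<subseteq> bverts b" "bverts b \<inter> R = {}"
    "\<forall>F\<in>bclasses b. 4 ^ n_tasks \<le> card F" if "b \<in> set bs" for b
    using ok[OF that] by (auto simp: block_ok_def block_shape_def)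
  define Fo where "Fo = (\<Union>b\<in>set bs. bclasses b)"
  interpret stage s t c U Nb "old bs" Fo A0
  proof
    show "finite (old bs)" "finite Fo" using okD by (auto simp: old_def Fo_def)
    show "\<Union>Fo \<subseteq> old bs" using okD(3) by (fastforce simp: old_def Fo_def)
    show "disjoint Fo" using I by (simp add: Inv_def Fo_def)
    show "old bs \<inter> R = {}" using okD(4) unfolding old_def by blast
  qed (rule big(1))
  have start: "inv {} M {} {} (old bs) A0"
    by (rule inv_start) (use okD(5) big(3) in \<open>auto simp: Fo_def\<close>)
  show ?thesis
  proof (rule force_mono[OF all_tasks[OF start leg] leg])
    fix M' B' assume "M \<subseteq> M' \<and> (\<exists>Y Fn T \<A>. inv tasks M' Y Fn T \<A>)"
    then obtain Y Fn T \<A> where MM: "M \<subseteq> M'" and inv: "inv tasks M' Y Fn T \<A>" by blast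
    note J = inv[unfolded inv_def]
    \<comment> \<open>The remaining weight is positive, so some tuple is still alive, and the new
      block commits itself to it.\<close>
    have "sum (wt tasks) \<A> > 0" using J big(2) by linarith
    then have "\<A> \<noteq> {}" by auto
    then obtain \<tau> where \<tau>: "\<tau> \<in> \<A>" by blast
    define b :: block where "b = (Y, (\<lambda>F. F \<inter> T) ` Fn, T \<inter> old bs, \<tau>)"
    have b [simp]: "bverts b = Y" "bclasses b = (\<lambda>F. F \<inter> T) ` Fn" "blinks b = T \<inter> old bs" "btuple b = \<tau>"
      by (auto simp: b_def bverts_def bclasses_def blinks_def btuple_def)
    have sel: "sel tasks M' Y Fn T \<A>" and disj: "disjoint (Fo \<union> Fn)" using J by auto
    have okb: "block_ok M' bs b"
      unfolding block_ok_def block_shape_def block_sel_def b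
    proof (intro conjI ballI allI impI)
      show "finite Y" "finite ((\<lambda>F. F \<inter> T) ` Fn)" "\<Union>((\<lambda>F. F \<inter> T) ` Fn) \<subseteq> Y" "Y \<inter> (old bs \<union> R) = {}"
        using J by auto
      show "\<tau> \<in> tuples" using J \<tau> big(1) by blast
      show "4 ^ n_tasks \<le> card F" if "F \<in> (\<lambda>F. F \<inter> T) ` Fn" for F
      proof -
        have "2 * n_tasks - n_tasks = n_tasks" by simp
        then show ?thesis using J that by auto
      qed
      fix a F assume "a \<in> set bs" "F \<in> bclasses a"
      then have F: "F \<in> Fo" by (auto simp: Fo_def)
      \<comment> \<open>An old class entered the stage with at least \<open>4 ^ n_tasks\<close>
        vertices and was at most quartered \<open>n_tasks\<close> times, so at least one vertex is
        left.\<close>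
      have "\<forall>F\<in>Fo. 4 ^ (n_tasks - n_tasks) \<le> card (F \<inter> T)" using J by blast
      then have "4 ^ (n_tasks - n_tasks) \<le> card (F \<inter> T)" using F by (rule bspec)
      then have "F \<inter> T \<noteq> {}" by auto
      moreover have "F \<subseteq> old bs" using F Old(2) by blast
      ultimately show "T \<inter> old bs \<inter> F \<noteq> {}" by blast
    next
      fix T' assume hit: "\<forall>F\<in>(\<lambda>F. F \<inter> T) ` Fn. T' \<inter> F \<noteq> {}"
      have "\<forall>F\<in>Fn. (T' \<inter> T) \<inter> F \<noteq> {}" using hit by (simp add: Int_ac)
      then obtain H where H: "H \<subseteq> T' \<inter> T \<inter> Y" "complete_on M' (H \<union> rng \<tau>)" "\<forall>h\<in>H. joined M' h (T \<inter> old bs)"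
        "served tasks H \<tau>" using sel_apply[OF sel \<tau>, of "T' \<inter> T"] by blast
      have "T \<inter> old bs \<inter> old bs = T \<inter> old bs" by blast
      with H show "\<exists>H\<subseteq>T' \<inter> Y. complete_on M' (H \<union> rng \<tau>) \<and> (\<forall>h\<in>H. joined M' h (T \<inter> old bs \<inter> old bs)) \<and> served tasks H \<tau>"
        by (intro exI[of _ H]) auto
    qed
    have "disjoint (Fo \<union> (\<lambda>F. F \<inter> T) ` Fn)"
    proof -
      have 1: "F \<inter> (G \<inter> T) = {}" if "F \<in> Fo" "G \<in> Fn" for F G
      proof -
        have "F \<subseteq> old bs" "G \<subseteq> Y" using that Old(2) J by auto
        then show ?thesis using J by blast
      qed
      have 2: "(F \<inter> T) \<inter> (G \<inter> T) = {}" if "F \<in> Fn" "G \<in> Fn" "F \<inter> T \<noteq> G \<inter> T" for F G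
        using disj that unfolding disjoint_def by blast
      have 3: "F \<inter> G = {}" if "F \<in> Fo" "G \<in> Fo" "F \<noteq> G" for F G
        using disj that unfolding disjoint_def by blast
      show ?thesis unfolding disjoint_def
        by (intro ballI impI; elim UnE imageE; metis 1 2 3 Int_commute)
    qed
    moreover have "block_ok M' (take k (bs @ [b])) ((bs @ [b]) ! k)" if "k < length (bs @ [b])" for k
    proof (cases "k = length bs")
      case True
      then show ?thesis using okb by simp
    next
      case False
      then have "k < length bs" using that by simp
      then have "block_ok M (take k bs) (bs ! k)" using I by (simp add: Inv_def)
      then show ?thesis using block_ok_mono[OF _ MM] \<open>k < length bs\<close> by (simp add: nth_append)
    qed
    moreover have "big A0 M'" using big complete_on_mono[OF _ MM order_refl] by (auto simp: big_def)
    ultimately have "Inv (bs @ [b]) M'"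
      unfolding Inv_def by (auto simp: Fo_def Un_commute)
    then show "\<exists>bs'. (\<exists>b. bs' = bs @ [b]) \<and> Inv bs' M'" by blast
  qed
qed

end

section \<open>The limit clique\<close>

text \<open>Nested infinite index sets: after the least index is taken, the rest is thinned out
  until all traces on its finite set \<open>Y (m S)\<close> coincide.\<close>

lemma diagonal_subsequence:
  fixes T Y :: "nat \<Rightarrow> 'b set"
  assumes fin: "\<And>n. finite (Y n)" and I0: "infinite I0"
  shows "\<exists>(\<nu> :: nat \<Rightarrow> nat) B. strict_mono \<nu> \<and> range \<nu> \<subseteq> I0 \<and> (\<forall>k l. k < l \<longrightarrow> T (\<nu> l) \<inter> Y (\<nu> k) = B k)"
proof -
  define m where "m S = (LEAST n. n \<in> S)" for S :: "nat set"
  have m_in: "m S \<in> S" if "infinite S" for S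
    unfolding m_def using that by (metis LeastI ex_in_conv finite.emptyI)
  have step: "\<exists>S'. infinite S' \<and> S' \<subseteq> S \<and> (\<forall>n\<in>S'. m S < n) \<and> (\<exists>B. \<forall>n\<in>S'. T n \<inter> Y (m S) = B)"
    if S: "infinite S" for S
  proof -
    let ?S = "S \<inter> {m S<..}"
    have "S \<subseteq> ?S \<union> {..m S}" by auto
    then have inf: "infinite ?S" using S finite_subset by blast
    have "finite ((\<lambda>n. T n \<inter> Y (m S)) ` ?S)"
      by (rule finite_subset[of _ "Pow (Y (m S))"]) (use fin in auto)
    then obtain a where a: "infinite {n \<in> ?S. T n \<inter> Y (m S) = T a \<inter> Y (m S)}"
      using pigeonhole_infinite[OF inf] by blast
    show ?thesis
      by (rule exI[of _ "{n \<in> ?S. T n \<inter> Y (m S) = T a \<inter> Y (m S)}"]) (use a in auto)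
  qed
  have "\<exists>S. \<forall>n. (infinite (S n) \<and> S n \<subseteq> I0) \<and>
      (S (Suc n) \<subseteq> S n \<and> (\<forall>k\<in>S (Suc n). m (S n) < k) \<and> (\<exists>B. \<forall>k\<in>S (Suc n). T k \<inter> Y (m (S n)) = B))"
  proof (rule dependent_nat_choice)
    show "\<exists>S. infinite S \<and> S \<subseteq> I0" using I0 by blast
    fix S and n :: nat assume S: "infinite S \<and> S \<subseteq> I0"
    from step[OF conjunct1[OF S]] obtain S' where "infinite S' \<and> S' \<subseteq> S \<and> (\<forall>n\<in>S'. m S < n) \<and>
      (\<exists>B. \<forall>n\<in>S'. T n \<inter> Y (m S) = B)" by (rule exE)
    moreover from this have "S' \<subseteq> I0" using S order_trans by metis
    ultimately show "\<exists>S'. (infinite S' \<and> S' \<subseteq> I0) \<and> S' \<subseteq> S \<and> (\<forall>k\<in>S'. m S < k) \<and> (\<exists>B. \<forall>k\<in>S'. T k \<inter> Y (m S) = B)"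
      by (intro exI[of _ S']) simp
  qed
  then obtain S where "\<forall>n. (infinite (S n) \<and> S n \<subseteq> I0) \<and>
      (S (Suc n) \<subseteq> S n \<and> (\<forall>k\<in>S (Suc n). m (S n) < k) \<and> (\<exists>B. \<forall>k\<in>S (Suc n). T k \<inter> Y (m (S n)) = B))"
    by (rule exE)
  then have S: "\<And>n. infinite (S n)" "\<And>n. S n \<subseteq> I0" "\<And>n. S (Suc n) \<subseteq> S n"
    "\<And>n k. k \<in> S (Suc n) \<Longrightarrow> m (S n) < k" "\<And>n. \<exists>B. \<forall>k\<in>S (Suc n). T k \<inter> Y (m (S n)) = B" by simp_all
  then obtain B where B: "\<And>n k. k \<in> S (Suc n) \<Longrightarrow> T k \<inter> Y (m (S n)) = B n" by metis
  have dec: "S l \<subseteq> S k" if "k \<le> l" for k l using that S(3) lift_Suc_antimono_le by metis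
  have in_S: "m (S l) \<in> S (Suc k)" if "k < l" for k l using m_in[OF S(1)] dec[of "Suc k" l] that by auto
  show ?thesis
  proof (intro exI conjI allI impI)
    show "strict_mono (\<lambda>k. m (S k))" using S(4) in_S by (intro strict_monoI) auto
    show "range (\<lambda>k. m (S k)) \<subseteq> I0" using m_in S(1,2) by blast
    show "T (m (S l)) \<inter> Y (m (S k)) = B k" if "k < l" for k l using B in_S[OF that] by blast
  qed
qed

context big_roots
begin

definition coloured :: "nat set \<Rightarrow> nat \<Rightarrow> nat set set" where
  "coloured K i = {e \<in> nsets K 2. \<exists>x y. e = {x, y} \<and> y \<in> Nb i x}"

text \<open>\<open>B k\<close> is the common trace of all later links on the \<open>k\<close>-th
  chosen block. It meets every class of that block because the next links do, so a clique
  \<open>H k\<close> can be selected inside \<open>B k\<close>, and then all later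
  \<open>H l\<close> are joined to it.\<close>

lemma limit_clique:
  fixes \<alpha> :: "nat \<Rightarrow> block list" and b :: "nat \<Rightarrow> block"
  assumes Inv: "\<And>n. Inv (\<alpha> n) M" and \<alpha>0: "\<alpha> 0 = []" and \<alpha>_Suc: "\<And>n. \<alpha> (Suc n) = \<alpha> n @ [b n]"
  shows "\<exists>K. infinite K \<and> complete_on M K \<and>
    (\<forall>i\<in>{1..s + t}. infinite (coloured K i))"
proof -
  have \<alpha>: "\<alpha> n = map b [0..<n]" for n by (induction n) (simp_all add: \<alpha>0 \<alpha>_Suc)
  have ok: "block_ok M (\<alpha> n) (b n)" for n
  proof -
    have "block_ok M (take n (\<alpha> (Suc n))) (\<alpha> (Suc n) ! n)"
      using Inv[of "Suc n"] unfolding Inv_def by (auto simp: \<alpha>)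
    then show ?thesis by (simp add: \<alpha> take_map nth_append)
  qed
  define Y where "Y n = bverts (b n)" for n
  define T where "T n = blinks (b n)" for n
  have set_\<alpha>: "set (\<alpha> n) = b ` {..<n}" for n by (auto simp: \<alpha>)
  have old: "old (\<alpha> n) = (\<Union>m<n. Y m)" for n by (simp add: old_def set_\<alpha> Y_def)
  have shape: "block_shape (\<alpha> n) (b n)" and sel: "block_sel M (\<alpha> n) (b n)" for n
    using ok by (auto simp: block_ok_def)
  have finY: "finite (Y n)" and cls: "\<Union>(bclasses (b n)) \<subseteq> Y n" and tup: "btuple (b n) \<in> tuples" 
    and YR: "Y n \<inter> R = {}" and Yold: "Y n \<inter> old (\<alpha> n) = {}" for n
    using shape[of n] unfolding block_shape_def Y_def by blast+
  have hits: "T n \<inter> F \<noteq> {}" if "m < n" "F \<in> bclasses (b m)" for m n F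
    using shape[of n] that unfolding block_shape_def T_def set_\<alpha> by blast
  have Ydisj: "Y m \<inter> Y n = {}" if "m < n" for m n
    using Yold[of n] that unfolding old by blast
  have "finite ((\<lambda>n. btuple (b n)) ` UNIV)"
    by (rule finite_subset[OF _ finite_tuples]) (use tup in auto)
  then obtain n0 where "infinite {n \<in> UNIV. btuple (b n) = btuple (b n0)}"
    using pigeonhole_infinite[of UNIV "\<lambda>n. btuple (b n)"] by auto
  moreover define \<tau> where "\<tau> = btuple (b n0)"
  ultimately have "infinite {n. btuple (b n) = \<tau>}" by simp
  from diagonal_subsequence[of Y, OF finY this, of T] obtain \<nu> :: "nat \<Rightarrow> nat" where
    "\<exists>B. strict_mono \<nu> \<and> range \<nu> \<subseteq> {n. btuple (b n) = \<tau>} \<and> (\<forall>k l. k < l \<longrightarrow> T (\<nu> l) \<inter> Y (\<nu> k) = B k)"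
    by (rule exE)
  then obtain B where
    \<nu>B: "strict_mono \<nu> \<and> range \<nu> \<subseteq> {n. btuple (b n) = \<tau>} \<and> (\<forall>k l. k < l \<longrightarrow> T (\<nu> l) \<inter> Y (\<nu> k) = B k)"
    by (rule exE)
  then have \<nu>: "strict_mono \<nu>" "range \<nu> \<subseteq> {n. btuple (b n) = \<tau>}"
    and B: "\<And>k l. k < l \<Longrightarrow> T (\<nu> l) \<inter> Y (\<nu> k) = B k" by simp_all
  have \<tau>: "btuple (b (\<nu> k)) = \<tau>" for k using \<nu>(2) by blast
  have \<tau>_tup: "\<tau> \<in> tuples" using tup \<tau>_def by simp
  have lt: "\<nu> k < \<nu> l" if "k < l" for k l using \<nu>(1) that by (simp add: strict_mono_def)
  have "\<exists>H. H \<subseteq> B k \<inter> Y (\<nu> k) \<and> complete_on M (H \<union> rng \<tau>) \<and> (\<forall>h\<in>H. joined M h (T (\<nu> k) \<inter> old (\<alpha> (\<nu> k)))) \<and>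
    served tasks H \<tau>" for k
  proof -
    have "\<forall>F\<in>bclasses (b (\<nu> k)). B k \<inter> F \<noteq> {}"
    proof
      fix F assume F: "F \<in> bclasses (b (\<nu> k))"
      have "T (\<nu> (Suc k)) \<inter> F \<noteq> {}" using hits[OF lt F, of "Suc k"] by simp
      moreover have "F \<subseteq> Y (\<nu> k)" using F cls by blast
      ultimately show "B k \<inter> F \<noteq> {}" using B[of k "Suc k"] by blast
    qed
    from block_selD[OF sel this] show ?thesis by (simp add: Y_def T_def \<tau>)
  qed
  then obtain H where H: "\<And>k. H k \<subseteq> B k \<inter> Y (\<nu> k)" "\<And>k. complete_on M (H k \<union> rng \<tau>)"
    "\<And>k h. h \<in> H k \<Longrightarrow> joined M h (T (\<nu> k) \<inter> old (\<alpha> (\<nu> k)))" "\<And>k. served tasks (H k) \<tau>" by metis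
  have link: "{h, h'} \<in> M" if "j < k" "h \<in> H k" "h' \<in> H j" for j k h h'
  proof -
    have "h' \<in> B j" "h' \<in> Y (\<nu> j)" using that H(1) by blast+
    then have "h' \<in> T (\<nu> k)" "h' \<in> old (\<alpha> (\<nu> k))" using B[OF that(1)] lt[OF that(1)] by (auto simp: old)
    then show ?thesis using H(3)[OF that(2)] by (auto simp: joined_def)
  qed
  define K where "K = rng \<tau> \<union> (\<Union>k. H k)"
  have comp: "complete_on M K"
    unfolding complete_on_def
  proof (intro ballI impI)
    fix x y assume xy: "x \<in> K" "y \<in> K" "x \<noteq> y"
    have same: "{x, y} \<in> M" if "x \<in> H k \<union> rng \<tau>" "y \<in> H k \<union> rng \<tau>" for k
      using H(2)[of k] that xy(3) by (auto simp: complete_on_def)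
    consider "x \<in> rng \<tau>" "y \<in> rng \<tau>" | k where "x \<in> rng \<tau>" "y \<in> H k" | k where "x \<in> H k" "y \<in> rng \<tau>"
      | k j where "x \<in> H k" "y \<in> H j" using xy unfolding K_def by blast
    then show "{x, y} \<in> M"
    proof cases
      case (4 k j)
      consider "k = j" | "j < k" | "k < j" by linarith
      then show ?thesis using 4 same link[of j k x y] link[of k j y x] by cases (auto simp: insert_commute)
    qed (use same in blast)+
  qed
  have Hdisj: "H j \<inter> H k = {}" if "j \<noteq> k" for j k
  proof -
    have "Y (\<nu> j) \<inter> Y (\<nu> k) = {}" using that Ydisj lt by (metis Int_commute linorder_neqE_nat)
    then show ?thesis using H(1) by blast
  qed
  have HR: "H k \<inter> rng \<tau> = {}" for k using H(1) YR rng_R[OF \<tau>_tup] by blast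
  have col: "infinite (coloured K i)" if i: "i \<in> {1..s + t}" for i
  proof -
    have "\<exists>e. e \<in> nsets K 2 \<and> (\<exists>x y. e = {x, y} \<and> y \<in> Nb i x) \<and> e \<inter> H k \<noteq> {} \<and> e \<subseteq> H k \<union> rng \<tau>" for k
    proof (cases "i \<le> s")
      case True
      then have "(i, \<tau> i) \<in> tasks" using i tuple_in[OF \<tau>_tup, of i] by (auto simp: tasks_def)
      then obtain h where h: "h \<in> H k" "h \<in> Nb i (\<tau> i)"
        using H(4)[of k] True by (fastforce simp: served_def aff_def)
      have r: "\<tau> i \<in> rng \<tau>" using i True by (auto simp: rng_def)
      then have "\<tau> i \<noteq> h" using h HR by blast
      then have "{\<tau> i, h} \<in> nsets K 2" using h r by (auto simp: K_def)
      then show ?thesis using h r by blast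
    next
      case False
      then have "(i, 0) \<in> tasks" using i by (auto simp: tasks_def)
      then obtain h h' where h: "h \<in> H k" "h' \<in> H k" "h' \<in> Nb i h"
        using H(4)[of k] False by (fastforce simp: served_def aff_def)
      then have "h \<noteq> h'" using irrefl_Nb by metis
      then have "{h, h'} \<in> nsets K 2" using h by (auto simp: K_def)
      then show ?thesis using h by blast
    qed
    then obtain e where e: "\<And>k. e k \<in> nsets K 2" "\<And>k. \<exists>x y. e k = {x, y} \<and> y \<in> Nb i x"
      "\<And>k. e k \<inter> H k \<noteq> {}" "\<And>k. e k \<subseteq> H k \<union> rng \<tau>" by metis
    \<comment> \<open>\<open>e k\<close> meets \<open>H k\<close> but no other \<open>H j\<close>,
      so these edges are all different.\<close>
    have "inj e"
    proof (rule injI, rule ccontr)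
      fix j k assume jk: "e j = e k" "j \<noteq> k"
      then show False using e(3)[of j] e(4)[of k] Hdisj[OF jk(2)] HR[of j] by (simp only: jk(1)) blast
    qed
    then have "infinite (range e)" by (rule range_inj_infinite)
    then show ?thesis by (rule infinite_super[rotated]) (use e in \<open>auto simp: coloured_def\<close>)
  qed
  have "infinite K"
  proof
    assume "finite K"
    then have "finite (nsets K 2)" by (rule finite_imp_finite_nsets)
    moreover have "s + t \<in> {1..s + t}" using t_pos by simp
    moreover have "coloured K i \<subseteq> nsets K 2" for i by (auto simp: coloured_def)
    ultimately show False using col finite_subset by blast
  qed
  then show ?thesis using comp col by blast
qed

theorem maker_strategy:
  "\<exists>\<sigma>. is_strategy \<sigma> \<and> maker_ensures \<sigma> (\<lambda>p. \<exists>K. infinite K \<and> complete_on (maker_edges p) K \<and>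
    (\<forall>i\<in>{1..s + t}. infinite (coloured K i)))"
  (is "\<exists>\<sigma>. _ \<and> maker_ensures \<sigma> ?P")
proof -
  have start: "force (\<lambda>M B. Inv [] M) {} {}"
    by (rule force_mono[OF base_phase]) (auto simp: legal_def Inv_def)
  have "\<exists>\<sigma>. is_strategy \<sigma> \<and> maker_ensures \<sigma> (\<lambda>p. \<exists>\<alpha>. \<alpha> 0 = [] \<and>
      (\<forall>n. (\<exists>b. \<alpha> (Suc n) = \<alpha> n @ [b]) \<and> Inv (\<alpha> n) (maker_edges p)))"
    (is "\<exists>\<sigma>. _ \<and> maker_ensures \<sigma> ?A")
    by (rule maker_strategy_from_invariant[where stp = "\<lambda>bs bs'. \<exists>b. bs' = bs @ [b]"])
      (rule start, erule (1) Inv_mono, erule (1) Inv_progress)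
  then obtain \<sigma> where \<sigma>: "is_strategy \<sigma>" "maker_ensures \<sigma> ?A" by blast
  have "maker_ensures \<sigma> ?P"
    unfolding maker_ensures_def
  proof (intro allI impI)
    fix p assume "is_play p \<and> (\<forall>n. p (2 * n) = \<sigma> (map p [0..<2 * n]))"
    then have "?A p"
      by (rule \<sigma>(2)[unfolded maker_ensures_def, rule_format])
    then obtain \<alpha> where \<alpha>: "\<alpha> 0 = []" "\<And>n. \<exists>b. \<alpha> (Suc n) = \<alpha> n @ [b]" "\<And>n. Inv (\<alpha> n) (maker_edges p)"
      by auto
    then obtain b where "\<And>n. \<alpha> (Suc n) = \<alpha> n @ [b n]" by metis
    from limit_clique[OF \<alpha>(3,1) this] show "?P p" .
  qed
  then show ?thesis using \<sigma>(1) by blast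
qed

end

section \<open>Roots of infinite degree and the bound for Maker\<close>

definition nbrs :: "graph \<Rightarrow> nat \<Rightarrow> nat set" where
  "nbrs G v = {x. {v, x} \<in> edges G}"

lemma board_graph_edges: "subgraph G board \<Longrightarrow> edges G \<subseteq> nsets (verts G) 2"
  by (simp add: subgraph_def wf_graph_def)

lemma incident_edges:
  assumes "subgraph G board"
  shows "{e \<in> edges G. v \<in> e} = (\<lambda>x. {v, x}) ` nbrs G v"
proof (intro set_eqI iffI)
  fix e assume e: "e \<in> {e \<in> edges G. v \<in> e}"
  then have "e \<in> nsets (verts G) 2" using board_graph_edges[OF assms] by blast
  then obtain x where "e = {v, x}" using e by (auto simp: nsets_def card_2_iff insert_commute)
  then show "e \<in> (\<lambda>x. {v, x}) ` nbrs G v" using e by (auto simp: nbrs_def)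
qed (auto simp: nbrs_def)

lemma not_in_nbrs: "subgraph G board \<Longrightarrow> v \<notin> nbrs G v"
  using board_graph_edges[of G] by (auto simp: nbrs_def nsets_def)

lemma degree_eq:
  assumes "subgraph G board"
  shows "degree G v = (if finite (nbrs G v) then enat (card (nbrs G v)) else \<infinity>)"
proof -
  have "inj_on (\<lambda>x. {v, x}) (nbrs G v)" by (rule star_inj)
  then show ?thesis
    unfolding degree_def Let_def incident_edges[OF assms] by (simp add: card_image finite_image_iff)
qed

lemma ascending_nbrs:
  assumes "subgraph G board" "ascending G" "finite Av"
  shows "\<exists>y. y \<notin> Av \<and> (\<exists>X. finite X \<and> X \<subseteq> nbrs G y \<and> card X > n)"
proof -
  obtain v where v: "inj v" "\<And>j. enat j \<le> degree G (v j)" using assms(2) by (auto simp: ascending_def)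
  have "infinite (v ` {n<..})" using v(1) by (simp add: finite_image_iff inj_on_subset infinite_Ioi)
  then obtain j where j: "j > n" "v j \<notin> Av" using assms(3) by (metis finite_subset greaterThan_iff imageE subsetI)
  show ?thesis
  proof (intro exI[of _ "v j"] conjI j)
    show "\<exists>X. finite X \<and> X \<subseteq> nbrs G (v j) \<and> card X > n"
    proof (cases "finite (nbrs G (v j))")
      case True
      then show ?thesis using v(2)[of j] j(1) by (intro exI[of _ "nbrs G (v j)"]) (simp add: degree_eq[OF assms(1)])
    next
      case False
      then show ?thesis using infinite_arbitrarily_large[OF False, of "Suc n"] by (metis lessI)
    qed
  qed
qed

text \<open>Greedy choice: at most \<open>k * c\<close> vertices are taken when the next set is
  chosen, out of \<open>s * c\<close> with \<open>k < s\<close>.\<close>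

lemma disjoint_transversal_sets:
  fixes S :: "nat \<Rightarrow> 'b set"
  assumes "\<And>j. j \<in> {1..s} \<Longrightarrow> finite (S j) \<and> s * c \<le> card (S j)"
  shows "\<exists>U. (\<forall>j\<in>{1..s}. U j \<subseteq> S j \<and> card (U j) = c) \<and> disjoint_family_on U {1..s}"
proof -
  have "\<exists>U. (\<forall>j\<in>{1..k}. U j \<subseteq> S j \<and> card (U j) = c) \<and> disjoint_family_on U {1..k}" if "k \<le> s" for k
    using that
  proof (induction k)
    case 0
    then show ?case by (simp add: disjoint_family_on_def)
  next
    case (Suc k)
    then have "\<exists>U. (\<forall>j\<in>{1..k}. U j \<subseteq> S j \<and> card (U j) = c) \<and> disjoint_family_on U {1..k}" by simp
    then obtain U where U: "\<And>j. j \<in> {1..k} \<Longrightarrow> U j \<subseteq> S j \<and> card (U j) = c" "disjoint_family_on U {1..k}" by blast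
    let ?W = "\<Union>j\<in>{1..k}. U j"
    have "finite (U j)" if "j \<in> {1..k}" for j
      using U(1)[OF that] assms[of j] that Suc.prems by (auto intro: finite_subset[of "U j" "S j"])
    then have finW: "finite ?W" by blast
    have "card ?W \<le> (\<Sum>j\<in>{1..k}. card (U j))" by (rule card_UN_le) simp
    also have "\<dots> = k * c" using U(1) by simp
    finally have "c \<le> s * c - card ?W"
      using Suc.prems mult_le_mono1[of "Suc k" s c] by simp
    also have "\<dots> \<le> card (S (Suc k)) - card ?W" using assms[of "Suc k"] Suc.prems by auto
    also have "\<dots> \<le> card (S (Suc k) - ?W)" by (rule diff_card_le_card_Diff[OF finW])
    finally obtain X where X: "X \<subseteq> S (Suc k) - ?W" "card X = c"
      using obtain_subset_with_card_n by metis
    have 1: "{1..Suc k} = insert (Suc k) {1..k}" by auto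
    show ?case
    proof (intro exI[of _ "U(Suc k := X)"] conjI)
      show "\<forall>j\<in>{1..Suc k}. (U(Suc k := X)) j \<subseteq> S j \<and> card ((U(Suc k := X)) j) = c"
        unfolding 1 using U(1) X by auto
      have "X \<inter> U j = {}" if "j \<in> {1..k}" for j using X(1) that by blast
      then show "disjoint_family_on (U(Suc k := X)) {1..Suc k}"
        unfolding 1 using U(2) by (auto simp: disjoint_family_on_def Int_commute)
    qed
  qed
  then show ?thesis by blast
qed

section \<open>Numerical bounds for the number of roots\<close>

definition maker_poly :: "nat \<Rightarrow> real" where
  "maker_poly s = 3 * real s ^ 2 + 7 * real s + 4"

text \<open>\<open>maker_poly s + 2 * t * (s + 1)\<close> is the exponent of
  \<open>2 ^ s * c\<close> for the \<open>c\<close> chosen in \<open>maker_part\<close>. For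
  \<open>s \<ge> 1\<close>, \<open>eps2\<close> is made such that
  \<open>2 powr ((1 + eps2 s) * s)\<close> equals
  \<open>2 powr s * (2 * maker_poly s)\<close>.\<close>

definition eps2 :: "nat \<Rightarrow> real" where
  "eps2 s = log 2 (2 * maker_poly s) / real s"

lemma eps2_tendsto: "eps2 \<longlonglongrightarrow> 0"
  unfolding eps2_def maker_poly_def by real_asymp

lemma maker_poly_pos: "maker_poly s > 0"
  unfolding maker_poly_def by (smt (verit) of_nat_0_le_iff zero_le_power2)

text \<open>A sum is at most twice its larger summand, so twice each summand is compared with one of
  the exponents: by \<open>4 * (s + 1) \<le> 8 ^ s\<close> for the summand with \<open>t\<close>, by
  the choice of \<open>eps2\<close> for the other.\<close>

lemma maker_bound:
  assumes "s \<ge> 1"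
  shows "2 powr (maker_poly s + 2 * real t * (s + 1)) \<le>
    max (2 powr (real t * 2 powr ((1 + 0) * (3 * real s)))) (2 powr (2 powr ((1 + eps2 s) * real s)))"
proof -
  have X: "real t * 2 powr ((1 + 0) * (3 * real s)) \<ge> 4 * real t * (s + 1)"
  proof -
    have "4 * (s + 1) \<le> 8 ^ s" using assms by (induction s rule: dec_induct) auto
    then have "real (4 * (s + 1)) \<le> real (8 ^ s)" by (simp only: of_nat_le_iff)
    moreover have "2 powr ((1 + 0) * (3 * real s)) = 8 ^ s"
      by (simp add: powr_realpow[of 2 "3 * s", simplified] power_mult)
    ultimately show ?thesis using mult_left_mono[of "real (4 * (s + 1))" "8 ^ s" "real t"] by (simp add: algebra_simps)
  qed
  have Y: "2 powr ((1 + eps2 s) * real s) \<ge> 2 * maker_poly s"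
  proof -
    have "(1 + eps2 s) * real s = s + log 2 (2 * maker_poly s)"
      using assms by (simp add: eps2_def distrib_right)
    then have "2 powr ((1 + eps2 s) * real s) = 2 powr s * (2 * maker_poly s)"
      using maker_poly_pos[of s] by (simp add: powr_add)
    moreover have "2 powr s \<ge> (1::real)" by (simp add: ge_one_powr_ge_zero)
    ultimately show ?thesis using maker_poly_pos[of s] mult_right_mono[of 1 "2 powr s" "2 * maker_poly s"] by simp
  qed
  have "maker_poly s + 2 * real t * (s + 1) \<le>
      max (real t * 2 powr ((1 + 0) * (3 * real s))) (2 powr ((1 + eps2 s) * real s))"
    using X Y by linarith
  then have "2 powr (maker_poly s + 2 * real t * (s + 1)) \<le>
      2 powr max (real t * 2 powr ((1 + 0) * (3 * real s))) (2 powr ((1 + eps2 s) * real s))"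
    by (intro powr_mono) auto
  also have "\<dots> = max (2 powr (real t * 2 powr ((1 + 0) * (3 * real s)))) (2 powr (2 powr ((1 + eps2 s) * real s)))"
    by (simp add: max_def)
  finally show ?thesis .
qed

text \<open>All factors are replaced by powers of two, with \<open>s + 1 \<le> 2 ^ s\<close> and
  \<open>s + 2 * t \<le> 2 ^ (s + 2 * t)\<close>. The exponent in \<open>c\<close> exceeds the
  resulting one by exactly 1.\<close>

lemma root_size_bound:
  fixes s t :: nat
  defines "c \<equiv> 2 ^ (3 * s ^ 2 + 4 * s + 2 + 2 * t * (s + 1)) :: nat"
  shows "real c > 2 ^ (s ^ 2) * ((s ^ 2 + 1) + 4 ^ s * (4 ^ s) ^ (s + t) * (s + 1) * (s + 2 * t))"
proof -
  have s1: "s + 1 \<le> 2 ^ s" by (induction s) auto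
  then have "(s + 1) ^ 2 \<le> (2 ^ s) ^ 2" by (intro power_mono) auto
  then have a: "s ^ 2 + 1 \<le> 4 ^ s" by (simp add: power2_eq_square power_mult_distrib[symmetric])
  have b: "s + 2 * t \<le> 2 ^ (s + 2 * t)" by (simp add: less_imp_le)
  let ?P = "4 ^ s * (4 ^ s) ^ (s + t) * 2 ^ s * 2 ^ (s + 2 * t) :: nat"
  have "4 ^ s * (4 ^ s) ^ (s + t) * (s + 1) * (s + 2 * t) \<le> ?P"
    by (intro mult_le_mono order_refl s1 b)
  moreover have "s ^ 2 + 1 \<le> ?P"
  proof -
    have "4 ^ s * 1 \<le> 4 ^ s * ((4 ^ s) ^ (s + t) * 2 ^ s * 2 ^ (s + 2 * t) :: nat)"
      by (intro mult_le_mono2) simp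
    then have "4 ^ s \<le> ?P" by (simp only: mult.assoc mult_1_right)
    with a show ?thesis by (rule le_trans)
  qed
  ultimately have "(s ^ 2 + 1) + 4 ^ s * (4 ^ s) ^ (s + t) * (s + 1) * (s + 2 * t) \<le> 2 * ?P" by linarith
  then have "2 ^ (s ^ 2) * ((s ^ 2 + 1) + 4 ^ s * (4 ^ s) ^ (s + t) * (s + 1) * (s + 2 * t)) \<le> 2 ^ (s ^ 2) * (2 * ?P)"
    by (rule mult_le_mono2)
  also have "\<dots> = 2 ^ (s ^ 2 + 1 + 2 * s + 2 * s * (s + t) + s + (s + 2 * t))"
  proof -
    have "(4::nat) ^ s = 2 ^ (2 * s)" by (simp add: power_mult)
    then show ?thesis by (simp add: power_add[symmetric] power_mult[symmetric] power_Suc[symmetric] del: power_Suc)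
  qed
  also have "\<dots> < c"
    unfolding c_def by (rule power_strict_increasing) (auto simp: power2_eq_square algebra_simps)
  finally have "real (2 ^ (s ^ 2) * ((s ^ 2 + 1) + 4 ^ s * (4 ^ s) ^ (s + t) * (s + 1) * (s + 2 * t))) < real c"
    by (simp only: of_nat_less_iff)
  then show ?thesis by (simp add: algebra_simps)
qed

theorem maker_part:
  assumes G: "\<And>i. i \<in> {1..s + t} \<Longrightarrow> subgraph (G i) board"
    and ord: "\<And>i. i \<in> {1..s} \<Longrightarrow> has_order (G i) (C i)"
    and asc: "\<And>i. i \<in> {s + 1..s + t} \<Longrightarrow> ascending (G i)"
    and C: "\<And>i. i \<in> {1..s} \<Longrightarrow> real (C i) \<ge> 2 powr (maker_poly s + 2 * real t * (s + 1))"
  shows "\<exists>\<sigma>. maker_winning_strategy G {1..s + t} \<sigma>"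
proof -
  \<comment> \<open>The size from \<open>root_size_bound\<close> for \<open>t + 1\<close> ascending
    graphs.\<close>
  define c :: nat where "c = 2 ^ (3 * s ^ 2 + 4 * s + 2 + 2 * (t + 1) * (s + 1))"
  \<comment> \<open>The board as an additional ascending graph forces the clique to be infinite even if \<open>s = t = 0\<close>.\<close>
  define G' where "G' = G(s + t + 1 := board)"
  have sub: "subgraph (G' i) board" if "i \<in> {1..s + (t + 1)}" for i
    using that G[of i] by (auto simp: G'_def subgraph_def wf_graph_def board_def complete_graph_def)
  have "\<exists>S. finite S \<and> card S = C j \<and> (\<forall>v\<in>S. degree (G j) v = \<infinity>)" if "j \<in> {1..s}" for j
    using ord[OF that] by (auto simp: has_order_def)
  then obtain S where S: "\<And>j. j \<in> {1..s} \<Longrightarrow> finite (S j) \<and> card (S j) = C j \<and> (\<forall>v\<in>S j. degree (G j) v = \<infinity>)"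
    by metis
  \<comment> \<open>With \<open>s * c\<close> vertices of infinite degree in each graph the sets
    \<open>U j\<close> can be chosen disjoint; \<open>s \<le> 2 ^ s\<close> absorbs the factor
    \<open>s\<close>.\<close>
  have sc: "s * c \<le> C j" if "j \<in> {1..s}" for j
  proof -
    have "s * c \<le> 2 ^ s * c" by (intro mult_le_mono1 less_imp_le) simp
    also have "\<dots> = 2 ^ (3 * s ^ 2 + 7 * s + 4 + 2 * t * (s + 1))"
    proof -
      have "s + (3 * s ^ 2 + 4 * s + 2 + 2 * (t + 1) * (s + 1)) = 3 * s ^ 2 + 7 * s + 4 + 2 * t * (s + 1)"
        by (simp add: algebra_simps)
      then show ?thesis by (simp only: c_def power_add[symmetric])
    qed
    finally have "real (s * c) \<le> real (2 ^ (3 * s ^ 2 + 7 * s + 4 + 2 * t * (s + 1)))"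
      by (simp only: of_nat_le_iff)
    also have "\<dots> = 2 powr real (3 * s ^ 2 + 7 * s + 4 + 2 * t * (s + 1))"
      by (simp only: powr_realpow[OF zero_less_numeral] of_nat_power of_nat_numeral)
    also have "real (3 * s ^ 2 + 7 * s + 4 + 2 * t * (s + 1)) = maker_poly s + 2 * real t * (s + 1)"
      by (simp add: maker_poly_def algebra_simps)
    also have "2 powr \<dots> \<le> real (C j)" by (rule C[OF that])
    finally show ?thesis by (simp only: of_nat_le_iff)
  qed
  obtain U where U: "\<And>j. j \<in> {1..s} \<Longrightarrow> U j \<subseteq> S j \<and> card (U j) = c" "disjoint_family_on U {1..s}"
    using disjoint_transversal_sets[of s S c] S sc by metis
  define Nb where "Nb i v = (if i \<in> {1..s + (t + 1)} then nbrs (G' i) v else {})" for i v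
  interpret roots s "t + 1" c U Nb
  proof
    show "card (U j) = c" if "j \<in> {1..s}" for j using U that by blast
    show "c > 0" by (simp add: c_def)
    show "disjoint_family_on U {1..s}" by (rule U)
    show "infinite (Nb j v)" if "j \<in> {1..s}" "v \<in> U j" for j v
    proof -
      have "degree (G j) v = \<infinity>" using that U S by blast
      then have "infinite (nbrs (G j) v)" using degree_eq[OF G[of j]] that by (auto split: if_splits)
      then show ?thesis using that by (simp add: Nb_def G'_def)
    qed
    show "y \<notin> Nb i y" for i y using not_in_nbrs[OF sub] by (auto simp: Nb_def)
    fix i n and Av :: "nat set" assume i: "i \<in> {s + 1..s + (t + 1)}" and Av: "finite Av"
    have "\<exists>y. y \<notin> Av \<and> (\<exists>X. finite X \<and> X \<subseteq> nbrs (G' i) y \<and> card X > n)"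
    proof (cases "i = s + t + 1")
      case True
      have "infinite (UNIV - Av)" using Av by simp
      then obtain y where y: "y \<notin> Av" by (metis Diff_iff ex_in_conv finite.emptyI)
      have "nbrs (G' i) y = UNIV - {y}" using True by (auto simp: nbrs_def G'_def)
      then have "infinite (nbrs (G' i) y)" by (simp add: infinite_UNIV_nat)
      then show ?thesis using y infinite_arbitrarily_large[of "nbrs (G' i) y" "Suc n"] by (metis lessI)
    next
      case False
      then have "i \<in> {s + 1..s + t}" using i by auto
      then have "subgraph (G i) board" "ascending (G i)" using G[of i] asc[of i] by auto
      then show ?thesis using ascending_nbrs[OF _ _ Av] False by (simp add: G'_def)
    qed
    then show "\<exists>y. y \<notin> Av \<and> (\<exists>X. finite X \<and> X \<subseteq> Nb i y \<and> card X > n)"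
      using i by (simp add: Nb_def)
  qed
  interpret big_roots s "t + 1" c U Nb
  proof
    show "real c > 2 ^ (s ^ 2) * ((s ^ 2 + 1) + 4 ^ s * Wm * (s + 1) * (s + 2 * (t + 1)))"
      unfolding Wm_def using root_size_bound[of s "t + 1"] by (simp add: c_def algebra_simps)
  qed simp
  obtain \<sigma> where \<sigma>: "is_strategy \<sigma>" "maker_ensures \<sigma> (\<lambda>p. \<exists>K. infinite K \<and> complete_on (maker_edges p) K \<and>
    (\<forall>i\<in>{1..s + (t + 1)}. infinite (coloured K i)))"
    using maker_strategy by blast
  have win: "maker_wins_col G {1..s + t} p" if K: "infinite K" "complete_on (maker_edges p) K"
    "\<forall>i\<in>{1..s + (t + 1)}. infinite (coloured K i)" for p K
    unfolding maker_wins_col_def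
  proof (intro exI[of _ "complete_graph K"] conjI ballI)
    have "nsets K 2 \<subseteq> maker_edges p" using K(2) by (auto simp: complete_on_def nsets_2_eq)
    moreover have "nsets K 2 \<subseteq> nsets UNIV 2" by (rule nsets_mono) simp
    ultimately show "maker_clique p (complete_graph K)"
      using K(1) by (simp add: maker_clique_def subgraph_def wf_graph_def complete_graph_def board_def)
    fix i assume i: "i \<in> {1..s + t}"
    then have i': "i \<in> {1..s + (t + 1)}" by simp
    have "coloured K i \<subseteq> edges (complete_graph K) \<inter> edges (G i)"
      using i by (auto simp: coloured_def Nb_def complete_graph_def nbrs_def G'_def)
    then show "infinite (edges (complete_graph K) \<inter> edges (G i))"
      using K(3) i' infinite_super by blast
  qed
  have "maker_winning_strategy G {1..s + t} \<sigma>"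
    unfolding maker_winning_strategy_def
  proof
    show "maker_ensures \<sigma> (maker_wins_col G {1..s + t})"
      unfolding maker_ensures_def
    proof (intro allI impI)
      fix p assume "is_play p \<and> (\<forall>n. p (2 * n) = \<sigma> (map p [0..<2 * n]))"
      from \<sigma>(2)[unfolded maker_ensures_def, rule_format, OF this]
      show "maker_wins_col G {1..s + t} p" using win[of _ p] by (elim exE conjE) (rule win)
    qed
  qed (rule \<sigma>(1))
  then show ?thesis by blast
qed

section \<open>Potential and pairing for Breaker\<close>

lemma (in weighted_sets) deg_breaker:
  assumes "M \<inter> F = {}"
  shows "deg (F - {f}) M g \<le> deg F M g"
  unfolding deg_def
proof (rule sum_mono)
  fix i assume i: "i \<in> I"
  show "(if A i \<subseteq> M \<union> (F - {f}) \<and> g \<in> A i then w i / 2 ^ card (A i \<inter> (F - {f})) else 0)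
    \<le> (if A i \<subseteq> M \<union> F \<and> g \<in> A i then w i / 2 ^ card (A i \<inter> F) else 0)"
  proof (cases "A i \<subseteq> M \<union> (F - {f}) \<and> g \<in> A i")
    case True
    then have "A i \<inter> (F - {f}) = A i \<inter> F" "A i \<subseteq> M \<union> F" using assms by auto
    then show ?thesis using w_nonneg[OF i] by simp
  qed (use w_nonneg[OF i] in auto)
qed

section \<open>Colourings at distance two and pairings\<close>

lemma greedy_colouring:
  fixes Cf :: "nat \<Rightarrow> nat set"
  assumes fin: "\<And>n. finite (Cf n)" and card: "\<And>n. card (Cf n) \<le> D"
  shows "\<exists>\<phi> :: nat \<Rightarrow> nat. (\<forall>n. \<phi> n \<le> D) \<and> (\<forall>m n. m < n \<longrightarrow> m \<in> Cf n \<longrightarrow> \<phi> m \<noteq> \<phi> n)"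
proof -
  \<comment> \<open>Vertices are coloured in their natural order. At most \<open>D\<close> earlier
    ones are in conflict, so the colours up to \<open>D\<close> suffice.\<close>
  define \<phi> where "\<phi> = wfrec less_than (\<lambda>f n. LEAST c :: nat. c \<notin> f ` {m \<in> Cf n. m < n})"
  have \<phi>: "\<phi> n = (LEAST c. c \<notin> \<phi> ` {m \<in> Cf n. m < n})" for n
  proof -
    have "cut \<phi> less_than n ` {m \<in> Cf n. m < n} = \<phi> ` {m \<in> Cf n. m < n}"
      by (intro image_cong) (auto simp: cut_apply)
    then show ?thesis using def_wfrec[OF eq_reflection[OF \<phi>_def] wf_less_than, of n] by simp
  qed
  have ex: "\<exists>c \<le> D. c \<notin> \<phi> ` {m \<in> Cf n. m < n}" for n
  proof (rule ccontr)
    assume "\<not> ?thesis"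
    then have "{..D} \<subseteq> \<phi> ` {m \<in> Cf n. m < n}" by auto
    then have "card {..D} \<le> card {m \<in> Cf n. m < n}" using fin by (intro surj_card_le) auto
    also have "\<dots> \<le> card (Cf n)" using fin by (intro card_mono) auto
    also have "\<dots> \<le> D" by (rule card)
    finally show False by simp
  qed
  have "\<phi> n \<notin> \<phi> ` {m \<in> Cf n. m < n}" for n
    by (subst \<phi>) (rule LeastI_ex, use ex in blast)
  moreover have "\<phi> n \<le> D" for n
  proof -
    obtain c where "c \<le> D" "c \<notin> \<phi> ` {m \<in> Cf n. m < n}" using ex by blast
    then show ?thesis by (subst \<phi>) (meson Least_le le_trans)
  qed
  moreover have "\<phi> m \<in> \<phi> ` {m \<in> Cf n. m < n}" if "m < n" "m \<in> Cf n" for m n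
    using that by blast
  ultimately show ?thesis by (intro exI[of _ \<phi>]) metis
qed

text \<open>Greedy colouring for the conflict graph of distances one and two, with degrees at most
  \<open>d + d * d\<close>. The last clause makes the colouring injective on every neighbourhood, so
  that a colour determines a neighbour.\<close>

lemma distance_two_colouring:
  fixes H :: "nat \<Rightarrow> nat \<Rightarrow> bool"
  assumes sym: "\<And>u v. H u v \<Longrightarrow> H v u" and deg: "\<And>v. finite {u. H v u} \<and> card {u. H v u} \<le> d"
  shows "\<exists>(\<phi> :: nat \<Rightarrow> nat) D. (\<forall>n. \<phi> n \<le> D) \<and> (\<forall>u v. u \<noteq> v \<longrightarrow> H u v \<longrightarrow> \<phi> u \<noteq> \<phi> v) \<and>
    (\<forall>u v z. H z u \<longrightarrow> H z v \<longrightarrow> u \<noteq> v \<longrightarrow> \<phi> u \<noteq> \<phi> v)"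
proof -
  define Cf where "Cf v = {u. H v u} \<union> (\<Union>z\<in>{z. H v z}. {u. H z u})" for v
  have fin: "finite (Cf v)" for v using deg by (auto simp: Cf_def)
  have card: "card (Cf v) \<le> d + d * d" for v
  proof -
    have "card (\<Union>z\<in>{z. H v z}. {u. H z u}) \<le> (\<Sum>z\<in>{z. H v z}. card {u. H z u})"
      using deg by (intro card_UN_le) auto
    also have "\<dots> \<le> (\<Sum>z\<in>{z. H v z}. d)" using deg by (intro sum_mono) auto
    also have "\<dots> \<le> d * d" using deg by simp
    finally show ?thesis using card_Un_le[of "{u. H v u}"] deg[of v] unfolding Cf_def
      by (meson add_mono le_trans)
  qed
  obtain \<phi> where \<phi>: "\<And>n. \<phi> n \<le> d + d * d" "\<And>m n. m < n \<Longrightarrow> m \<in> Cf n \<Longrightarrow> \<phi> m \<noteq> \<phi> n"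
    using greedy_colouring[of Cf, OF fin card] by blast
  have ne: "\<phi> u \<noteq> \<phi> v" if "u \<noteq> v" "u \<in> Cf v" "v \<in> Cf u" for u v
    using \<phi>(2)[of u v] \<phi>(2)[of v u] that by (metis linorder_neqE_nat)
  show ?thesis
  proof (intro exI conjI allI impI)
    show "\<phi> n \<le> d + d * d" for n by (rule \<phi>)
    show "\<phi> u \<noteq> \<phi> v" if "u \<noteq> v" "H u v" for u v
      using that sym by (intro ne) (auto simp: Cf_def)
    show "\<phi> u \<noteq> \<phi> v" if "H z u" "H z v" "u \<noteq> v" for u v z
      using that sym by (intro ne) (auto simp: Cf_def)
  qed
qed

text \<open>The edge \<open>ab\<close> is paired with \<open>b'a'\<close>, where \<open>b'\<close> is the neighbour of \<open>a\<close> with the colour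
  of \<open>b\<close> and \<open>a'\<close> the neighbour of \<open>b\<close> with the colour of \<open>a\<close>. If two edges of \<open>H\<close> between the
  same two colour classes lie in a clique, then the clique contains such a pair.\<close>

definition paired :: "(nat \<Rightarrow> nat \<Rightarrow> bool) \<Rightarrow> (nat \<Rightarrow> nat) \<Rightarrow> nat set \<Rightarrow> nat set \<Rightarrow> bool" where
  "paired H \<phi> e e' \<longleftrightarrow> (\<exists>a b a' b'. e = {a, b} \<and> e' = {a', b'} \<and> \<phi> a \<noteq> \<phi> b \<and> H a b' \<and> H b a' \<and>
     \<phi> b' = \<phi> b \<and> \<phi> a' = \<phi> a \<and> e \<noteq> e')"

lemma paired_sym:
  assumes "\<And>u v. H u v \<Longrightarrow> H v u" "paired H \<phi> e e'"
  shows "paired H \<phi> e' e"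
proof -
  obtain a b a' b' where "e = {a, b}" "e' = {a', b'}" "\<phi> a \<noteq> \<phi> b" "H a b'" "H b a'" "\<phi> b' = \<phi> b" "\<phi> a' = \<phi> a" "e \<noteq> e'"
    using assms(2) unfolding paired_def by blast
  then have "e' = {a', b'} \<and> e = {a, b} \<and> \<phi> a' \<noteq> \<phi> b' \<and> H a' b \<and> H b' a \<and> \<phi> b = \<phi> b' \<and> \<phi> a = \<phi> a' \<and> e' \<noteq> e"
    using assms(1) by metis
  then show ?thesis unfolding paired_def by (intro exI)
qed

text \<open>By injectivity on neighbourhoods the colours of \<open>a\<close> and \<open>b\<close>
  determine \<open>b'\<close> and \<open>a'\<close>. Naming the ends of \<open>e\<close> in the
  other order only exchanges the ends of the partner.\<close>

lemma paired_unique: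
  assumes inj: "\<And>z u v. H z u \<Longrightarrow> H z v \<Longrightarrow> \<phi> u = \<phi> v \<Longrightarrow> u = v" and "paired H \<phi> e e1" "paired H \<phi> e e2"
  shows "e1 = e2"
proof -
  obtain a b a1 b1 where 1: "e = {a, b}" "e1 = {a1, b1}" "H a b1" "H b a1" "\<phi> b1 = \<phi> b" "\<phi> a1 = \<phi> a"
    using assms(2) unfolding paired_def by blast
  obtain c d c2 d2 where 2: "e = {c, d}" "e2 = {c2, d2}" "H c d2" "H d c2" "\<phi> d2 = \<phi> d" "\<phi> c2 = \<phi> c"
    using assms(3) unfolding paired_def by blast
  have "a = c \<and> b = d \<or> a = d \<and> b = c" using 1(1) 2(1) by (auto simp: doubleton_eq_iff)
  then show ?thesis
  proof
    assume "a = c \<and> b = d"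
    then have "b1 = d2" "a1 = c2" using inj[of a b1 d2] inj[of b a1 c2] 1 2 by auto
    then show ?thesis using 1 2 by simp
  next
    assume "a = d \<and> b = c"
    then have "b1 = c2" "a1 = d2" using inj[of a b1 c2] inj[of b a1 d2] 1 2 by auto
    then show ?thesis using 1 2 by auto
  qed
qed

text \<open>The factor 2 in \<open>few\<close> pays for Maker's first move. Edges of
  \<open>H\<close> avoid \<open>S\<close>, so an edge with a partner never belongs to the clique
  game on \<open>S\<close>, and a Maker move calls for at most one answer.\<close>

locale breaker_game =
  fixes S :: "nat set" and k :: nat and H :: "nat \<Rightarrow> nat \<Rightarrow> bool" and d :: nat
  assumes finS: "finite S" and few: "2 * (card S choose k) < 2 ^ (k choose 2)"
    and H_sym: "\<And>u v. H u v \<Longrightarrow> H v u" and H_irrefl: "\<And>v. \<not> H v v" and H_S: "\<And>u v. H u v \<Longrightarrow> u \<notin> S"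
    and H_deg: "\<And>v. finite {u. H v u} \<and> card {u. H v u} \<le> d"
begin

abbreviation "SS \<equiv> nsets S 2"

sublocale weighted_sets "nsets S k" "\<lambda>_. 1" "\<lambda>X. nsets X 2" 0
  by unfold_locales (use finS in \<open>auto simp: finite_imp_finite_nsets\<close>)

lemma finSS: "finite SS"
  using finS by (simp add: finite_imp_finite_nsets)

lemma sub_SS: "X \<in> nsets S k \<Longrightarrow> nsets X 2 \<subseteq> SS"
  by (intro nsets_mono) (auto simp: nsets_def)

definition colouring where
  "colouring = (SOME \<phi> :: nat \<Rightarrow> nat. \<exists>D. (\<forall>n. \<phi> n \<le> D) \<and> (\<forall>u v. u \<noteq> v \<longrightarrow> H u v \<longrightarrow> \<phi> u \<noteq> \<phi> v) \<and>
    (\<forall>u v z. H z u \<longrightarrow> H z v \<longrightarrow> u \<noteq> v \<longrightarrow> \<phi> u \<noteq> \<phi> v))"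

lemma colouring:
  "\<exists>D. \<forall>n. colouring n \<le> D" "H u v \<Longrightarrow> colouring u \<noteq> colouring v"
  "H z u \<Longrightarrow> H z v \<Longrightarrow> colouring u = colouring v \<Longrightarrow> u = v"
proof -
  have "\<exists>\<phi> :: nat \<Rightarrow> nat. \<exists>D. (\<forall>n. \<phi> n \<le> D) \<and> (\<forall>u v. u \<noteq> v \<longrightarrow> H u v \<longrightarrow> \<phi> u \<noteq> \<phi> v) \<and>
    (\<forall>u v z. H z u \<longrightarrow> H z v \<longrightarrow> u \<noteq> v \<longrightarrow> \<phi> u \<noteq> \<phi> v)"
    by (rule distance_two_colouring[OF H_sym H_deg])
  from someI_ex[OF this] have "\<exists>D. (\<forall>n. colouring n \<le> D) \<and> (\<forall>u v. u \<noteq> v \<longrightarrow> H u v \<longrightarrow> colouring u \<noteq> colouring v) \<and>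
    (\<forall>u v z. H z u \<longrightarrow> H z v \<longrightarrow> u \<noteq> v \<longrightarrow> colouring u \<noteq> colouring v)"
    unfolding colouring_def .
  then show "\<exists>D. \<forall>n. colouring n \<le> D" "H u v \<Longrightarrow> colouring u \<noteq> colouring v"
    "H z u \<Longrightarrow> H z v \<Longrightarrow> colouring u = colouring v \<Longrightarrow> u = v"
    using H_irrefl by metis+
qed

definition es_reply where
  "es_reply M F = (SOME f. f \<in> F \<and> (\<forall>g\<in>F. deg F M g \<le> deg F M f))"

lemma es_reply:
  assumes "finite F" "F \<noteq> {}"
  shows "es_reply M F \<in> F" "\<And>g. g \<in> F \<Longrightarrow> deg F M g \<le> deg F M (es_reply M F)"
proof -
  have "Max (deg F M ` F) \<in> deg F M ` F" using assms by (intro Max_in) auto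
  then obtain f where "f \<in> F" "deg F M f = Max (deg F M ` F)" by auto
  then have "f \<in> F \<and> (\<forall>g\<in>F. deg F M g \<le> deg F M f)" using assms by auto
  then have "es_reply M F \<in> F \<and> (\<forall>g\<in>F. deg F M g \<le> deg F M (es_reply M F))"
    unfolding es_reply_def by (rule someI)
  then show "es_reply M F \<in> F" "\<And>g. g \<in> F \<Longrightarrow> deg F M g \<le> deg F M (es_reply M F)" by auto
qed

text \<open>\<open>C\<close> contains all claimed edges, Maker's last one included. If
  \<open>e\<close> has no partner, the description is meaningless, and the legality test in
  \<open>strategy\<close> guards against it.\<close>

definition candidate :: "nat set set \<Rightarrow> nat set set \<Rightarrow> nat set \<Rightarrow> nat set" where
  "candidate M C e = (if e \<in> SS then es_reply M (SS - C) else (THE e'. paired H colouring e e'))"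

text \<open>Breaker sees a history of odd length, in which Maker's edges have the even indices.\<close>

definition strategy :: "nat set list \<Rightarrow> nat set" where
  "strategy h = (let f = candidate {h ! i |i. i < length h \<and> even i} (set h) (last h)
     in if f \<in> board_edges - set h then f else (SOME f. f \<in> board_edges - set h))"

lemma is_strategy_strategy: "is_strategy strategy"
  unfolding is_strategy_def strategy_def Let_def using some_unclaimed by (auto simp del: Diff_iff)

lemma paired_SS: "paired H colouring e e' \<Longrightarrow> e \<notin> SS"
  unfolding paired_def using H_S by (auto simp: nsets_def)

context
  fixes p assumes play: "is_play p" and follows: "\<And>n. p (2 * n + 1) = strategy (map p [0..<2 * n + 1])"
begin

definition Mk where "Mk n = {p (2 * i) |i. i < n}"
definition Br where "Br n = {p (2 * i + 1) |i. i < n}"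
definition Fr where "Fr n = SS - (Mk n \<union> Br n)"

lemma inj_p: "p i = p j \<longleftrightarrow> i = j"
  using play by (auto simp: is_play_def inj_eq)

lemma p_board: "p i \<in> board_edges"
  using play by (auto simp: is_play_def)

lemma Mk_Suc: "Mk (Suc n) = insert (p (2 * n)) (Mk n)"
  unfolding Mk_def less_Suc_eq by blast

lemma Br_Suc: "Br (Suc n) = insert (p (2 * n + 1)) (Br n)"
  unfolding Br_def less_Suc_eq by blast

lemma Fr_Suc: "Fr (Suc n) = Fr n - {p (2 * n)} - {p (2 * n + 1)}"
  by (auto simp: Fr_def Mk_Suc Br_Suc)

lemma prefix_set: "set (map p [0..<2 * n + 1]) = insert (p (2 * n)) (Mk n \<union> Br n)"
proof -
  have "set (map p [0..<2 * n + 1]) = insert (p (2 * n)) (set (map p [0..<2 * n]))" by simp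
  then show ?thesis unfolding set_play_prefix Mk_def Br_def .
qed

lemma prefix_maker: "{map p [0..<2 * n + 1] ! i |i. i < length (map p [0..<2 * n + 1]) \<and> even i} = Mk (Suc n)"
proof -
  have "{map p [0..<2 * n + 1] ! i |i. i < length (map p [0..<2 * n + 1]) \<and> even i} = {p i |i. i < 2 * n + 1 \<and> even i}"
  proof (intro Collect_cong iffI; elim exE conjE)
    fix e i assume i: "e = map p [0..<2 * n + 1] ! i" "i < length (map p [0..<2 * n + 1])" "even i"
    then have "map p [0..<2 * n + 1] ! i = p i" by (simp del: upt_Suc)
    then show "\<exists>i. e = p i \<and> i < 2 * n + 1 \<and> even i" using i by (intro exI[of _ i]) simp
  next
    fix e i assume i: "e = p i" "i < 2 * n + 1" "even i"
    then have "map p [0..<2 * n + 1] ! i = p i" by (simp del: upt_Suc)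
    then show "\<exists>i. e = map p [0..<2 * n + 1] ! i \<and> i < length (map p [0..<2 * n + 1]) \<and> even i"
      using i by (intro exI[of _ i]) (simp del: upt_Suc)
  qed
  also have "\<dots> = Mk (Suc n)"
    unfolding Mk_def by (intro Collect_cong iffI) (auto elim!: evenE)
  finally show ?thesis .
qed

lemma reply:
  assumes "candidate (Mk (Suc n)) (insert (p (2 * n)) (Mk n \<union> Br n)) (p (2 * n)) \<in> board_edges - insert (p (2 * n)) (Mk n \<union> Br n)"
  shows "p (2 * n + 1) = candidate (Mk (Suc n)) (insert (p (2 * n)) (Mk n \<union> Br n)) (p (2 * n))"
  using assms follows[of n] unfolding strategy_def Let_def prefix_set prefix_maker by (simp add: last_map)

lemma new_move: "p (2 * n) \<notin> Mk n \<union> Br n"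
  unfolding Mk_def Br_def by (auto simp: inj_p) presburger

text \<open>The second conjunct prepares for Maker's next move, which adds just the degree of her
  edge. An answer of largest degree then takes off at least as much as her following edge can
  add.\<close>

lemma potential_small:
  "pot (Fr n) (Mk n) < 1 \<and> (\<forall>e\<in>Fr n. pot (Fr n) (Mk n) + deg (Fr n) (Mk n) e < 1)"
proof (induction n)
  case 0
  have F0: "Fr 0 = SS" "Mk 0 = {}" by (auto simp: Fr_def Mk_def Br_def)
  have "pot SS {} = (\<Sum>X\<in>nsets S k. 1 / 2 ^ (k choose 2))"
    unfolding pot_def
  proof (intro sum.cong refl)
    fix X assume X: "X \<in> nsets S k"
    then have "card (nsets X 2) = k choose 2" by (simp add: card_nsets) (simp add: nsets_def)
    moreover have "nsets X 2 \<inter> SS = nsets X 2" "nsets X 2 \<subseteq> {} \<union> SS" using sub_SS[OF X] by auto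
    ultimately show "(if nsets X 2 \<subseteq> {} \<union> SS then 1 / 2 ^ card (nsets X 2 \<inter> SS) else 0) = (1::real) / 2 ^ (k choose 2)"
      by simp
  qed
  also have "\<dots> = (card S choose k) / 2 ^ (k choose 2)" by (simp add: card_nsets)
  finally have pot0: "pot SS {} = (card S choose k) / 2 ^ (k choose 2)" .
  have "real (2 * (card S choose k)) < real (2 ^ (k choose 2))" using few by (simp only: of_nat_less_iff)
  then have "2 * pot SS {} < 1" by (simp add: pot0)
  moreover have le: "deg SS {} e \<le> pot SS {}" for e
    unfolding deg_def pot_def by (rule sum_mono) auto
  moreover have "pot SS {} \<ge> 0" by (simp add: pot0)
  ultimately have "pot SS {} < 1" "pot SS {} + deg SS {} e < 1" for e using le[of e] by linarith+
  then show ?case unfolding F0 by blast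
next
  case (Suc n)
  define e where "e = p (2 * n)"
  define f where "f = p (2 * n + 1)"
  define F where "F = Fr n"
  define M where "M = Mk n"
  have finF: "finite F" using finSS by (simp add: F_def Fr_def)
  have MF: "M \<inter> F = {}" by (auto simp: M_def F_def Fr_def)
  have new: "Mk (Suc n) = insert e M" "Fr (Suc n) = F - {e} - {f}" by (auto simp: e_def f_def F_def M_def Mk_Suc Fr_Suc)
  have ef: "e \<noteq> f" by (simp add: e_def f_def inj_p)
  have eMB: "e \<notin> Mk n \<union> Br n" unfolding e_def by (rule new_move)
  show ?case
  proof (cases "e \<in> SS")
    case True
    then have eF: "e \<in> F" using eMB by (simp add: F_def Fr_def)
    define F1 where "F1 = F - {e}"
    define M1 where "M1 = insert e M"
    have fin1: "finite F1" and MF1: "M1 \<inter> F1 = {}" using finF MF by (auto simp: F1_def M1_def)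
    have p1: "pot F1 M1 < 1"
      unfolding F1_def M1_def pot_maker[OF eF finF] using Suc eF by (simp add: F_def M_def)
    show ?thesis
    proof (cases "F1 = {}")
      case True
      then have "Fr (Suc n) = {}" by (auto simp: new F1_def)
      then show ?thesis using p1 True by (simp add: new(1) M1_def)
    next
      case False
      have F1_eq: "SS - insert e (Mk n \<union> Br n) = F1" by (auto simp: F1_def F_def Fr_def)
      have c: "candidate (Mk (Suc n)) (insert e (Mk n \<union> Br n)) e = es_reply M1 F1"
        using \<open>e \<in> SS\<close> by (simp add: candidate_def new F1_eq M1_def)
      have r: "es_reply M1 F1 \<in> F1" by (rule es_reply[OF fin1 False])
      then have "es_reply M1 F1 \<in> board_edges - insert e (Mk n \<union> Br n)"
        unfolding F1_eq[symmetric] board_edges_eq using nsets_mono[of S UNIV 2] by auto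
      then have f: "f = es_reply M1 F1" using reply[of n] c by (simp add: e_def f_def)
      then have fF: "f \<in> F1" using r by simp
      have p2: "pot (F1 - {f}) M1 = pot F1 M1 - deg F1 M1 f" by (rule pot_breaker[OF fF MF1])
      have "pot (F1 - {f}) M1 + deg (F1 - {f}) M1 g < 1" if "g \<in> F1 - {f}" for g
        using deg_breaker[OF MF1, of f g] es_reply(2)[OF fin1 False, of g M1] that p1 p2 f by auto
      moreover have "pot (F1 - {f}) M1 < 1" using p1 p2 deg_nonneg[of F1 M1 f] by linarith
      ultimately show ?thesis by (simp add: new F1_def M1_def)
    qed
  next
    \<comment> \<open>Maker has played outside the clique game; whatever Breaker claims now, the
      potential and the degrees do not grow.\<close>
    case False
    have sub: "nsets X 2 \<subseteq> insert e (M \<union> Z) \<longleftrightarrow> nsets X 2 \<subseteq> M \<union> Z" if "X \<in> nsets S k" for X Z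
      using sub_SS[OF that] False by blast
    have potM: "pot Z (insert e M) = pot Z M" for Z
      unfolding pot_def by (rule sum.cong) (auto simp: sub)
    have degM: "deg Z (insert e M) g = deg Z M g" for Z g
      unfolding deg_def by (rule sum.cong) (auto simp: sub)
    have Fe: "F - {e} = F" using False by (auto simp: F_def Fr_def)
    have IH: "pot F M < 1" "\<And>g. g \<in> F \<Longrightarrow> pot F M + deg F M g < 1" using Suc by (auto simp: F_def M_def)
    have "pot (F - {f}) M \<le> pot F M"
    proof (cases "f \<in> F")
      case True
      then show ?thesis using pot_breaker[OF True MF] deg_nonneg[of F M f] by simp
    qed simp
    then show ?thesis using IH deg_breaker[OF MF, of f]
      unfolding new potM degM Fe by (smt (verit) Diff_iff)
  qed
qed

lemma finite_maker_subset:
  assumes "finite Z" "Z \<subseteq> maker_edges p"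
  shows "\<exists>n. Z \<subseteq> Mk n"
proof -
  have "\<forall>z\<in>Z. \<exists>i. z = p (2 * i)" using assms(2) by (auto simp: maker_edges_def)
  then obtain i where i: "\<And>z. z \<in> Z \<Longrightarrow> z = p (2 * i z)" by metis
  obtain n where "\<And>z. z \<in> Z \<Longrightarrow> i z < n" using finite_nat_set_iff_bounded[of "i ` Z"] assms(1) by auto
  then show ?thesis using i by (intro exI[of _ n]) (auto simp: Mk_def)
qed

text \<open>None of the edges of a completed \<open>k\<close>-clique is free, so it alone
  contributes 1 to the potential.\<close>

lemma small_clique:
  assumes K: "nsets K 2 \<subseteq> maker_edges p"
  shows "card (K \<inter> S) < k"
proof (rule ccontr)
  assume "\<not> ?thesis"
  then obtain X where X: "X \<subseteq> K \<inter> S" "card X = k" "finite X"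
    using obtain_subset_with_card_n[of k "K \<inter> S"] by auto
  then have XI: "X \<in> nsets S k" by (auto simp: nsets_def)
  have "nsets X 2 \<subseteq> nsets K 2" using X by (intro nsets_mono) auto
  then obtain n where n: "nsets X 2 \<subseteq> Mk n"
    using finite_maker_subset[of "nsets X 2"] X K finite_imp_finite_nsets by blast
  have e: "nsets X 2 \<inter> Fr n = {}" using n by (auto simp: Fr_def)
  have "(if nsets X 2 \<subseteq> Mk n \<union> Fr n then 1 / 2 ^ card (nsets X 2 \<inter> Fr n) else (0::real)) \<le> pot (Fr n) (Mk n)"
    unfolding pot_def by (rule member_le_sum[OF XI]) (use finI in auto)
  then have "1 \<le> pot (Fr n) (Mk n)" using n by (simp add: e le_supI1)
  then show False using potential_small[of n] by simp
qed

text \<open>When Maker takes the earlier of the two edges, the other one is still free and is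
  Breaker's answer.\<close>

lemma not_both_paired:
  assumes "paired H colouring e e'" "e \<in> maker_edges p" "e' \<in> maker_edges p"
  shows False
proof -
  have *: False if pr: "paired H colouring (p (2 * i)) (p (2 * j))" and ij: "i < j" for i j
  proof -
    have "(THE e'. paired H colouring (p (2 * i)) e') = p (2 * j)"
      by (rule the_equality, rule pr, rule paired_unique[of H colouring, OF colouring(3) _ pr])
    then have c: "candidate (Mk (Suc i)) (insert (p (2 * i)) (Mk i \<union> Br i)) (p (2 * i)) = p (2 * j)"
      using paired_SS[OF pr] by (simp add: candidate_def)
    have "p (2 * j) \<notin> Mk j \<union> Br j" by (rule new_move)
    moreover have "insert (p (2 * i)) (Mk i \<union> Br i) \<subseteq> Mk j \<union> Br j" using ij by (auto simp: Mk_def Br_def intro: less_trans)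
    ultimately have "p (2 * j) \<in> board_edges - insert (p (2 * i)) (Mk i \<union> Br i)" using p_board by blast
    then have "p (2 * i + 1) = p (2 * j)" using reply[of i] c by simp
    then show False by (simp add: inj_p) presburger
  qed
  obtain i j where ij: "e = p (2 * i)" "e' = p (2 * j)" using assms(2,3) by (auto simp: maker_edges_def)
  have "e \<noteq> e'" using assms(1) by (auto simp: paired_def)
  then consider "i < j" | "j < i" using ij by (metis linorder_neqE_nat)
  then show False using * assms(1) paired_sym[of H, OF H_sym assms(1)] ij by cases auto
qed

text \<open>Each of the finitely many ordered pairs of colours occurs on at most one edge of the
  clique: for two such edges, \<open>{x1, y2}\<close> and \<open>{x2, y1}\<close> would be paired
  and both Maker's.\<close>

lemma finite_H_edges:
  assumes K: "nsets K 2 \<subseteq> maker_edges p"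
  shows "finite {e \<in> nsets K 2. \<exists>x y. e = {x, y} \<and> H x y}"
proof -
  obtain D where D: "\<And>n. colouring n \<le> D" using colouring(1) by blast
  define P where "P \<alpha> \<beta> = {e \<in> nsets K 2. \<exists>x y. e = {x, y} \<and> H x y \<and> colouring x = \<alpha> \<and> colouring y = \<beta>}" for \<alpha> \<beta>
  have uniq: "e1 = e2" if e: "e1 \<in> P \<alpha> \<beta>" "e2 \<in> P \<alpha> \<beta>" for e1 e2 \<alpha> \<beta>
  proof (rule ccontr)
    assume ne: "e1 \<noteq> e2"
    obtain x1 y1 where 1: "e1 = {x1, y1}" "H x1 y1" "colouring x1 = \<alpha>" "colouring y1 = \<beta>" "x1 \<in> K" "y1 \<in> K"
      using e(1) by (auto simp: P_def)
    obtain x2 y2 where 2: "e2 = {x2, y2}" "H x2 y2" "colouring x2 = \<alpha>" "colouring y2 = \<beta>" "x2 \<in> K" "y2 \<in> K"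
      using e(2) by (auto simp: P_def)
    have ab: "\<alpha> \<noteq> \<beta>" using colouring(2)[OF 1(2)] 1 by simp
    have x: "x1 \<noteq> x2" using colouring(3)[of x1 y1 y2] 1 2 ne by auto
    have y: "y1 \<noteq> y2" using colouring(3)[of y1 x1 x2] H_sym 1 2 ne by auto
    have "{x1, y2} \<noteq> {x2, y1}" using x ab 1 2 by (auto simp: doubleton_eq_iff)
    then have "{x1, y2} = {x1, y2} \<and> {x2, y1} = {x2, y1} \<and> colouring x1 \<noteq> colouring y2 \<and> H x1 y1 \<and> H y2 x2 \<and>
        colouring y1 = colouring y2 \<and> colouring x2 = colouring x1 \<and> {x1, y2} \<noteq> {x2, y1}"
      using 1(2-4) 2(3,4) ab H_sym[OF 2(2)] by simp
    then have "paired H colouring {x1, y2} {x2, y1}"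
      unfolding paired_def by (intro exI)
    moreover have "x1 \<noteq> y2" "x2 \<noteq> y1" using ab 1 2 by auto
    then have "{x1, y2} \<in> maker_edges p" "{x2, y1} \<in> maker_edges p" using K 1 2 by auto
    ultimately show False using not_both_paired by blast
  qed
  have single: "P \<alpha> \<beta> \<subseteq> {e}" if "e \<in> P \<alpha> \<beta>" for e \<alpha> \<beta>
    using uniq[OF _ that] by (intro subsetI) simp
  have "finite (P \<alpha> \<beta>)" for \<alpha> \<beta>
  proof (cases "P \<alpha> \<beta> = {}")
    case False
    then obtain e where "e \<in> P \<alpha> \<beta>" by (metis all_not_in_conv)
    from single[OF this] show ?thesis by (rule finite_subset) simp
  qed simp
  moreover have "{e \<in> nsets K 2. \<exists>x y. e = {x, y} \<and> H x y} \<subseteq> (\<Union>\<alpha>\<in>{..D}. \<Union>\<beta>\<in>{..D}. P \<alpha> \<beta>)"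
    using D by (auto simp: P_def)
  ultimately show ?thesis by (rule_tac finite_subset) auto
qed

end

theorem breaker_strategy:
  "\<exists>\<sigma>. is_strategy \<sigma> \<and> breaker_ensures \<sigma> (\<lambda>p. \<forall>K. nsets K 2 \<subseteq> maker_edges p \<longrightarrow>
     card (K \<inter> S) < k \<and> finite {e \<in> nsets K 2. \<exists>x y. e = {x, y} \<and> H x y})"
  using is_strategy_strategy small_clique finite_H_edges
  by (intro exI[of _ strategy]) (auto simp: breaker_ensures_def)

end

section \<open>The two parts of the theorem\<close>

lemma power_div_fact_le_exp:
  assumes "x \<ge> (0::real)"
  shows "x ^ m / fact m \<le> exp x"
proof -
  have "(\<Sum>n\<in>{m}. x ^ n /\<^sub>R fact n) \<le> (\<Sum>n. x ^ n /\<^sub>R fact n)"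
    using exp_converges[of x] assms by (intro sum_le_suminf) (auto simp: sums_iff)
  then show ?thesis using exp_converges[of x] by (simp add: sums_iff field_simps)
qed

text \<open>From \<open>m ^ m / fact m \<le> exp 1 ^ m\<close> follows
  \<open>N choose m \<le> (N * exp 1 / m) ^ m\<close>, and the hypothesis bounds the base by
  \<open>2 powr (m / 2 - 1)\<close>. The exponents compare strictly only for \<open>m > 2\<close>;
  for \<open>m \<le> 2\<close> the hypothesis forces \<open>N < m\<close>.\<close>

lemma breaker_count:
  assumes N: "real N \<le> real m / exp 1 * 2 powr (real m / 2 - 1)" and m: "m \<ge> 1"
  shows "2 * (N choose m) < 2 ^ (m choose 2)"
proof (cases "m \<ge> 3")
  case False
  have e: "exp 1 \<ge> (2::real)" using exp_ge_add_one_self[of 1] by simp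
  have "N < m"
  proof (cases "m = 1")
    case True
    have "2 powr (- 1 / 2) \<le> (1::real)" using powr_mono[of "- 1 / 2" 0 "2::real"] by simp
    then have "1 / exp 1 * 2 powr (- 1 / 2) \<le> 1 / 2 * (1::real)" using e by (intro mult_mono) (auto simp: field_simps)
    moreover have "real N \<le> 1 / exp 1 * 2 powr (- 1 / 2)" using N True by simp
    ultimately have "real N < 1" by linarith
    then show ?thesis using True by simp
  next
    case False
    then have m2: "m = 2" using \<open>\<not> m \<ge> 3\<close> m by simp
    have "2 / exp 1 \<le> (1::real)" using e by simp
    moreover have "real N \<le> 2 / exp 1" using N m2 by simp
    ultimately have "real N \<le> 1" by linarith
    then show ?thesis using m2 by simp
  qed
  then show ?thesis by (simp add: binomial_eq_0)
next
  case True
  have "real (N choose m) * fact m \<le> real N ^ m"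
    using binomial_fact_pow[of N m] by (metis of_nat_fact of_nat_le_iff of_nat_mult of_nat_power)
  then have 1: "real (N choose m) \<le> real N ^ m / fact m" by (simp add: field_simps)
  have "real m ^ m / fact m \<le> exp 1 ^ m" using power_div_fact_le_exp[of "real m" m] by (simp add: exp_of_nat_mult[symmetric])
  then have "real N ^ m / fact m \<le> (real N * exp 1 / real m) ^ m"
    using True mult_left_mono[of "real m ^ m / fact m" "exp 1 ^ m" "real N ^ m / real m ^ m"]
    by (simp add: power_divide power_mult_distrib)
  also have "real N * exp 1 / real m \<le> 2 powr (real m / 2 - 1)"
    using N True by (simp add: field_simps)
  then have "(real N * exp 1 / real m) ^ m \<le> (2 powr (real m / 2 - 1)) ^ m"
    by (intro power_mono) auto
  also have "\<dots> = 2 powr ((real m / 2 - 1) * real m)" by (simp add: powr_realpow[symmetric] powr_powr)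
  finally have "2 * real (N choose m) \<le> 2 powr 1 * 2 powr ((real m / 2 - 1) * real m)" using 1 by simp
  also have "\<dots> = 2 powr (1 + (real m / 2 - 1) * real m)" by (rule powr_add[symmetric])
  also have "\<dots> < 2 powr real (m choose 2)"
  proof (rule powr_less_mono)
    have "real (m choose 2) = real m * (real m - 1) / 2"
      using True by (simp add: choose_two real_of_nat_div of_nat_diff)
    then show "1 + (real m / 2 - 1) * real m < real (m choose 2)" using True by (simp add: field_simps)
  qed simp
  also have "\<dots> = real (2 ^ (m choose 2))" by (simp add: powr_realpow)
  finally have "real (2 * (N choose m)) < real (2 ^ (m choose 2))" by simp
  then show ?thesis by (simp only: of_nat_less_iff)
qed

section \<open>Degrees and orders of subgraphs\<close>

lemma delete_verts_board: "subgraph G board \<Longrightarrow> subgraph (delete_verts G S) board"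
  by (auto simp: subgraph_def wf_graph_def delete_verts_def nsets_def)

lemma nbrs_delete_verts: "v \<notin> S \<Longrightarrow> nbrs (delete_verts G S) v = nbrs G v - S"
  by (auto simp: nbrs_def delete_verts_def)

lemma nbrs_verts: "subgraph G board \<Longrightarrow> nbrs G v \<noteq> {} \<Longrightarrow> v \<in> verts G"
  using board_graph_edges[of G] by (auto simp: nbrs_def nsets_def)

lemma bounded_outside:
  assumes G: "subgraph G board" and "max_degree (delete_verts G S) < \<infinity>"
  shows "\<exists>D. \<forall>v. v \<notin> S \<longrightarrow> finite (nbrs G v - S) \<and> card (nbrs G v - S) \<le> D"
proof -
  obtain D where D: "max_degree (delete_verts G S) = enat D" using assms(2) by (cases "max_degree (delete_verts G S)") auto
  have "finite (nbrs G v - S) \<and> card (nbrs G v - S) \<le> D" if v: "v \<notin> S" for v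
  proof (cases "v \<in> verts G")
    case True
    then have "v \<in> verts (delete_verts G S)" using v by (simp add: delete_verts_def)
    then have "degree (delete_verts G S) v \<le> max_degree (delete_verts G S)" unfolding max_degree_def by (rule SUP_upper)
    then show ?thesis
      by (simp add: D degree_eq[OF delete_verts_board[OF G]] nbrs_delete_verts[OF v] split: if_splits)
  next
    case False
    then have "nbrs G v = {}" using nbrs_verts[OF G] by blast
    then show ?thesis by simp
  qed
  then show ?thesis by blast
qed

lemma has_order_if_bounded:
  assumes G: "subgraph G board" and S: "finite S" and bd: "\<And>v. v \<notin> S \<Longrightarrow> finite (nbrs G v) \<and> card (nbrs G v) \<le> D"
  shows "has_order G (card {v \<in> verts G. degree G v = \<infinity>})" "{v \<in> verts G. degree G v = \<infinity>} \<subseteq> S"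
proof -
  let ?I = "{v \<in> verts G. degree G v = \<infinity>}"
  show IS: "?I \<subseteq> S" using bd by (auto simp: degree_eq[OF G] split: if_splits)
  then have finI: "finite ?I" using S finite_subset by blast
  \<comment> \<open>Vertices of \<open>S\<close> with finite degree stay in the graph and must be
    covered by the bound; infinite neighbourhoods contribute \<open>card = 0\<close> to the
    sum.\<close>
  define D' where "D' = D + (\<Sum>v\<in>S. card (nbrs G v))"
  have "degree (delete_verts G ?I) v \<le> enat D'" if v: "v \<in> verts (delete_verts G ?I)" for v
  proof -
    have v': "v \<in> verts G" "v \<notin> ?I" using v by (auto simp: delete_verts_def)
    then have fin: "finite (nbrs G v)" by (auto simp: degree_eq[OF G] split: if_splits)
    have "card (nbrs G v) \<le> D'"
    proof (cases "v \<in> S")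
      case True
      then have "card (nbrs G v) \<le> (\<Sum>v\<in>S. card (nbrs G v))" using S by (intro member_le_sum) auto
      then show ?thesis by (simp add: D'_def)
    next
      case False
      then show ?thesis using bd[OF False] by (simp add: D'_def)
    qed
    moreover have "card (nbrs G v - ?I) \<le> card (nbrs G v)" using fin by (intro card_mono) auto
    ultimately show ?thesis
      using fin by (simp add: degree_eq[OF delete_verts_board[OF G]] nbrs_delete_verts[OF v'(2)])
  qed
  then have "max_degree (delete_verts G ?I) \<le> enat D'" unfolding max_degree_def by (intro SUP_least)
  then have "max_degree (delete_verts G ?I) < \<infinity>" by (rule le_less_trans) simp
  then show "has_order G (card ?I)" unfolding has_order_def using finI by (intro exI[of _ ?I]) auto
qed

theorem breaker_part:
  assumes A: "finite A" "A \<noteq> {}"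
    and G: "\<And>i. i \<in> A \<Longrightarrow> subgraph (G i) board"
    and ord: "\<And>j. j \<in> A \<Longrightarrow> has_order (G j) (C j)"
    and bound: "ereal (real (\<Sum>j\<in>A. C j)) \<le> breaker_bound (cover_number G A)"
  shows "\<exists>\<sigma>. is_strategy \<sigma> \<and> breaker_ensures \<sigma> (\<lambda>p. \<forall>K. maker_clique p K \<longrightarrow>
     (\<exists>j\<in>A. finite (edges K \<inter> edges (G j))) \<and>
     (\<exists>r. has_order (graph_Inter (graph_Union G A) K) r \<and> enat r < cover_number G A))"
  (is "\<exists>\<sigma>. _ \<and> breaker_ensures \<sigma> (\<lambda>p. \<forall>K. _ \<longrightarrow> ?P K)")
proof -
  let ?m = "cover_number G A"
  have "\<forall>j\<in>A. \<exists>S. finite S \<and> card S = C j \<and> max_degree (delete_verts (G j) S) < \<infinity> \<and>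
      (\<forall>v\<in>S. degree (G j) v = \<infinity>)"
    using ord unfolding has_order_def by blast
  then obtain S where "\<forall>j\<in>A. finite (S j) \<and> card (S j) = C j \<and> max_degree (delete_verts (G j) (S j)) < \<infinity> \<and>
      (\<forall>v\<in>S j. degree (G j) v = \<infinity>)" by (rule bchoice[THEN exE])
  then have S: "\<And>j. j \<in> A \<Longrightarrow> finite (S j)" "\<And>j. j \<in> A \<Longrightarrow> card (S j) = C j"
    "\<And>j. j \<in> A \<Longrightarrow> max_degree (delete_verts (G j) (S j)) < \<infinity>"
    "\<And>j v. j \<in> A \<Longrightarrow> v \<in> S j \<Longrightarrow> degree (G j) v = \<infinity>" by blast+
  define R where "R = (\<Union>j\<in>A. S j)"
  have finR: "finite R" using A S(1) by (simp add: R_def)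
  have cR: "card R \<le> (\<Sum>j\<in>A. C j)"
    unfolding R_def using card_UN_le[OF A(1), of S] S(2) by simp
  have cover: "?m \<le> enat (card W)" if "finite W" "\<And>j. j \<in> A \<Longrightarrow> \<exists>v\<in>W. degree (G j) v = \<infinity>" for W
    unfolding cover_number_def by (rule INF_lower) (use that in \<open>auto simp: board_def complete_graph_def\<close>)
  obtain D where D: "\<And>j v. j \<in> A \<Longrightarrow> v \<notin> S j \<Longrightarrow> finite (nbrs (G j) v - S j) \<and> card (nbrs (G j) v - S j) \<le> D j"
    using bounded_outside[OF G S(3)] by metis
  have fin_nbrs: "finite (nbrs (G j) v)" "card (nbrs (G j) v) \<le> D j + C j" if "j \<in> A" "v \<notin> S j" for j v
  proof -
    have sub: "nbrs (G j) v \<subseteq> (nbrs (G j) v - S j) \<union> S j" by blast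
    have f: "finite ((nbrs (G j) v - S j) \<union> S j)" using D[OF that] S(1)[OF that(1)] by simp
    show "finite (nbrs (G j) v)" using sub f by (rule finite_subset)
    have "card (nbrs (G j) v) \<le> card ((nbrs (G j) v - S j) \<union> S j)" by (rule card_mono[OF f sub])
    also have "\<dots> \<le> card (nbrs (G j) v - S j) + card (S j)" by (rule card_Un_le)
    finally show "card (nbrs (G j) v) \<le> D j + C j" using D[OF that] S(2)[OF that(1)] by simp
  qed
  \<comment> \<open>If \<open>m(A)\<close> is infinite, \<open>k\<close> is too large for cliques inside \<open>R\<close> to matter.\<close>
  define k where "k = (case ?m of enat n \<Rightarrow> n | \<infinity> \<Rightarrow> Suc (card R))"
  have few: "2 * (card R choose k) < 2 ^ (k choose 2)"
  proof (cases ?m)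
    case (enat n)
    have "n \<ge> 1"
    proof (rule ccontr)
      assume "\<not> n \<ge> 1"
      then have "?m < enat 1" using enat by simp
      then obtain W where W: "finite W" "\<forall>j\<in>A. \<exists>v\<in>W. degree (G j) v = \<infinity>" "enat (card W) < enat 1"
        unfolding cover_number_def by (auto simp: INF_less_iff)
      then have "W = {}" by simp
      then show False using W(2) A(2) by blast
    qed
    moreover have "real (card R) \<le> real n / exp 1 * 2 powr (real n / 2 - 1)"
    proof -
      have "real (card R) \<le> real (\<Sum>j\<in>A. C j)" using cR by (simp only: of_nat_le_iff)
      also have "\<dots> \<le> real n / exp 1 * 2 powr (real n / 2 - 1)" using bound by (simp add: enat breaker_bound_def)
      finally show ?thesis .
    qed
    ultimately show ?thesis using breaker_count by (simp add: k_def enat)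
  next
    case infinity
    then show ?thesis by (simp add: k_def binomial_eq_0)
  qed
  define H where "H u v \<longleftrightarrow> u \<notin> R \<and> v \<notin> R \<and> (\<exists>j\<in>A. {u, v} \<in> edges (G j))" for u v
  define d where "d = (\<Sum>j\<in>A. D j + C j)"
  have union_nbrs: "finite (\<Union>j\<in>A. nbrs (G j) v) \<and> card (\<Union>j\<in>A. nbrs (G j) v) \<le> d" if v: "v \<notin> R" for v
  proof
    have vS: "v \<notin> S j" if "j \<in> A" for j using v that by (auto simp: R_def)
    show "finite (\<Union>j\<in>A. nbrs (G j) v)" using A(1) fin_nbrs(1) vS by blast
    have "card (\<Union>j\<in>A. nbrs (G j) v) \<le> (\<Sum>j\<in>A. card (nbrs (G j) v))" by (rule card_UN_le[OF A(1)])
    also have "\<dots> \<le> d" unfolding d_def by (rule sum_mono) (use fin_nbrs(2) vS in blast)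
    finally show "card (\<Union>j\<in>A. nbrs (G j) v) \<le> d" .
  qed
  interpret breaker_game R k H d
  proof
    show "finite R" by (rule finR)
    show "2 * (card R choose k) < 2 ^ (k choose 2)" by (rule few)
    show "H u v \<Longrightarrow> H v u" for u v by (auto simp: H_def insert_commute)
    show "\<not> H v v" for v using not_in_nbrs[OF G] by (auto simp: H_def nbrs_def)
    show "H u v \<Longrightarrow> u \<notin> R" for u v by (simp add: H_def)
    show "finite {u. H v u} \<and> card {u. H v u} \<le> d" for v
    proof (cases "v \<in> R")
      case True
      then have "{u. H v u} = {}" by (simp add: H_def)
      then show ?thesis by simp
    next
      case False
      have sub: "{u. H v u} \<subseteq> (\<Union>j\<in>A. nbrs (G j) v)" by (auto simp: H_def nbrs_def)
      show ?thesis
        using finite_subset[OF sub] card_mono[OF _ sub] union_nbrs[OF False] by (meson le_trans)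
    qed
  qed
  obtain \<sigma> where \<sigma>: "is_strategy \<sigma>" "breaker_ensures \<sigma> (\<lambda>p. \<forall>K. nsets K 2 \<subseteq> maker_edges p \<longrightarrow>
     card (K \<inter> R) < k \<and> finite {e \<in> nsets K 2. \<exists>x y. e = {x, y} \<and> H x y})"
    using breaker_strategy by blast
  have main: "?P K"
    if K: "maker_clique p K" and br: "\<forall>K. nsets K 2 \<subseteq> maker_edges p \<longrightarrow>
     card (K \<inter> R) < k \<and> finite {e \<in> nsets K 2. \<exists>x y. e = {x, y} \<and> H x y}" for p K
  proof -
    let ?V = "verts K"
    have eK: "edges K = nsets ?V 2" using K unfolding maker_clique_def
      by (metis complete_graph_def graph.select_convs(2))
    have "nsets ?V 2 \<subseteq> maker_edges p" using K eK by (simp add: maker_clique_def)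
    from br[rule_format, OF this]
    have small: "card (?V \<inter> R) < k" and finH: "finite {e \<in> nsets ?V 2. \<exists>x y. e = {x, y} \<and> H x y}" by auto
    have lt: "enat (card (?V \<inter> R)) < ?m"
      using small by (cases ?m) (auto simp: k_def)
    have "\<exists>j\<in>A. ?V \<inter> S j = {}"
    proof (rule ccontr)
      assume no: "\<not> ?thesis"
      have "?m \<le> enat (card (?V \<inter> R))"
      proof (rule cover)
        show "finite (?V \<inter> R)" using finR by simp
        fix j assume j: "j \<in> A"
        then obtain v where "v \<in> ?V \<inter> S j" using no by blast
        then show "\<exists>v\<in>?V \<inter> R. degree (G j) v = \<infinity>" using S(4) j by (auto simp: R_def)
      qed
      then show False using lt by simp
    qed
    then obtain j where j: "j \<in> A" "?V \<inter> S j = {}" by blast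
    \<comment> \<open>An edge that avoids \<open>R\<close> belongs to \<open>H\<close>, where the
      pairing applies. Any other one has an end in \<open>R - S j\<close>, a vertex of finite degree
      in \<open>G j\<close> although its degree is infinite in another graph of the family.\<close>
    have "edges K \<inter> edges (G j) \<subseteq> {e \<in> nsets ?V 2. \<exists>x y. e = {x, y} \<and> H x y} \<union>
        (\<Union>v\<in>R - S j. {e \<in> edges (G j). v \<in> e})"
    proof
      fix e assume e: "e \<in> edges K \<inter> edges (G j)"
      then obtain x y where xy: "e = {x, y}" "x \<in> ?V" "y \<in> ?V" unfolding eK by (auto elim: nsets2_E)
      then have xS: "x \<notin> S j" "y \<notin> S j" using j(2) by auto
      show "e \<in> {e \<in> nsets ?V 2. \<exists>x y. e = {x, y} \<and> H x y} \<union> (\<Union>v\<in>R - S j. {e \<in> edges (G j). v \<in> e})"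
      proof (cases "x \<in> R \<or> y \<in> R")
        case True
        then show ?thesis using e xS xy by auto
      next
        case False
        then have "H x y" using e xy j(1) by (auto simp: H_def)
        then show ?thesis using e xy eK by blast
      qed
    qed
    moreover have "finite {e \<in> edges (G j). v \<in> e}" if "v \<in> R - S j" for v
      unfolding incident_edges[OF G[OF j(1)]] using fin_nbrs(1)[OF j(1)] that by blast
    ultimately have "finite (edges K \<inter> edges (G j))"
      using finH finR by (elim finite_subset) blast
    moreover have "\<exists>r. has_order (graph_Inter (graph_Union G A) K) r \<and> enat r < ?m"
    proof -
      let ?G = "graph_Inter (graph_Union G A) K"
      have sub: "subgraph ?G board"
      proof -
        have "e \<in> nsets (verts ?G) 2" if e: "e \<in> edges ?G" for e
        proof -
          obtain j where "j \<in> A" "e \<in> edges (G j)" "e \<in> nsets ?V 2"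
            using e eK by (auto simp: graph_Inter_def graph_Union_def)
          then show ?thesis using board_graph_edges[OF G[of j]]
            by (fastforce simp: graph_Inter_def graph_Union_def nsets_def)
        qed
        then show ?thesis
          by (auto simp: subgraph_def wf_graph_def board_def complete_graph_def nsets_def)
      qed
      have bd: "finite (nbrs ?G v) \<and> card (nbrs ?G v) \<le> d" if "v \<notin> R" for v
      proof -
        have s: "nbrs ?G v \<subseteq> (\<Union>j\<in>A. nbrs (G j) v)" by (auto simp: nbrs_def graph_Inter_def graph_Union_def)
        show ?thesis using finite_subset[OF s] card_mono[OF _ s] union_nbrs[OF that] by (meson le_trans)
      qed
      \<comment> \<open>Outside \<open>R\<close> the degrees are bounded by \<open>d\<close>, so
        infinite degrees occur only in \<open>?V \<inter> R\<close>, which is smaller than any cover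
        of \<open>A\<close>.\<close>
      let ?I = "{v \<in> verts ?G. degree ?G v = \<infinity>}"
      have "?I \<subseteq> ?V \<inter> R" using has_order_if_bounded(2)[OF sub finR bd] by (auto simp: graph_Inter_def)
      then have "card ?I \<le> card (?V \<inter> R)" using finR by (intro card_mono) auto
      then have "enat (card ?I) < ?m" using lt by (meson enat_ord_simps(1) le_less_trans)
      then show ?thesis using has_order_if_bounded(1)[OF sub finR bd] by blast
    qed
    ultimately show ?thesis using j(1) by blast
  qed
  have "breaker_ensures \<sigma> (\<lambda>p. \<forall>K. maker_clique p K \<longrightarrow> ?P K)"
    unfolding breaker_ensures_def
  proof (intro allI impI)
    fix p K assume p: "is_play p \<and> (\<forall>n. p (2 * n + 1) = \<sigma> (map p [0..<2 * n + 1]))" and K: "maker_clique p K"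
    from \<sigma>(2)[unfolded breaker_ensures_def, rule_format, OF p]
    show "?P K" by (intro main[OF K]) blast
  qed
  then show ?thesis using \<sigma>(1) by blast
qed

theorem theorem1p5:
  shows "\<exists>\<epsilon>1 \<epsilon>2 :: nat \<Rightarrow> real. \<epsilon>1 \<longlonglongrightarrow> 0 \<and> \<epsilon>2 \<longlonglongrightarrow> 0 \<and>
    (\<forall>(s :: nat) (t :: nat) (G :: nat \<Rightarrow> graph) (C :: nat \<Rightarrow> nat).
       (\<forall>i\<in>{1..s + t}. subgraph (G i) board \<and> infinite_graph (G i)) \<and>
       (\<forall>i\<in>{1..s}. has_order (G i) (C i)) \<and>
       (\<forall>i\<in>{s + 1..s + t}. ascending (G i)) \<longrightarrow>
       ((\<forall>i\<in>{1..s}. real (C i) \<ge>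
            max (2 powr (real t * 2 powr ((1 + \<epsilon>1 s) * (3 * real s))))
                (2 powr (2 powr ((1 + \<epsilon>2 s) * real s)))) \<longrightarrow>
          (\<exists>\<sigma>. maker_winning_strategy G {1..s + t} \<sigma>)) \<and>
       (\<forall>A. A \<noteq> {} \<and> A \<subseteq> {1..s} \<and>
          ereal (real (\<Sum>j\<in>A. C j)) \<le> breaker_bound (cover_number G A) \<longrightarrow>
          (\<exists>\<sigma>. breaker_winning_strategy G {1..s + t} \<sigma> \<and>
             breaker_ensures \<sigma> (\<lambda>p. \<forall>K'. maker_clique p K' \<longrightarrow>
               (\<exists>r. has_order (graph_Inter (graph_Union G A) K') r \<and>
                    enat r < cover_number G A)))))"
proof (rule exI[of _ "\<lambda>_. 0"], rule exI[of _ eps2], intro conjI allI impI)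
  show "(\<lambda>_. 0 :: real) \<longlonglongrightarrow> 0" by simp
  show "eps2 \<longlonglongrightarrow> 0" by (rule eps2_tendsto)
  fix s t :: nat and G :: "nat \<Rightarrow> graph" and C :: "nat \<Rightarrow> nat"
  assume asm: "(\<forall>i\<in>{1..s + t}. subgraph (G i) board \<and> infinite_graph (G i)) \<and>
    (\<forall>i\<in>{1..s}. has_order (G i) (C i)) \<and> (\<forall>i\<in>{s + 1..s + t}. ascending (G i))"
  {
    assume C: "\<forall>i\<in>{1..s}. real (C i) \<ge> max (2 powr (real t * 2 powr ((1 + 0) * (3 * real s))))
                (2 powr (2 powr ((1 + eps2 s) * real s)))"
    show "\<exists>\<sigma>. maker_winning_strategy G {1..s + t} \<sigma>"
    proof (rule maker_part[where C = C])
      \<comment> \<open>The existence of \<open>i\<close> gives \<open>s \<ge> 1\<close>, as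
        required by \<open>maker_bound\<close>.\<close>
      show "2 powr (maker_poly s + 2 * real t * real (s + 1)) \<le> real (C i)" if "i \<in> {1..s}" for i
        using maker_bound[of s t] C that by (intro order_trans[OF maker_bound[of s t]]) auto
    qed (use asm in auto)
  next
    fix A assume A: "A \<noteq> {} \<and> A \<subseteq> {1..s} \<and> ereal (real (\<Sum>j\<in>A. C j)) \<le> breaker_bound (cover_number G A)"
    then have fin: "finite A" using finite_subset by blast
    have sub: "A \<subseteq> {1..s + t}" using A by auto
    obtain \<sigma> where \<sigma>: "is_strategy \<sigma>" "breaker_ensures \<sigma> (\<lambda>p. \<forall>K. maker_clique p K \<longrightarrow>
     (\<exists>j\<in>A. finite (edges K \<inter> edges (G j))) \<and>
     (\<exists>r. has_order (graph_Inter (graph_Union G A) K) r \<and> enat r < cover_number G A))"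
      using breaker_part[of A G C] fin A sub asm by blast
    show "\<exists>\<sigma>. breaker_winning_strategy G {1..s + t} \<sigma> \<and>
             breaker_ensures \<sigma> (\<lambda>p. \<forall>K'. maker_clique p K' \<longrightarrow>
               (\<exists>r. has_order (graph_Inter (graph_Union G A) K') r \<and> enat r < cover_number G A))"
      (is "\<exists>\<sigma>. _ \<and> ?ensures \<sigma>")
    proof (intro exI[of _ \<sigma>] conjI)
      show "breaker_winning_strategy G {1..s + t} \<sigma>"
        unfolding breaker_winning_strategy_def
      proof
        show "breaker_ensures \<sigma> (\<lambda>p. \<not> maker_wins_col G {1..s + t} p)"
          using \<sigma>(2) sub unfolding breaker_ensures_def maker_wins_col_def by (metis subset_iff)
      qed (rule \<sigma>(1))
      show "?ensures \<sigma>"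
        using \<sigma>(2) unfolding breaker_ensures_def by blast
    qed
  }
qed

end
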